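(* Let $H,U,A,B$ satisfy (H1)--(H4) (as stated in the context), let $\omega>0$, and let $\Lambda_\omega$, $C$, $\widetilde J$, $J$ and the group $U(t)$ be as defined in the context. For all $x,y\in H$ and $t\in\mathbb{R}$, $$\langle\Lambda_\omega^{-1}x,y\rangle_{H',H}=\langle\Lambda_\omega^{-1}U(t)x,U(t)y\rangle_{H',H}+\int_0^t\langle\widetilde JCU(s)x,CU(s)y\rangle_{H',H}\,ds+\int_0^t\langle JB^*\Lambda_\omega^{-1}U(s)x,B^*\Lambda_\omega^{-1}U(s)y\rangle_{U,U'}\,ds.$$
   Context: Spaces and pairings. $H$ (state space) and $U$ (control space) are Hilbert spaces with duals $H'$, $U'$; $L(X,Y)$ denotes bounded linear operators. $\widetilde J:H\to H'$ and $J:U'\to U$ are the canonical (Riesz) isomorphisms. In the complex case, duals consist of continuous antilinear functionals and pairings $\langle\cdot,\cdot\rangle$ are linear in the first and antilinear in the second argument, so that $\langle x,\widetilde J y\rangle_{H,H'}=(x,y)_H$ and $\langle Jx',y'\rangle_{U,U'}=(x',y')_{U'}$; $\langle x',x\rangle_{H',H}=\overline{\langle x,x'\rangle_{H,H'}}$. Adjoints $^*$ are taken with respect to these duality pairings. Hypotheses. (H1) $A:D(A)\subset H\to H$ generates a strongly continuous group $e^{tA}$ on $H$. Then $A^*:D(A^* )\subset H'\to H'$ generates the strongly continuous group $e^{tA^*}=(e^{tA})^*$ on $H'$. $D(A^* )$ is a Hilbert space with norm $\|x\|_{D(A^* )}^2=\|x\|_{H'}^2+\|A^*x\|_{H'}^2$,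 and $H\subset D(A^* )'$ via $\langle x,y\rangle_{D(A^* )',D(A^* )}=\langle x,y\rangle_{H,H'}$. (H2) $B\in L(U,D(A^* )')$; $B^*\in L(D(A^* ),U')$ denotes its adjoint (identifying $D(A^* )''$ with $D(A^* )$). (H3) For every $T>0$ there is $c_1(T)>0$ with $\int_0^T\|B^*e^{-tA^*}x\|_{U'}^2dt\le c_1(T)\|x\|_{H'}^2$ for all $x\in D(A^* )$. (H4) There are $T>0$ and $c_2(T)>0$ with $c_2(T)\|x\|_{H'}^2\le\int_0^T\|B^*e^{-tA^*}x\|_{U'}^2dt$ for all $x\in D(A^* )$. This $T$ is fixed from now on. Extension of $B^*$ along trajectories. For $y_0\in H'$ and $g\in L^1_{\rm loc}(\mathbb{R};H')$ put $y(t)=e^{-tA^*}y_0+\int_0^te^{-(t-r)A^*}g(r)\,dr$. For every $\tau>0$ there is $c>0$ such that $\int_{-\tau}^{\tau}\|B^*y(t)\|_{U'}^2dt\le c(\|y_0\|_{H'}^2+\|g\|_{L^1(-\tau,\tau;H')}^2)$ whenever $y_0\in D(A^* )$ and $g\in L^1(-\tau,\tau;D(A^* ))$. Hence $(y_0,g)\mapsto B^*y$ extends by density to all $y_0\in H'$, $g\in L^1_{\rm loc}(\mathbb{R};H')$, with values in $L^2_{\rm loc}(\mathbb{R};U')$; $B^*y$ denotes this extension. In particular ($g=0$) $t\mapsto B^*e^{-tA^*}x$ is an element of $L^2_{\rm loc}(\mathbb{R};U')$ for each $x\in H'$. Weighted Gramian. Fix $\omega>0$, set $T_\omega:=T+\frac1{2\omega}$,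 and let $e_\omega(s)=e^{-2\omega s}$ for $0\le s\le T$, $e_\omega(s)=2\omega e^{-2\omega T}(T_\omega-s)$ for $T\le s\le T_\omega$. The operator $\Lambda_\omega\in L(H',H)$ is defined by $$\langle\Lambda_\omega x,y\rangle_{H,H'}=\int_0^{T_\omega}e_\omega(s)\langle JB^*e^{-sA^*}x,B^*e^{-sA^*}y\rangle_{U,U'}ds,\qquad x,y\in H'.$$ It is self-adjoint, positive-definite and invertible, with $\Lambda_\omega^{-1}\in L(H,H')$. The operator $C$. Let $L\in L(H)$ be the positive-definite self-adjoint operator given by $$(Lx,y)_H=-\int_0^{T_\omega}e_\omega'(s)\langle JB^*e^{-sA^*}\Lambda_\omega^{-1}x,B^*e^{-sA^*}\Lambda_\omega^{-1}y\rangle_{U,U'}ds,$$ and $C:=\sqrt L\in L(H)$, with adjoint $C^*\in L(H')$, i.e. $\langle Cx,y\rangle_{H,H'}=\langle x,C^*y\rangle_{H,H'}$. Groups. $V(t)$ is the strongly continuous group on $H'$ generated by $-A^*-C^*\widetilde JC\Lambda_\omega$ with domain $D(A^* )$ (a bounded perturbation of $-A^*$); it satisfies $V(t)y_0=e^{-tA^*}y_0-\int_0^te^{-(t-r)A^*}C^*\widetilde JC\Lambda_\omega V(r)y_0\,dr$. Thus $t\mapsto B^*V(t)y_0$ is defined in $L^2_{\rm loc}(\mathbb{R};U')$ for every $y_0\in H'$ as the value, at the pair $(y_0,g)$ with $g=-C^*\widetilde JC\Lambda_\omega V(\cdot)y_0$, of the extension by density to $H'\times L^1_{\rm loc}(\mathbb{R};H')$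 of the map $(y_0,g)\mapsto B^*y$, where $y(t)=e^{-tA^*}y_0+\int_0^te^{-(t-r)A^*}g(r)\,dr$. For $x_0\in H$, $U(t)x_0:=\Lambda_\omega V(t)\Lambda_\omega^{-1}x_0$ (the group $U(t)$ on $H$ is not to be confused with the control space $U$); accordingly $B^*\Lambda_\omega^{-1}U(s)x_0$ means $B^*V(s)\Lambda_\omega^{-1}x_0$. *)

theory Defs
  imports "HOL-Analysis.Analysis"
begin

section \<open>Scalars and Hilbert spaces\<close>

text \<open>By the Gelfand--Mazur theorem the real and the complex numbers are, up to isomorphism, the only
  members of this class; the axioms force \<open>sconj\<close> to be complex conjugation (the identity on the
  reals). It serves to treat real and complex Hilbert spaces at once.\<close>

class real_or_complex = real_normed_field + euclidean_space +
  fixes sconj :: "'a \<Rightarrow> 'a"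
  assumes sconj_add: "sconj (x + y) = sconj x + sconj y"
    and sconj_mult: "sconj (x * y) = sconj x * sconj y"
    and sconj_scaleR_one: "sconj (r *\<^sub>R 1) = r *\<^sub>R 1"
    and sconj_sconj: "sconj (sconj x) = x"
    and mult_sconj: "x * sconj x = (norm x)\<^sup>2 *\<^sub>R 1"

instantiation real :: real_or_complex
begin
definition sconj_real :: "real \<Rightarrow> real" where "sconj_real x = x"
instance by standard (auto simp: sconj_real_def power2_eq_square)
end

instantiation complex :: real_or_complex
begin
definition sconj_complex :: "complex \<Rightarrow> complex" where "sconj_complex = cnj"
instance
proof
  show "x * sconj x = (norm x)\<^sup>2 *\<^sub>R 1" for x :: complex
    by (simp only: sconj_complex_def complex_norm_square[symmetric] scaleR_conv_of_real mult_1_right)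
qed (simp_all add: sconj_complex_def)
end

text \<open>Completeness is that of the class \<open>banach\<close>, whose norm is the one induced by \<open>ip\<close>.\<close>

locale hilbert_space = vector_space scl
  for scl :: "'k::real_or_complex \<Rightarrow> 'a::banach \<Rightarrow> 'a" +
  fixes ip :: "'a \<Rightarrow> 'a \<Rightarrow> 'k"
  assumes scale_of_real: "scl (of_real r) x = r *\<^sub>R x"
    and ip_add_left: "ip (x + y) z = ip x z + ip y z"
    and ip_scale_left: "ip (scl c x) y = c * ip x y"
    and ip_commute: "ip y x = sconj (ip x y)"
    and ip_self: "ip x x = of_real ((norm x)\<^sup>2)"

lemma hilbert_space_real:
  "hilbert_space (\<lambda>r x. r *\<^sub>R x) (\<lambda>x y :: 'a::{real_inner,banach}. x \<bullet> y)"
proof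
  show "y \<bullet> x = sconj (x \<bullet> y)" for x y :: 'a
    by (simp only: sconj_real_def inner_commute)
  show "x \<bullet> x = of_real ((norm x)\<^sup>2)" for x :: 'a
    by (simp only: power2_norm_eq_inner of_real_eq_id id_apply)
qed (simp_all only: scaleR_add_right scaleR_add_left inner_add_left inner_scaleR_left
       scaleR_scaleR scaleR_one of_real_eq_id id_apply real_scaleR_def)

lemma hilbert_space_complex: "hilbert_space (*) (\<lambda>x y :: complex. x * cnj y)"
proof
  show "y * cnj x = sconj (x * cnj y)" for x y :: complex
    by (simp only: sconj_complex_def complex_cnj_mult complex_cnj_cnj mult.commute)
  show "x * cnj x = of_real ((norm x)\<^sup>2)" for x :: complex
    by (rule complex_norm_square[symmetric])
qed (simp_all only: distrib_left distrib_right scaleR_conv_of_real mult.assoc mult_1_left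
       of_real_eq_id id_apply)

text \<open>The dual consists of the continuous antilinear functionals. Inside the space of bounded
  real-linear maps it is a closed subspace, from which it inherits its (operator) norm.\<close>

definition antidual :: "('k::real_or_complex \<Rightarrow> 'a::banach \<Rightarrow> 'a) \<Rightarrow> ('a \<Rightarrow>\<^sub>L 'k) set" where
  "antidual scl = {f. \<forall>c x. blinfun_apply f (scl c x) = sconj c * blinfun_apply f x}"

definition scale_dual :: "'k::real_or_complex \<Rightarrow> ('a::banach \<Rightarrow>\<^sub>L 'k) \<Rightarrow> ('a \<Rightarrow>\<^sub>L 'k)" where
  "scale_dual c f = Blinfun (\<lambda>x. c * blinfun_apply f x)"

text \<open>\<open>pair' x' x\<close> is the pairing of $X'$ with $X$, \<open>pair x x'\<close> that of $X$ with $X'$.\<close>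

definition pair' :: "('a::banach \<Rightarrow>\<^sub>L 'k::real_or_complex) \<Rightarrow> 'a \<Rightarrow> 'k" where
  "pair' x' x = blinfun_apply x' x"

definition pair :: "'a::banach \<Rightarrow> ('a \<Rightarrow>\<^sub>L 'k::real_or_complex) \<Rightarrow> 'k" where
  "pair x x' = sconj (pair' x' x)"

definition riesz :: "('a::banach \<Rightarrow> 'a \<Rightarrow> 'k::real_or_complex) \<Rightarrow> 'a \<Rightarrow> ('a \<Rightarrow>\<^sub>L 'k)" where
  "riesz ip y = Blinfun (\<lambda>x. ip y x)"

definition riesz_inv :: "('a::banach \<Rightarrow> 'a \<Rightarrow> 'k::real_or_complex) \<Rightarrow> ('a \<Rightarrow>\<^sub>L 'k) \<Rightarrow> 'a" where
  "riesz_inv ip = inv_into UNIV (riesz ip)"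

text \<open>Adjoint of a bounded operator, \<open>pair (F x) y' = pair x (adj F y')\<close>.\<close>

definition adj :: "('a::banach \<Rightarrow> 'b::banach) \<Rightarrow> ('b \<Rightarrow>\<^sub>L 'k::real_or_complex) \<Rightarrow> ('a \<Rightarrow>\<^sub>L 'k)" where
  "adj F y' = Blinfun (\<lambda>x. blinfun_apply y' (F x))"

section \<open>Operators and groups\<close>

text \<open>Operators are total functions of which only the values on the stated carrier or domain matter.\<close>

definition bounded_operator ::
    "('k \<Rightarrow> 'a::real_normed_vector \<Rightarrow> 'a) \<Rightarrow> 'a set \<Rightarrow> ('a \<Rightarrow> 'a) \<Rightarrow> bool" where
  "bounded_operator scl X F \<longleftrightarrow>
     (\<forall>x\<in>X. F x \<in> X) \<and>
     (\<forall>x\<in>X. \<forall>y\<in>X. F (x + y) = F x + F y) \<and>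
     (\<forall>c. \<forall>x\<in>X. F (scl c x) = scl c (F x)) \<and>
     (\<exists>K. \<forall>x\<in>X. norm (F x) \<le> K * norm x)"

definition strongly_continuous_group ::
    "('k \<Rightarrow> 'a::real_normed_vector \<Rightarrow> 'a) \<Rightarrow> 'a set \<Rightarrow> (real \<Rightarrow> 'a \<Rightarrow> 'a) \<Rightarrow> bool" where
  "strongly_continuous_group scl X S \<longleftrightarrow>
     (\<forall>t. bounded_operator scl X (S t)) \<and>
     (\<forall>x\<in>X. S 0 x = x) \<and>
     (\<forall>s t. \<forall>x\<in>X. S (s + t) x = S s (S t x)) \<and>
     (\<forall>x\<in>X. continuous_on UNIV (\<lambda>t. S t x))"

definition generates_group ::
    "('k \<Rightarrow> 'a::real_normed_vector \<Rightarrow> 'a) \<Rightarrow> 'a set \<Rightarrow> 'a set \<Rightarrow> ('a \<Rightarrow> 'a) \<Rightarrow>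
      (real \<Rightarrow> 'a \<Rightarrow> 'a) \<Rightarrow> bool" where
  "generates_group scl X D G S \<longleftrightarrow>
     strongly_continuous_group scl X S \<and>
     D = {x\<in>X. \<exists>y. ((\<lambda>t. (S t x - x) /\<^sub>R t) \<longlongrightarrow> y) (at 0)} \<and>
     (\<forall>x\<in>D. ((\<lambda>t. (S t x - x) /\<^sub>R t) \<longlongrightarrow> G x) (at 0))"

definition positive_sqrt ::
    "('k::real_or_complex \<Rightarrow> 'a::banach \<Rightarrow> 'a) \<Rightarrow> ('a \<Rightarrow> 'a \<Rightarrow> 'k) \<Rightarrow> ('a \<Rightarrow> 'a) \<Rightarrow> ('a \<Rightarrow> 'a) \<Rightarrow> bool"
  where
  "positive_sqrt scl ip L C \<longleftrightarrow>
     bounded_operator scl UNIV C \<and>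
     (\<forall>x y. ip (C x) y = ip x (C y)) \<and>
     (\<forall>x. \<exists>r\<ge>0. ip (C x) x = of_real r) \<and>
     (\<forall>x. C (C x) = L x)"

section \<open>Locally integrable functions with values in arbitrary Banach spaces\<close>

text \<open>Separability is not assumed, so strong measurability is required separately. The functions are
  everywhere defined, Borel representatives of their classes.\<close>

definition strongly_measurable :: "(real \<Rightarrow> 'a::real_normed_vector) \<Rightarrow> bool" where
  "strongly_measurable f \<longleftrightarrow>
     (\<exists>s. (\<forall>i::nat. simple_function lborel (s i)) \<and> (\<forall>x. (\<lambda>i. s i x) \<longlonglongrightarrow> f x))"

definition Lloc :: "nat \<Rightarrow> 'a::real_normed_vector set \<Rightarrow> (real \<Rightarrow> 'a) set" where
  "Lloc p X = {f. (\<forall>r. f r \<in> X) \<and> strongly_measurable f \<and>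
     (\<forall>\<tau>>0. (\<integral>\<^sup>+r\<in>{-\<tau>..\<tau>}. ennreal (norm (f r) ^ p) \<partial>lborel) < \<infinity>)}"

definition Lloc_tendsto ::
    "nat \<Rightarrow> (nat \<Rightarrow> real \<Rightarrow> 'a::real_normed_vector) \<Rightarrow> (real \<Rightarrow> 'a) \<Rightarrow> bool" where
  "Lloc_tendsto p fs f \<longleftrightarrow>
     (\<forall>\<tau>>0. (\<lambda>n. \<integral>\<^sup>+r\<in>{-\<tau>..\<tau>}. ennreal (norm (fs n r - f r) ^ p) \<partial>lborel) \<longlonglongrightarrow> 0)"

text \<open>Oriented integral of a vector-valued function. \<open>integral\<close> (Henstock--Kurzweil) is used since
  the Bochner integral of the library presupposes a separable range space; on Bochner integrable
  functions the two integrals agree.\<close>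

definition oriented_integral :: "real \<Rightarrow> real \<Rightarrow> (real \<Rightarrow> 'a::banach) \<Rightarrow> 'a" where
  "oriented_integral a b f = (if a \<le> b then integral {a..b} f else - integral {b..a} f)"

section \<open>The control system\<close>

text \<open>The values of \<open>opA\<close> matter only on \<open>domA\<close>. For a control \<open>u\<close>, \<open>opB \<Sigma> u\<close> is a functional
  on $D(A^*)$.\<close>

record (overloaded) ('k, 'h, 'u) control_system =
  scaleH :: "'k \<Rightarrow> 'h \<Rightarrow> 'h"
  ipH :: "'h \<Rightarrow> 'h \<Rightarrow> 'k"
  scaleU :: "'k \<Rightarrow> 'u \<Rightarrow> 'u"
  ipU :: "'u \<Rightarrow> 'u \<Rightarrow> 'k"
  domA :: "'h set"
  opA :: "'h \<Rightarrow> 'h"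
  opB :: "'u \<Rightarrow> ('h \<Rightarrow>\<^sub>L 'k) \<Rightarrow> 'k"

type_synonym ('k, 'h, 'u) csys = "('k, 'h, 'u) control_system"

abbreviation dualH :: "('k::real_or_complex, 'h::banach, 'u::banach) csys \<Rightarrow> ('h \<Rightarrow>\<^sub>L 'k) set" where
  "dualH \<Sigma> \<equiv> antidual (scaleH \<Sigma>)"

abbreviation dualU :: "('k::real_or_complex, 'h::banach, 'u::banach) csys \<Rightarrow> ('u \<Rightarrow>\<^sub>L 'k) set" where
  "dualU \<Sigma> \<equiv> antidual (scaleU \<Sigma>)"

abbreviation Jtilde :: "('k::real_or_complex, 'h::banach, 'u::banach) csys \<Rightarrow> 'h \<Rightarrow> ('h \<Rightarrow>\<^sub>L 'k)" where
  "Jtilde \<Sigma> \<equiv> riesz (ipH \<Sigma>)"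

abbreviation J :: "('k::real_or_complex, 'h::banach, 'u::banach) csys \<Rightarrow> ('u \<Rightarrow>\<^sub>L 'k) \<Rightarrow> 'u" where
  "J \<Sigma> \<equiv> riesz_inv (ipU \<Sigma>)"

text \<open>$e^{tA}$, $e^{tA^*} = (e^{tA})^*$ and the adjoint $A^*$ with its domain. A group is determined by
  its generator.\<close>

definition expA :: "('k::real_or_complex, 'h::banach, 'u::banach) csys \<Rightarrow> real \<Rightarrow> 'h \<Rightarrow> 'h" where
  "expA \<Sigma> = (SOME S. generates_group (scaleH \<Sigma>) UNIV (domA \<Sigma>) (opA \<Sigma>) S)"

definition expAstar ::
    "('k::real_or_complex, 'h::banach, 'u::banach) csys \<Rightarrow> real \<Rightarrow> ('h \<Rightarrow>\<^sub>L 'k) \<Rightarrow> ('h \<Rightarrow>\<^sub>L 'k)" where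
  "expAstar \<Sigma> t = adj (expA \<Sigma> t)"

definition domAstar :: "('k::real_or_complex, 'h::banach, 'u::banach) csys \<Rightarrow> ('h \<Rightarrow>\<^sub>L 'k) set" where
  "domAstar \<Sigma> = {x'\<in>dualH \<Sigma>. \<exists>z'\<in>dualH \<Sigma>. \<forall>x\<in>domA \<Sigma>. pair (opA \<Sigma> x) x' = pair x z'}"

definition opAstar ::
    "('k::real_or_complex, 'h::banach, 'u::banach) csys \<Rightarrow> ('h \<Rightarrow>\<^sub>L 'k) \<Rightarrow> ('h \<Rightarrow>\<^sub>L 'k)" where
  "opAstar \<Sigma> x' = (THE z'. z' \<in> dualH \<Sigma> \<and> (\<forall>x\<in>domA \<Sigma>. pair (opA \<Sigma> x) x' = pair x z'))"

text \<open>The product norm makes \<open>norm (embDAstar \<Sigma> x')\<close> the graph norm of $D(A^*)$.\<close>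

definition embDAstar ::
    "('k::real_or_complex, 'h::banach, 'u::banach) csys \<Rightarrow> ('h \<Rightarrow>\<^sub>L 'k) \<Rightarrow> ('h \<Rightarrow>\<^sub>L 'k) \<times> ('h \<Rightarrow>\<^sub>L 'k)" where
  "embDAstar \<Sigma> x' = (x', opAstar \<Sigma> x')"

text \<open>$B^*$ on $D(A^*)$, defined by \<open>pair u (Bstar \<Sigma> x') = opB \<Sigma> u x'\<close>.\<close>

definition Bstar ::
    "('k::real_or_complex, 'h::banach, 'u::banach) csys \<Rightarrow> ('h \<Rightarrow>\<^sub>L 'k) \<Rightarrow> ('u \<Rightarrow>\<^sub>L 'k)" where
  "Bstar \<Sigma> x' = Blinfun (\<lambda>u. sconj (opB \<Sigma> u x'))"

subsection \<open>Hypotheses\<close>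

definition H1 :: "('k::real_or_complex, 'h::banach, 'u::banach) csys \<Rightarrow> bool" where
  "H1 \<Sigma> \<longleftrightarrow> (\<exists>S. generates_group (scaleH \<Sigma>) UNIV (domA \<Sigma>) (opA \<Sigma>) S)"

text \<open>Antilinearity of each \<open>opB \<Sigma> u\<close>, linearity in \<open>u\<close>, and boundedness for the norms of $U$ and of
  the dual of $D(A^*)$.\<close>

definition H2 :: "('k::real_or_complex, 'h::banach, 'u::banach) csys \<Rightarrow> bool" where
  "H2 \<Sigma> \<longleftrightarrow>
     (\<forall>u. \<forall>x\<in>domAstar \<Sigma>. \<forall>y\<in>domAstar \<Sigma>. opB \<Sigma> u (x + y) = opB \<Sigma> u x + opB \<Sigma> u y) \<and>
     (\<forall>u c. \<forall>x\<in>domAstar \<Sigma>. opB \<Sigma> u (scale_dual c x) = sconj c * opB \<Sigma> u x) \<and>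
     (\<forall>u v. \<forall>x\<in>domAstar \<Sigma>. opB \<Sigma> (u + v) x = opB \<Sigma> u x + opB \<Sigma> v x) \<and>
     (\<forall>c u. \<forall>x\<in>domAstar \<Sigma>. opB \<Sigma> (scaleU \<Sigma> c u) x = c * opB \<Sigma> u x) \<and>
     (\<exists>K. \<forall>u. \<forall>x\<in>domAstar \<Sigma>. norm (opB \<Sigma> u x) \<le> K * norm u * norm (embDAstar \<Sigma> x))"

definition H3 :: "('k::real_or_complex, 'h::banach, 'u::banach) csys \<Rightarrow> bool" where
  "H3 \<Sigma> \<longleftrightarrow> (\<forall>T>0. \<exists>c\<^sub>1>0. \<forall>x\<in>domAstar \<Sigma>.
     (LBINT t:{0..T}. (norm (Bstar \<Sigma> (expAstar \<Sigma> (- t) x)))\<^sup>2) \<le> c\<^sub>1 * (norm x)\<^sup>2)"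

definition H4 :: "('k::real_or_complex, 'h::banach, 'u::banach) csys \<Rightarrow> real \<Rightarrow> bool" where
  "H4 \<Sigma> T \<longleftrightarrow> T > 0 \<and> (\<exists>c\<^sub>2>0. \<forall>x\<in>domAstar \<Sigma>.
     c\<^sub>2 * (norm x)\<^sup>2 \<le> (LBINT t:{0..T}. (norm (Bstar \<Sigma> (expAstar \<Sigma> (- t) x)))\<^sup>2))"

subsection \<open>Extension of $B^*$ along trajectories\<close>

definition mild ::
    "('k::real_or_complex, 'h::banach, 'u::banach) csys \<Rightarrow> ('h \<Rightarrow>\<^sub>L 'k) \<Rightarrow> (real \<Rightarrow> ('h \<Rightarrow>\<^sub>L 'k)) \<Rightarrow>
      real \<Rightarrow> ('h \<Rightarrow>\<^sub>L 'k)" where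
  "mild \<Sigma> y\<^sub>0 g t =
     expAstar \<Sigma> (- t) y\<^sub>0 + oriented_integral 0 t (\<lambda>r. expAstar \<Sigma> (- (t - r)) (g r))"

definition L1loc_domAstar ::
    "('k::real_or_complex, 'h::banach, 'u::banach) csys \<Rightarrow> (real \<Rightarrow> ('h \<Rightarrow>\<^sub>L 'k)) set" where
  "L1loc_domAstar \<Sigma> = {g. (\<lambda>r. embDAstar \<Sigma> (g r)) \<in> Lloc 1 (embDAstar \<Sigma> ` domAstar \<Sigma>)}"

text \<open>\<open>z\<close> represents the value at \<open>(y\<^sub>0, g)\<close> of the extension by density of \<open>(y\<^sub>0, g) \<mapsto> B\<^sup>* y\<close>: the
  limit of the values along every sequence of regular data tending to \<open>(y\<^sub>0, g)\<close>. It is unique up to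
  null sets.\<close>

definition is_Bstar_ext ::
    "('k::real_or_complex, 'h::banach, 'u::banach) csys \<Rightarrow> ('h \<Rightarrow>\<^sub>L 'k) \<Rightarrow> (real \<Rightarrow> ('h \<Rightarrow>\<^sub>L 'k)) \<Rightarrow>
      (real \<Rightarrow> ('u \<Rightarrow>\<^sub>L 'k)) \<Rightarrow> bool" where
  "is_Bstar_ext \<Sigma> y\<^sub>0 g z \<longleftrightarrow> z \<in> Lloc 2 (dualU \<Sigma>) \<and>
     (\<forall>ys gs. (\<forall>n. ys n \<in> domAstar \<Sigma>) \<and> (\<forall>n. gs n \<in> L1loc_domAstar \<Sigma>) \<and>
        ys \<longlonglongrightarrow> y\<^sub>0 \<and> Lloc_tendsto 1 gs g \<longrightarrow>
        Lloc_tendsto 2 (\<lambda>n t. Bstar \<Sigma> (mild \<Sigma> (ys n) (gs n) t)) z)"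

definition Bstar_ext ::
    "('k::real_or_complex, 'h::banach, 'u::banach) csys \<Rightarrow> ('h \<Rightarrow>\<^sub>L 'k) \<Rightarrow> (real \<Rightarrow> ('h \<Rightarrow>\<^sub>L 'k)) \<Rightarrow>
      real \<Rightarrow> ('u \<Rightarrow>\<^sub>L 'k)" where
  "Bstar_ext \<Sigma> y\<^sub>0 g = (SOME z. is_Bstar_ext \<Sigma> y\<^sub>0 g z)"

text \<open>\<open>t \<mapsto> B\<^sup>* e\<^sup>-\<^sup>t\<^sup>A\<^sup>* x\<close> for arbitrary \<open>x\<close> in the dual of $H$.\<close>

definition Bstar_free ::
    "('k::real_or_complex, 'h::banach, 'u::banach) csys \<Rightarrow> ('h \<Rightarrow>\<^sub>L 'k) \<Rightarrow> real \<Rightarrow> ('u \<Rightarrow>\<^sub>L 'k)" where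
  "Bstar_free \<Sigma> x = Bstar_ext \<Sigma> x (\<lambda>_. 0)"

subsection \<open>Weighted Gramian and feedback groups\<close>

definition T_weight :: "real \<Rightarrow> real \<Rightarrow> real" where
  "T_weight \<omega> T = T + 1 / (2 * \<omega>)"

text \<open>The formulas are extended beyond \<open>[0, T_weight \<omega> T]\<close>, so that the two-sided \<open>deriv\<close> is the
  derivative of the weight on the whole interval.\<close>

definition e_weight :: "real \<Rightarrow> real \<Rightarrow> real \<Rightarrow> real" where
  "e_weight \<omega> T s =
     (if s \<le> T then exp (- 2 * \<omega> * s) else 2 * \<omega> * exp (- 2 * \<omega> * T) * (T_weight \<omega> T - s))"

definition Gramian ::
    "('k::real_or_complex, 'h::banach, 'u::banach) csys \<Rightarrow> real \<Rightarrow> real \<Rightarrow> ('h \<Rightarrow>\<^sub>L 'k) \<Rightarrow> 'h" where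
  "Gramian \<Sigma> \<omega> T x = (THE h. \<forall>y\<in>dualH \<Sigma>. pair h y =
     (LBINT s:{0..T_weight \<omega> T}.
        of_real (e_weight \<omega> T s) * pair (J \<Sigma> (Bstar_free \<Sigma> x s)) (Bstar_free \<Sigma> y s)))"

definition Gramian_inv ::
    "('k::real_or_complex, 'h::banach, 'u::banach) csys \<Rightarrow> real \<Rightarrow> real \<Rightarrow> 'h \<Rightarrow> ('h \<Rightarrow>\<^sub>L 'k)" where
  "Gramian_inv \<Sigma> \<omega> T = inv_into (dualH \<Sigma>) (Gramian \<Sigma> \<omega> T)"

definition opL ::
    "('k::real_or_complex, 'h::banach, 'u::banach) csys \<Rightarrow> real \<Rightarrow> real \<Rightarrow> 'h \<Rightarrow> 'h" where
  "opL \<Sigma> \<omega> T x = (THE h. \<forall>y. ipH \<Sigma> h y =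
     - (LBINT s:{0..T_weight \<omega> T}. of_real (deriv (e_weight \<omega> T) s) *
          pair (J \<Sigma> (Bstar_free \<Sigma> (Gramian_inv \<Sigma> \<omega> T x) s))
               (Bstar_free \<Sigma> (Gramian_inv \<Sigma> \<omega> T y) s)))"

text \<open>$C^* \widetilde J C \Lambda_\omega$\<close>

definition feedback ::
    "('k::real_or_complex, 'h::banach, 'u::banach) csys \<Rightarrow> real \<Rightarrow> real \<Rightarrow> ('h \<Rightarrow> 'h) \<Rightarrow>
      ('h \<Rightarrow>\<^sub>L 'k) \<Rightarrow> ('h \<Rightarrow>\<^sub>L 'k)" where
  "feedback \<Sigma> \<omega> T C x' = adj C (Jtilde \<Sigma> (C (Gramian \<Sigma> \<omega> T x')))"

text \<open>$U(t)x_0$ and $B^* \Lambda_\omega^{-1} U(s) x_0 = B^* V(s) \Lambda_\omega^{-1} x_0$, given the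
  group \<open>V\<close>.\<close>

definition groupU ::
    "('k::real_or_complex, 'h::banach, 'u::banach) csys \<Rightarrow> real \<Rightarrow> real \<Rightarrow>
      (real \<Rightarrow> ('h \<Rightarrow>\<^sub>L 'k) \<Rightarrow> ('h \<Rightarrow>\<^sub>L 'k)) \<Rightarrow> real \<Rightarrow> 'h \<Rightarrow> 'h" where
  "groupU \<Sigma> \<omega> T V t x\<^sub>0 = Gramian \<Sigma> \<omega> T (V t (Gramian_inv \<Sigma> \<omega> T x\<^sub>0))"

definition Bstar_V ::
    "('k::real_or_complex, 'h::banach, 'u::banach) csys \<Rightarrow> real \<Rightarrow> real \<Rightarrow> ('h \<Rightarrow> 'h) \<Rightarrow>
      (real \<Rightarrow> ('h \<Rightarrow>\<^sub>L 'k) \<Rightarrow> ('h \<Rightarrow>\<^sub>L 'k)) \<Rightarrow> ('h \<Rightarrow>\<^sub>L 'k) \<Rightarrow> real \<Rightarrow> ('u \<Rightarrow>\<^sub>L 'k)" where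
  "Bstar_V \<Sigma> \<omega> T C V y\<^sub>0 = Bstar_ext \<Sigma> y\<^sub>0 (\<lambda>r. - feedback \<Sigma> \<omega> T C (V r y\<^sub>0))"

definition Bstar_U ::
    "('k::real_or_complex, 'h::banach, 'u::banach) csys \<Rightarrow> real \<Rightarrow> real \<Rightarrow> ('h \<Rightarrow> 'h) \<Rightarrow>
      (real \<Rightarrow> ('h \<Rightarrow>\<^sub>L 'k) \<Rightarrow> ('h \<Rightarrow>\<^sub>L 'k)) \<Rightarrow> 'h \<Rightarrow> real \<Rightarrow> ('u \<Rightarrow>\<^sub>L 'k)" where
  "Bstar_U \<Sigma> \<omega> T C V x\<^sub>0 = Bstar_V \<Sigma> \<omega> T C V (Gramian_inv \<Sigma> \<omega> T x\<^sub>0)"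

end

theory Submission
  imports Defs
begin

text \<open>
  Write \<open>S t\<close> for $e^{-tA^*}$, \<open>b\<close> for $B^*$ and \<open>G\<close> for the sesquilinear form of the weighted Gramian
  on the dual of $H$, so that \<open>G x y = pair (\<Lambda> x) y\<close>. After the substitution \<open>x = \<Lambda> p\<close>,
  \<open>y = \<Lambda> q\<close> the assertion says that \<open>G (V t p) (V t q)\<close> decreases at the rate
  \<open>(C \<Lambda> V p, C \<Lambda> V q) + (B\<^sup>* V p, B\<^sup>* V q)\<close>.

  The reason is a Lyapunov equation. For \<open>z\<close>, \<open>v\<close> in $D(A^*)$ the function \<open>t \<mapsto> G (S t z) (S t v)\<close> is
  an integral of the weight, shifted by \<open>t\<close>, against the continuous function
  \<open>s \<mapsto> (b (S s z), b (S s v))\<close>. The weight equals 1 at the left end of the interval and 0 at the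
  right end, so differentiating at \<open>t = 0\<close> leaves the boundary term \<open>- (b z, b v)\<close> and minus the
  integral against the derivative of the weight, which is the form of \<open>L = C C\<close> (lemma \<open>Lyapunov_identity\<close>).
  Along the closed loop the feedback adds \<open>- 2 (C \<Lambda> z, C \<Lambda> v)\<close>, of which one half cancels against
  the term of \<open>L\<close>.

  This computation needs trajectories in $D(A^*)$, whereas \<open>B\<^sup>* V\<close> is defined by an extension from
  regular data. Both difficulties are met by one device: the averages
  \<open>R m\<close> of \<open>S\<close> over intervals of length \<open>1 / (m + 1)\<close>. They map the dual of $H$ into $D(A^*)$, commute
  with \<open>S\<close> and converge strongly to the identity. The smoothed trajectory \<open>R m (V t p)\<close> is a classical
  solution of the smoothed equation (\<open>smoothed_derivative\<close>), hence also its mild solution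
  (\<open>strong_solution_mild\<close>), so it is one of the regular trajectories through which the extension is
  defined. The balance is exact for the smoothed trajectories (\<open>smoothed_energy_balance\<close>), and the limit
  \<open>m \<longlonglongrightarrow> \<infinity>\<close> gives the theorem (\<open>energy_balance\<close>).

  Three supports remain. The extension must exist, with values in $L^2_{loc}$: this is the a priori
  estimate \<open>mild_estimate\<close>, which follows from admissibility by Minkowski's integral inequality, together
  with completeness of $L^2_{loc}$ (\<open>Lloc2_complete\<close>). The objects of the statement that are given by
  descriptions (the Gramian, its inverse, \<open>L\<close>, the Riesz isomorphism) must exist: they all come from one
  representation lemma for coercive symmetric forms (\<open>symmetric_form_represents_functional\<close>).
  Finally the adjoint group must be strongly continuous, which holds because
  $D(A^*)$ is norm dense in a Hilbert space (\<open>D_dense\<close>). As the spaces may be nonseparable, measurability is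
  handled through dominated approximation by simple functions, and vector-valued integrals are
  Henstock--Kurzweil integrals.
\<close>

section \<open>Scalars\<close>

text \<open>The real part of a scalar \<open>z\<close> is \<open>z \<bullet> 1\<close>. This encoding works for both scalar fields at once and
  turns sesquilinear questions into real bilinear ones.\<close>

lemma inner_one_one: "(1::'k::real_or_complex) \<bullet> 1 = 1"
  using power2_norm_eq_inner[of "1::'k"] by simp

lemma norm_sconj [simp]: "norm (sconj x) = norm (x::'k::real_or_complex)"
proof (cases "x = 0")
  case True
  have "sconj (0::'k) = 0" using sconj_scaleR_one[of 0, where 'a='k] by simp
  with True show ?thesis by simp
next
  case False
  have "norm x * norm (sconj x) = norm x * norm x"
    using arg_cong[OF mult_sconj[of x], of norm] by (simp add: norm_mult power2_eq_square)
  then show ?thesis using False by simp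
qed

lemma sconj_of_real [simp]: "sconj (of_real r :: 'k::real_or_complex) = of_real r"
  using sconj_scaleR_one[of r, where 'a='k] by (simp add: of_real_def)

lemma sconj_scaleR [simp]: "sconj (r *\<^sub>R x) = r *\<^sub>R sconj (x::'k::real_or_complex)"
  by (simp add: scaleR_conv_of_real sconj_mult)

lemma bounded_linear_sconj: "bounded_linear (sconj :: 'k::real_or_complex \<Rightarrow> 'k)"
  by (intro bounded_linear_intro[where K=1]) (auto simp: sconj_add)

lemma sconj_simps [simp]:
  "sconj (0::'k::real_or_complex) = 0" "sconj (1::'k) = 1" "sconj (- x) = - sconj (x::'k)"
  "sconj (x - y) = sconj x - sconj (y::'k)"
  using linear_0 linear_diff linear_neg bounded_linear_sconj[THEN bounded_linear.linear]
    sconj_scaleR_one[of 1, where 'a='k]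
  by (metis, simp, metis, metis)

declare sconj_sconj [simp]

text \<open>Polarisation of the axiom \<open>x * sconj x = (norm x)\<^sup>2\<close>: it forces the Euclidean inner product of the
  scalar field to be the real part of \<open>x * sconj y\<close>.\<close>

lemma inner_via_sconj: "(x * sconj y) \<bullet> 1 = x \<bullet> (y::'k::real_or_complex)"
proof -
  have pol: "x * sconj y + y * sconj x = (2 * (x \<bullet> y)) *\<^sub>R 1"
  proof -
    have "(x + y) * sconj (x + y) = (norm (x + y))\<^sup>2 *\<^sub>R 1" by (rule mult_sconj)
    then have "x * sconj y + y * sconj x + (norm x)\<^sup>2 *\<^sub>R 1 + (norm y)\<^sup>2 *\<^sub>R 1 = (norm (x + y))\<^sup>2 *\<^sub>R (1::'k)"
      by (simp add: sconj_add ring_distribs mult_sconj[symmetric])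
    moreover have "(norm (x + y))\<^sup>2 = 2 * (x \<bullet> y) + (norm x)\<^sup>2 + (norm y)\<^sup>2"
      by (simp add: power2_norm_eq_inner inner_add inner_commute)
    ultimately show ?thesis by (simp add: scaleR_left_distrib)
  qed
  have one: "z + sconj z = (2 * (z \<bullet> 1)) *\<^sub>R 1" for z :: 'k
  proof -
    have "z * sconj 1 + 1 * sconj z = (norm (z+1))\<^sup>2 *\<^sub>R 1 - (norm z)\<^sup>2 *\<^sub>R 1 - 1"
      using mult_sconj[of "z+1"] by (simp add: sconj_add ring_distribs mult_sconj[symmetric] algebra_simps)
    moreover have "(norm (z+1))\<^sup>2 = 2 * (z \<bullet> 1) + (norm z)\<^sup>2 + 1"
      by (simp add: power2_norm_eq_inner inner_add inner_commute inner_one_one)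
    ultimately show ?thesis by (simp add: scaleR_left_distrib)
  qed
  have "x * sconj y + sconj (x * sconj y) = (2 * (x \<bullet> y)) *\<^sub>R 1"
    using pol by (simp add: sconj_mult mult.commute)
  then have "(2 * ((x * sconj y) \<bullet> 1)) *\<^sub>R (1::'k) = (2 * (x \<bullet> y)) *\<^sub>R 1" using one by metis
  then show ?thesis by (simp)
qed

lemma inner_sconj_one: "sconj x \<bullet> 1 = (x::'k::real_or_complex) \<bullet> 1"
  using inner_via_sconj[of 1 x] by (simp add: inner_commute)

lemma eq_by_inner_one:
  assumes "\<And>c. (sconj c * x) \<bullet> 1 = (sconj c * y) \<bullet> (1::'k::real_or_complex)" shows "x = y"
proof -
  have "x \<bullet> c = y \<bullet> c" for c
    using assms[of c] inner_via_sconj[of x c] inner_via_sconj[of y c] by (simp add: mult.commute)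
  then show ?thesis by (metis vector_eq_rdot)
qed

section \<open>Coercive symmetric forms\<close>

text \<open>The direct method: the representing vector minimises \<open>a v v - 2 * f v\<close>. By the parallelogram law a
  minimising sequence is Cauchy, and the Euler equation at its limit is the assertion. The form may differ
  from the inner product that induces the norm, and the subspace may be proper; the lemma thus
  covers the Riesz theorem (\<open>riesz_representation\<close>), orthogonal projections (\<open>D_dense\<close>) and the
  inversion of the Gramian (\<open>Gramian_surj\<close>).\<close>

lemma symmetric_form_represents_functional:
  fixes a :: "'a::banach \<Rightarrow> 'a \<Rightarrow> real" and f :: "'a \<Rightarrow> real"
  assumes M: "subspace M" "closed M"
    and sym: "\<And>u v. u \<in> M \<Longrightarrow> v \<in> M \<Longrightarrow> a u v = a v u"
    and add: "\<And>u v w. u \<in> M \<Longrightarrow> v \<in> M \<Longrightarrow> w \<in> M \<Longrightarrow> a (u + v) w = a u w + a v w"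
    and scale: "\<And>r u v. u \<in> M \<Longrightarrow> v \<in> M \<Longrightarrow> a (r *\<^sub>R u) v = r * a u v"
    and bound: "\<And>u v. u \<in> M \<Longrightarrow> v \<in> M \<Longrightarrow> \<bar>a u v\<bar> \<le> K * norm u * norm v"
    and c: "c > 0" "\<And>v. v \<in> M \<Longrightarrow> c * (norm v)\<^sup>2 \<le> a v v"
    and fadd: "\<And>u v. u \<in> M \<Longrightarrow> v \<in> M \<Longrightarrow> f (u + v) = f u + f v"
    and fscale: "\<And>r u. u \<in> M \<Longrightarrow> f (r *\<^sub>R u) = r * f u"
    and fbound: "\<And>u. u \<in> M \<Longrightarrow> \<bar>f u\<bar> \<le> N * norm u"
  obtains m where "m \<in> M" "\<And>v. v \<in> M \<Longrightarrow> a m v = f v"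
proof -
  note MI = subspace_add[OF M(1)] subspace_scale[OF M(1)] subspace_0[OF M(1)] subspace_diff[OF M(1)]
  define Q where "Q v = a v v - 2 * f v" for v
  have add': "a w (u + v) = a w u + a w v" if "u \<in> M" "v \<in> M" "w \<in> M" for u v w
    using that by (metis MI(1) add sym)
  have scale': "a v (r *\<^sub>R u) = r * a v u" if "u \<in> M" "v \<in> M" for r u v
    using that by (metis MI(2) scale sym)
  have Qline: "Q (u + s *\<^sub>R v) = Q u + s\<^sup>2 * a v v + 2 * s * (a u v - f v)" if "u \<in> M" "v \<in> M" for u v s
    using that sym[of v u] by (simp add: Q_def add add' scale scale' MI fadd fscale power2_eq_square algebra_simps)
  have below: "Q v \<ge> - (N\<^sup>2 / c)" if "v \<in> M" for v
  proof -
    have "0 \<le> (c * norm v - N)\<^sup>2 / c" using c by simp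
    also have "\<dots> = c * (norm v)\<^sup>2 - 2 * N * norm v + N\<^sup>2 / c"
      using c by (simp add: power2_eq_square field_simps)
    finally show ?thesis using c(2)[OF that] fbound[OF that] by (simp add: Q_def algebra_simps)
  qed
  define d where "d = Inf (Q ` M)"
  have bdd: "bdd_below (Q ` M)" using below by (auto intro!: bdd_belowI)
  have dle: "d \<le> Q v" if "v \<in> M" for v unfolding d_def using that by (intro cInf_lower bdd) auto
  have "\<exists>v\<in>M. Q v < d + e" if "e > 0" for e
  proof -
    have "Inf (Q ` M) < d + e" using that d_def by simp
    then show ?thesis using cInf_lessD[of "Q ` M"] MI(3) by blast
  qed
  then have "\<forall>n. \<exists>v. v \<in> M \<and> Q v < d + inverse (real (Suc n))"
    by (meson inverse_positive_iff_positive of_nat_0_less_iff zero_less_Suc)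
  then have "\<exists>v. \<forall>n. v n \<in> M \<and> Q (v n) < d + inverse (real (Suc n))"
    by (rule choice)
  then obtain v where v: "\<And>n. v n \<in> M" "\<And>n. Q (v n) < d + inverse (real (Suc n))" by auto
  have close: "c * (norm (v n - v k))\<^sup>2 \<le> 2 * inverse (real (Suc n)) + 2 * inverse (real (Suc k))" for n k
  proof -
    let ?w = "v k - v n"
    have w: "?w \<in> M" using v MI by auto
    have "Q (v k) = Q (v n) + a ?w ?w + 2 * (a (v n) ?w - f ?w)"
      using Qline[OF v(1)[of n] w, of 1] by simp
    moreover have "d \<le> Q (v n) + (1/4) * a ?w ?w + (a (v n) ?w - f ?w)"
      using dle[of "v n + (1/2) *\<^sub>R ?w"] MI w v Qline[OF v(1)[of n] w, of "1/2"] by (simp add: power2_eq_square)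
    ultimately have "a ?w ?w \<le> 2 * (Q (v n) - d) + 2 * (Q (v k) - d)" by (simp add: field_simps)
    moreover have "2 * (Q (v n) - d) \<le> 2 * inverse (real (Suc n))" "2 * (Q (v k) - d) \<le> 2 * inverse (real (Suc k))"
      using v(2)[of n] v(2)[of k] by auto
    ultimately show ?thesis using c(2)[OF w] by (simp only: norm_minus_commute)
  qed
  have "Cauchy v"
  proof (rule metric_CauchyI)
    fix e :: real assume e: "e > 0"
    obtain n0 where n0: "inverse (real (Suc n0)) < c * e\<^sup>2 / 4"
      using reals_Archimedean[of "c * e\<^sup>2 / 4"] c e by auto
    have "dist (v m) (v n) < e" if "m \<ge> n0" "n \<ge> n0" for m n
    proof -
      have "inverse (real (Suc m)) \<le> inverse (real (Suc n0))" "inverse (real (Suc n)) \<le> inverse (real (Suc n0))"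
        using that by (auto simp: field_simps)
      then have "c * (norm (v m - v n))\<^sup>2 < c * e\<^sup>2" using close[of m n] n0 by linarith
      then have "(norm (v m - v n))\<^sup>2 < e\<^sup>2" using c by simp
      then show ?thesis using e by (simp add: dist_norm power2_less_imp_less)
    qed
    then show "\<exists>M. \<forall>m\<ge>M. \<forall>n\<ge>M. dist (v m) (v n) < e" by blast
  qed
  then obtain m where m: "v \<longlonglongrightarrow> m" using Cauchy_convergent convergent_def by blast
  have mM: "m \<in> M" using closed_sequentially[OF M(2) _ m] v by auto
  have "a m w = f w" if w: "w \<in> M" for w
  proof -
    have lim: "(\<lambda>n. a (v n) w) \<longlonglongrightarrow> a m w"
    proof (rule LIM_zero_cancel, rule Lim_null_comparison)
      have "a (v n) w - a m w = a (v n - m) w" for n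
        using add[of "v n - m" m w] v mM w MI by simp
      then show "\<forall>\<^sub>F n in sequentially. norm (a (v n) w - a m w) \<le> \<bar>K\<bar> * norm (v n - m) * norm w"
        using bound[of "v _ - m" w] v mM w MI
        by (intro always_eventually allI) (smt (verit) mult_right_mono norm_ge_zero real_norm_def)
      have "(\<lambda>n. norm (v n - m)) \<longlonglongrightarrow> 0" using m by (simp add: LIM_zero tendsto_norm_zero)
      from tendsto_mult_right[OF tendsto_mult_left[OF this, of "\<bar>K\<bar>"], of "norm w"]
      show "(\<lambda>n. \<bar>K\<bar> * norm (v n - m) * norm w) \<longlonglongrightarrow> 0" by simp
    qed
    have ineq: "0 \<le> s\<^sup>2 * a w w + 2 * s * (a m w - f w)" for s
    proof (rule tendsto_lowerbound)
      show "(\<lambda>n. s\<^sup>2 * a w w + 2 * s * (a (v n) w - f w) + inverse (real (Suc n))) \<longlonglongrightarrow> s\<^sup>2 * a w w + 2 * s * (a m w - f w)"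
        by (intro tendsto_add[where b=0, unfolded add_0_right] tendsto_intros lim LIMSEQ_inverse_real_of_nat)
      have "0 \<le> s\<^sup>2 * a w w + 2 * s * (a (v n) w - f w) + inverse (real (Suc n))" for n
      proof -
        have "v n + s *\<^sub>R w \<in> M" by (rule subspace_add[OF M(1) v(1) subspace_scale[OF M(1) w]])
        from dle[OF this] have "d \<le> Q (v n) + s\<^sup>2 * a w w + 2 * s * (a (v n) w - f w)"
          unfolding Qline[OF v(1) w] .
        moreover have "d \<le> q + e1 + e2 \<Longrightarrow> q < d + i \<Longrightarrow> 0 \<le> e1 + e2 + i" for q e1 e2 i :: real
          by linarith
        ultimately show ?thesis using v(2)[of n] by blast
      qed
      then show "\<forall>\<^sub>F n in sequentially. 0 \<le> s\<^sup>2 * a w w + 2 * s * (a (v n) w - f w) + inverse (real (Suc n))" by simp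
    qed simp
    have aw: "a w w \<ge> 0" using c(2)[OF w] c(1) by (smt (verit) mult_nonneg_nonneg zero_le_power2)
    define p where "p = a m w - f w"
    \<comment> \<open>The inequality is tested at \<open>s = - p / q\<close>; the summand 1 keeps \<open>q\<close> positive.\<close>
    define q where "q = a w w + 1"
    have q: "q > 0" "q - 1 = a w w" using aw by (auto simp: q_def)
    have "0 \<le> (- (p / q))\<^sup>2 * a w w + 2 * (- (p / q)) * p" unfolding p_def by (rule ineq)
    then have "0 \<le> q\<^sup>2 * ((- (p / q))\<^sup>2 * a w w + 2 * (- (p / q)) * p)" by simp
    also have "\<dots> = p\<^sup>2 * a w w - 2 * q * p\<^sup>2"
      using q(1) by (simp add: field_simps power2_eq_square)
    finally have "p\<^sup>2 * (a w w + 2) \<le> 0" unfolding q(2)[symmetric] by (simp add: algebra_simps)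
    then have "p = 0" using aw by (simp add: mult_le_0_iff)
    then show ?thesis by (simp add: p_def)
  qed
  with mM show thesis using that by blast
qed

section \<open>Riesz isomorphism and the inner product of the dual\<close>

context hilbert_space begin

lemma ip_zero [simp]: "ip 0 x = 0" "ip x 0 = 0"
  using ip_add_left[of 0 0 x] ip_commute[of x 0] by auto

lemma ip_add_right: "ip x (y + z) = ip x y + ip x z"
  by (metis ip_add_left ip_commute sconj_add)

lemma ip_scale_right: "ip x (scl c y) = sconj c * ip x y"
  by (metis ip_scale_left ip_commute sconj_mult)

lemma ip_scaleR_left: "ip (r *\<^sub>R x) y = r *\<^sub>R ip x y"
  by (simp flip: scale_of_real add: ip_scale_left scaleR_conv_of_real)

lemma ip_scaleR_right: "ip x (r *\<^sub>R y) = r *\<^sub>R ip x y"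
  by (simp flip: scale_of_real add: ip_scale_right scaleR_conv_of_real)

lemma norm_scl: "norm (scl c x) = norm c * norm x"
proof -
  have "of_real ((norm (scl c x))\<^sup>2) = (c * sconj c) * ip x x"
    unfolding ip_self[symmetric] by (simp only: ip_scale_left ip_scale_right mult_ac)
  also have "\<dots> = (of_real ((norm c * norm x)\<^sup>2) :: 'k)"
    unfolding mult_sconj ip_self of_real_def by (simp only: mult_scaleR_left mult_1_left scaleR_scaleR power_mult_distrib)
  finally have "of_real ((norm (scl c x))\<^sup>2) = (of_real ((norm c * norm x)\<^sup>2) :: 'k)" .
  then have "(norm (scl c x))\<^sup>2 = (norm c * norm x)\<^sup>2" using of_real_eq_iff by blast
  then show ?thesis by (simp add: power2_eq_iff_nonneg)
qed

lemma ip_bound: "norm (ip x y) \<le> norm x * norm y"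
proof -
  have re: "ip x y \<bullet> 1 \<le> norm x * norm y" for x y
  proof -
    have "of_real ((norm (x + y))\<^sup>2) = of_real ((norm x)\<^sup>2) + of_real ((norm y)\<^sup>2) + ip x y + sconj (ip x y)"
      by (simp only: ip_self[symmetric] ip_add_left ip_add_right ip_commute[of y x] algebra_simps)
    then have "of_real ((norm (x + y))\<^sup>2) \<bullet> (1::'k) = (of_real ((norm x)\<^sup>2) + of_real ((norm y)\<^sup>2) + ip x y + sconj (ip x y)) \<bullet> 1"
      by simp
    then have "(norm (x + y))\<^sup>2 = (norm x)\<^sup>2 + (norm y)\<^sup>2 + 2 * (ip x y \<bullet> 1)"
      by (simp add: inner_add inner_sconj_one of_real_def inner_one_one)
    moreover have "(norm (x + y))\<^sup>2 \<le> (norm x + norm y)\<^sup>2" by (simp add: norm_triangle_ineq power_mono)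
    ultimately show ?thesis by (simp add: power2_eq_square algebra_simps)
  qed
  have "(norm (ip x y))\<^sup>2 = ip x (scl (ip x y) y) \<bullet> 1"
    using mult_sconj[of "ip x y"] by (simp add: ip_scale_right mult.commute inner_one_one)
  also have "\<dots> \<le> norm x * (norm (ip x y) * norm y)" using re[of x "scl (ip x y) y"] by (simp add: norm_scl)
  finally show ?thesis by (cases "norm (ip x y) = 0") (auto simp: power2_eq_square mult_ac)
qed

lemma ip_bounded_bilinear: "bounded_bilinear ip"
  by (rule bounded_bilinear.intro)
    (auto intro!: exI[of _ 1] simp: ip_add_left ip_add_right ip_scaleR_left ip_scaleR_right ip_bound)

lemma ip_left_unique: "(\<And>y. ip x y = ip x' y) \<Longrightarrow> x = x'"
proof -
  assume "\<And>y. ip x y = ip x' y"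
  then have "ip (x - x') (x - x') = 0"
    using bounded_bilinear.diff_left[OF ip_bounded_bilinear] by simp
  then show ?thesis by (simp add: ip_self)
qed

lemma riesz_apply [simp]: "blinfun_apply (riesz ip x) y = ip x y"
  unfolding riesz_def
  by (rule bounded_linear_Blinfun_apply[OF bounded_bilinear.bounded_linear_right[OF ip_bounded_bilinear], THEN fun_cong])

lemma riesz_in_antidual [simp]: "riesz ip x \<in> antidual scl"
  by (simp add: antidual_def ip_scale_right)

lemma norm_riesz [simp]: "norm (riesz ip x) = norm x"
proof (rule antisym)
  show "norm (riesz ip x) \<le> norm x" by (rule norm_blinfun_bound) (auto simp: ip_bound)
  have "norm x * norm x \<le> norm (riesz ip x) * norm x"
    using norm_blinfun[of "riesz ip x" x] by (simp only: riesz_apply ip_self norm_of_real abs_power2 power2_eq_square abs_mult_self_eq)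
  then show "norm x \<le> norm (riesz ip x)" by (cases "norm x = 0") (auto)
qed

text \<open>An antilinear functional is determined by its real part, because the imaginary part at \<open>y\<close> is a
  real part at a multiple of \<open>y\<close>.\<close>

lemma antidual_eq_by_re:
  assumes "\<And>y. f y \<bullet> 1 = g y \<bullet> 1" "\<And>c y. f (scl c y) = sconj c * f y" "\<And>c y. g (scl c y) = sconj c * g y"
  shows "f = (g :: _ \<Rightarrow> 'k)"
proof
  fix y show "f y = g y" by (rule eq_by_inner_one) (metis assms)
qed

lemma riesz_representation:
  fixes f :: "'a \<Rightarrow> 'k"
  assumes "\<And>x y. f (x + y) = f x + f y" "\<And>c x. f (scl c x) = sconj c * f x" "\<And>x. norm (f x) \<le> N * norm x"
  obtains y where "\<And>x. f x = ip y x"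
proof -
  have fr: "f (r *\<^sub>R x) = r *\<^sub>R f x" for r x
    using assms(2)[of "of_real r" x] by (simp add: scale_of_real scaleR_conv_of_real)
  have in1: "\<bar>z \<bullet> 1\<bar> \<le> norm z" for z :: 'k using Cauchy_Schwarz_ineq2[of z 1] by simp
  obtain y where y: "\<And>x. ip y x \<bullet> 1 = f x \<bullet> 1"
  proof (rule symmetric_form_represents_functional[of UNIV "\<lambda>x y. ip x y \<bullet> 1" 1 1 "\<lambda>x. f x \<bullet> 1" N])
    show "ip u v \<bullet> 1 = ip v u \<bullet> 1" for u v using inner_sconj_one[of "ip u v"] ip_commute[of u v] by simp
    show "\<bar>ip u v \<bullet> 1\<bar> \<le> 1 * norm u * norm v" for u v using order_trans[OF in1 ip_bound[of u v]] by simp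
    show "1 * (norm v)\<^sup>2 \<le> ip v v \<bullet> 1" for v
      unfolding ip_self by (simp add: of_real_def inner_one_one del: scaleR_power)
    show "\<bar>f u \<bullet> 1\<bar> \<le> N * norm u" for u using in1 assms(3) by (rule order_trans)
  qed (auto simp: ip_add_left inner_add ip_scaleR_left assms fr)
  have "f = ip y" by (rule antidual_eq_by_re) (auto simp: y assms ip_scale_right)
  then show thesis using that by simp
qed

lemma riesz_surj: "f \<in> antidual scl \<Longrightarrow> \<exists>y. f = riesz ip y"
proof -
  assume f: "f \<in> antidual scl"
  obtain y where "\<And>x. blinfun_apply f x = ip y x"
    by (rule riesz_representation[of "blinfun_apply f" "norm f"])
      (use f in \<open>auto simp: antidual_def blinfun.add_right norm_blinfun\<close>)
  then show ?thesis by (intro exI[of _ y] blinfun_eqI) simp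
qed

lemma riesz_inj: "riesz ip x = riesz ip y \<Longrightarrow> x = y"
  by (rule ip_left_unique) (metis riesz_apply)

lemma riesz_inv_riesz [simp]: "riesz_inv ip (riesz ip y) = y"
  unfolding riesz_inv_def by (rule inv_into_f_f) (auto intro: injI riesz_inj)

lemma riesz_linear: "riesz ip (x + y) = riesz ip x + riesz ip y" "riesz ip (r *\<^sub>R x) = r *\<^sub>R riesz ip x"
  "riesz ip (scl c x) = scale_dual c (riesz ip x)"
proof -
  show "riesz ip (x + y) = riesz ip x + riesz ip y" "riesz ip (r *\<^sub>R x) = r *\<^sub>R riesz ip x"
    by (rule blinfun_eqI; simp add: plus_blinfun.rep_eq scaleR_blinfun.rep_eq ip_add_left ip_scaleR_left)+
  show "riesz ip (scl c x) = scale_dual c (riesz ip x)"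
    by (simp add: scale_dual_def riesz_def[of ip "scl c x"] ip_scale_left)
qed

lemma subspace_antidual: "Real_Vector_Spaces.subspace (antidual scl)"
  by (auto simp: Real_Vector_Spaces.subspace_def antidual_def plus_blinfun.rep_eq scaleR_blinfun.rep_eq algebra_simps)

lemmas antidual_zero = Real_Vector_Spaces.subspace_0[OF subspace_antidual]
  and antidual_add = Real_Vector_Spaces.subspace_add[OF subspace_antidual]
  and antidual_diff = Real_Vector_Spaces.subspace_diff[OF subspace_antidual]
  and antidual_neg = Real_Vector_Spaces.subspace_neg[OF subspace_antidual]
  and antidual_scaleR = Real_Vector_Spaces.subspace_scale[OF subspace_antidual]

lemma closed_antidual: "closed (antidual scl)"
proof -
  have "antidual scl = (\<Inter>c. \<Inter>x. {f. blinfun_apply f (scl c x) = sconj c * blinfun_apply f x})"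
    by (auto simp: antidual_def)
  moreover have "closed {f. blinfun_apply f (scl c x) = sconj c * (blinfun_apply f x)}" for c x
    by (intro closed_Collect_eq continuous_intros)
  ultimately show ?thesis by (simp only:) (intro closed_INT ballI)
qed

lemma scale_dual_apply [simp]: "blinfun_apply (scale_dual c f) x = c * blinfun_apply f x"
  unfolding scale_dual_def
  by (rule bounded_linear_Blinfun_apply[THEN fun_cong])
    (intro bounded_linear_mult_right[THEN bounded_linear_compose] blinfun.bounded_linear_right)

lemma scale_dual_in_antidual: "f \<in> antidual scl \<Longrightarrow> scale_dual c f \<in> antidual scl"
  by (auto simp: antidual_def)

text \<open>The inner product of the dual space, in the form \<open>(x', y') = \<langle>J x', y'\<rangle>\<close> in which it occurs in the
  definitions of the Gramian and of \<open>L\<close>.\<close>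

definition dip :: "('a \<Rightarrow>\<^sub>L 'k) \<Rightarrow> ('a \<Rightarrow>\<^sub>L 'k) \<Rightarrow> 'k" where
  "dip f g = pair (riesz_inv ip f) g"

lemma dip_riesz [simp]: "dip (riesz ip x) (riesz ip y) = ip x y"
  by (simp add: dip_def pair_def pair'_def ip_commute[of y x])

lemma dip_add_left: "\<lbrakk>f \<in> antidual scl; g \<in> antidual scl; h \<in> antidual scl\<rbrakk> \<Longrightarrow> dip (f + g) h = dip f h + dip g h"
  by (metis dip_riesz riesz_linear(1) riesz_surj ip_add_left)

lemma dip_add_right: "dip h (f + g) = dip h f + dip h g"
  by (simp add: dip_def pair_def pair'_def plus_blinfun.rep_eq sconj_add)

lemma dip_scaleR_left: "\<lbrakk>f \<in> antidual scl; h \<in> antidual scl\<rbrakk> \<Longrightarrow> dip (r *\<^sub>R f) h = r *\<^sub>R dip f h"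
  by (metis dip_riesz riesz_linear(2) riesz_surj ip_scaleR_left)

lemma dip_scaleR_right: "dip h (r *\<^sub>R f) = r *\<^sub>R dip h f"
  by (simp add: dip_def pair_def pair'_def scaleR_blinfun.rep_eq)

lemma dip_scale_left: "\<lbrakk>f \<in> antidual scl; h \<in> antidual scl\<rbrakk> \<Longrightarrow> dip (scale_dual c f) h = c * dip f h"
  by (metis dip_riesz riesz_linear(3) riesz_surj ip_scale_left)

lemma dip_bound: "\<lbrakk>f \<in> antidual scl; g \<in> antidual scl\<rbrakk> \<Longrightarrow> norm (dip f g) \<le> norm f * norm g"
  by (metis dip_riesz riesz_surj ip_bound norm_riesz)

lemma dip_self: "f \<in> antidual scl \<Longrightarrow> dip f f = of_real ((norm f)\<^sup>2)"
  by (metis dip_riesz riesz_surj ip_self norm_riesz)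

lemma dip_commute: "\<lbrakk>f \<in> antidual scl; g \<in> antidual scl\<rbrakk> \<Longrightarrow> dip g f = sconj (dip f g)"
  by (metis dip_riesz riesz_surj ip_commute)

end

section \<open>Strongly measurable functions\<close>

text \<open>The point nearest to \<open>f x\<close> among \<open>0, e 0, \<dots>, e (i - 1)\<close>. Starting the search at 0 is what makes the
  resulting approximation dominated: its error never exceeds \<open>norm (f x)\<close>.\<close>

primrec nearest :: "(real \<Rightarrow> 'a::real_normed_vector) \<Rightarrow> (nat \<Rightarrow> 'a) \<Rightarrow> nat \<Rightarrow> real \<Rightarrow> 'a" where
  "nearest f e 0 x = 0"
| "nearest f e (Suc i) x = (if dist (f x) (e i) < dist (f x) (nearest f e i x) then e i else nearest f e i x)"

text \<open>A countable dense set supplies the values of the approximating functions. Only the real functions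
  \<open>dist (f x) d\<close> have to be measurable, so the space itself may be nonseparable. Values in a prescribed set
  \<open>M\<close> are needed later, where operators are defined on a subspace only.\<close>

lemma dominated_simple_approximation:
  fixes f :: "real \<Rightarrow> 'a::real_normed_vector"
  assumes D: "countable D" "range f \<subseteq> closure D" "D \<subseteq> M" and M0: "0 \<in> M"
    and meas: "\<And>d. (\<lambda>x. dist (f x) d) \<in> borel_measurable borel"
  obtains s :: "nat \<Rightarrow> real \<Rightarrow> 'a" where
    "\<And>i. simple_function lborel (s i)" "\<And>i x. s i x \<in> M" "\<And>x. (\<lambda>i. s i x) \<longlonglongrightarrow> f x"
    "\<And>i x. norm (s i x - f x) \<le> norm (f x)"
proof -
  define e where "e = from_nat_into D"
  let ?s = "nearest f e"
  have Dne: "D \<noteq> {}" using D(2) by auto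
  have eD: "e i \<in> D" for i unfolding e_def by (rule from_nat_into[OF Dne])
  have rec: "dist (f x) (?s (Suc i) x) = min (dist (f x) (e i)) (dist (f x) (?s i x))" for i x by simp
  have m: "(\<lambda>x. dist (f x) (?s i x)) \<in> borel_measurable borel" for i
  proof (induction i)
    case 0 show ?case using meas[of 0] by simp
  next
    case (Suc i) show ?case unfolding rec by (intro borel_measurable_min meas Suc)
  qed
  have 1: "simple_function lborel (?s i)" for i
  proof (induction i)
    case 0 show ?case by simp
  next
    case (Suc i)
    have "{x \<in> space lborel. dist (f x) (e i) < dist (f x) (?s i x)} \<in> sets lborel"
      using meas[of "e i"] m[of i] by (simp, measurable)
    from simple_function_If[OF simple_function_const Suc this, of "e i"] show ?case by simp
  qed
  have 2: "?s i x \<in> M" for i x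
    by (induction i) (use M0 eD D(3) in auto)
  have mono: "dist (f x) (?s (i + k) x) \<le> dist (f x) (?s i x)" for i k x
    by (induction k) auto
  have 4: "norm (?s i x - f x) \<le> norm (f x)" for i x
    using mono[of x 0 i] by (simp add: dist_norm norm_minus_commute)
  have 3: "(\<lambda>i. ?s i x) \<longlonglongrightarrow> f x" for x
  proof (rule metric_LIMSEQ_I)
    fix r :: real assume "r > 0"
    moreover have "f x \<in> closure D" using D(2) by auto
    ultimately obtain d where d: "d \<in> D" "dist d (f x) < r" by (meson closure_approachable)
    obtain n where n: "e n = d" using from_nat_into_surj[OF D(1) d(1)] unfolding e_def by auto
    have "dist (?s i x) (f x) < r" if "i \<ge> Suc n" for i
    proof -
      have "dist (f x) (?s i x) \<le> dist (f x) (?s (Suc n) x)" using mono[of x "Suc n" "i - Suc n"] that by simp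
      also have "\<dots> \<le> dist (f x) d" unfolding rec n by simp
      finally show ?thesis using d(2) by (simp add: dist_commute)
    qed
    then show "\<exists>no. \<forall>n\<ge>no. dist (?s n x) (f x) < r" by blast
  qed
  show thesis using that[OF 1 2 3 4] .
qed

lemma strongly_measurableI:
  fixes f :: "real \<Rightarrow> 'a::real_normed_vector"
  assumes "countable D" "range f \<subseteq> closure D" "\<And>d. (\<lambda>x. dist (f x) d) \<in> borel_measurable borel"
  shows "strongly_measurable f"
  by (rule dominated_simple_approximation[OF assms(1,2) subset_UNIV UNIV_I assms(3)])
    (auto simp: strongly_measurable_def)

lemma strongly_measurable_borel_compose:
  fixes f :: "real \<Rightarrow> 'a::real_normed_vector" and h :: "'a \<Rightarrow> 'b::{metric_space, second_countable_topology}"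
  assumes "strongly_measurable f" "continuous_on UNIV h"
  shows "(\<lambda>x. h (f x)) \<in> borel_measurable borel"
proof -
  obtain s where s: "\<And>i. simple_function lborel (s i)" "\<And>x. (\<lambda>i. s i x) \<longlonglongrightarrow> f x"
    using assms(1) unfolding strongly_measurable_def by blast
  have "simple_function lborel (\<lambda>x. h (s i x))" for i
    using simple_function_compose[OF s(1), of h i] by (simp add: comp_def)
  then have "(\<lambda>x. h (s i x)) \<in> borel_measurable borel" for i
    using borel_measurable_simple_function by fastforce
  then show ?thesis
    by (rule borel_measurable_LIMSEQ_metric[where f = "\<lambda>i x. h (s i x)"])
      (use s(2) in \<open>auto intro!: continuous_on_tendsto_compose[OF assms(2)]\<close>)
qed

lemma strongly_measurable_norm [measurable_dest]:
  "strongly_measurable f \<Longrightarrow> (\<lambda>x. norm (f x)) \<in> borel_measurable borel"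
  by (rule strongly_measurable_borel_compose) (auto intro: continuous_intros)

lemma strongly_measurable_dist:
  "strongly_measurable f \<Longrightarrow> (\<lambda>x. dist (f x) d) \<in> borel_measurable borel"
  by (rule strongly_measurable_borel_compose) (auto intro: continuous_intros)

text \<open>A subset of a separable metric space is separable: the dense set of values of the simple functions is
  replaced by nearby points of the range itself.\<close>

lemma strongly_measurable_separable_range:
  fixes f :: "real \<Rightarrow> 'a::real_normed_vector"
  assumes "strongly_measurable f"
  obtains D where "countable D" "D \<subseteq> range f" "range f \<subseteq> closure D"
proof -
  obtain s where s: "\<And>i. simple_function lborel (s i)" "\<And>x. (\<lambda>i. s i x) \<longlonglongrightarrow> f x"
    using assms(1) unfolding strongly_measurable_def by blast
  define E where "E = (\<Union>i. range (s i))"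
  have "finite (range (s i))" for i using simple_functionD(1)[OF s(1)[of i]] by simp
  then have E: "countable E" unfolding E_def by (auto intro: countable_finite)
  define c where "c d n = (SOME y. y \<in> range f \<and> dist d y < inverse (real (Suc n)))" for d n
  define P where "P = {(d, n). \<exists>y. y \<in> range f \<and> dist d y < inverse (real (Suc n))}"
  have c: "c d n \<in> range f \<and> dist d (c d n) < inverse (real (Suc n))" if "(d, n) \<in> P" for d n
    unfolding c_def by (rule someI_ex) (use that in \<open>auto simp: P_def\<close>)
  define D where "D = case_prod c ` ((E \<times> UNIV) \<inter> P)"
  have "countable D" unfolding D_def by (intro countable_image countable_Int1 countable_SIGMA E) auto
  moreover have "D \<subseteq> range f"
  proof
    fix y assume "y \<in> D"
    then obtain d n where "(d, n) \<in> P" "y = c d n" unfolding D_def by auto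
    then show "y \<in> range f" using c by blast
  qed
  moreover have "f x \<in> closure D" for x
    unfolding closure_approachable
  proof (intro allI impI)
    fix r :: real assume r: "r > 0"
    obtain n where n: "inverse (real (Suc n)) < r / 2" using reals_Archimedean[of "r/2"] r by auto
    obtain i where i: "dist (s i x) (f x) < inverse (real (Suc n))"
      using metric_LIMSEQ_D[OF s(2)[of x], of "inverse (real (Suc n))"] by auto
    have "(s i x, n) \<in> P" using i unfolding P_def by auto
    moreover have "s i x \<in> E" by (auto simp: E_def)
    ultimately have "c (s i x) n \<in> D" "dist (s i x) (c (s i x) n) < inverse (real (Suc n))"
      using c unfolding D_def by auto
    moreover have "dist (c (s i x) n) (f x) \<le> dist (s i x) (c (s i x) n) + dist (s i x) (f x)"
      by (rule dist_triangle3)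
    ultimately show "\<exists>y\<in>D. dist y (f x) < r" using i n by (intro bexI[of _ "c (s i x) n"]) auto
  qed
  ultimately show thesis using that by blast
qed

lemma strongly_measurable_approximation:
  fixes f :: "real \<Rightarrow> 'a::real_normed_vector"
  assumes "strongly_measurable f" "range f \<subseteq> M" "0 \<in> M"
  obtains s :: "nat \<Rightarrow> real \<Rightarrow> 'a" where
    "\<And>i. simple_function lborel (s i)" "\<And>i x. s i x \<in> M" "\<And>x. (\<lambda>i. s i x) \<longlonglongrightarrow> f x"
    "\<And>i x. norm (s i x - f x) \<le> norm (f x)"
proof -
  obtain D where D: "countable D" "D \<subseteq> range f" "range f \<subseteq> closure D"
    using strongly_measurable_separable_range[OF assms(1)] by blast
  show thesis
    by (rule dominated_simple_approximation[OF D(1,3) order_trans[OF D(2) assms(2)] assms(3) strongly_measurable_dist[OF assms(1)]])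
      (rule that)
qed

lemma strongly_measurable_LIMSEQ:
  fixes f :: "real \<Rightarrow> 'a::real_normed_vector"
  assumes f: "\<And>i. strongly_measurable (fs i)" "\<And>x. (\<lambda>i. fs i x) \<longlonglongrightarrow> f x"
  shows "strongly_measurable f"
proof -
  have "\<forall>i. \<exists>D. countable D \<and> range (fs i) \<subseteq> closure D"
    using strongly_measurable_separable_range[OF f(1)] by metis
  then obtain D where D: "\<And>i. countable (D i)" "\<And>i. range (fs i) \<subseteq> closure (D i)" by metis
  show ?thesis
  proof (rule strongly_measurableI[of "\<Union>i. D i"])
    show "countable (\<Union>i. D i)" using D by auto
    have "fs i x \<in> closure (\<Union>i. D i)" for i x
      using D(2)[of i] closure_mono[of "D i" "\<Union>i. D i"] by blast
    then show "range f \<subseteq> closure (\<Union>i. D i)"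
      using closed_sequentially[OF closed_closure _ f(2)] by blast
    show "(\<lambda>x. dist (f x) d) \<in> borel_measurable borel" for d
      by (rule borel_measurable_LIMSEQ_metric[where f = "\<lambda>i x. dist (fs i x) d"])
        (intro strongly_measurable_dist f(1) tendsto_intros f(2))+
  qed
qed

text \<open>Sequential continuity of \<open>h\<close> is required on \<open>M\<close> only, since the approximations take their values
  there.\<close>

lemma strongly_measurable_compose2:
  fixes f g :: "real \<Rightarrow> 'a::real_normed_vector" and h :: "'a \<Rightarrow> 'a \<Rightarrow> 'b::real_normed_vector"
  assumes "strongly_measurable f" "strongly_measurable g" "range f \<subseteq> M" "range g \<subseteq> M" "0 \<in> M"
    and h: "\<And>us vs u v. (\<And>n::nat. us n \<in> M) \<Longrightarrow> (\<And>n. vs n \<in> M) \<Longrightarrow> u \<in> M \<Longrightarrow> v \<in> M \<Longrightarrow>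
       us \<longlonglongrightarrow> u \<Longrightarrow> vs \<longlonglongrightarrow> v \<Longrightarrow> (\<lambda>n. h (us n) (vs n)) \<longlonglongrightarrow> h u v"
  shows "strongly_measurable (\<lambda>x. h (f x) (g x))"
proof -
  obtain s where s: "\<And>i. simple_function lborel (s i)" "\<And>i x. s i x \<in> M" "\<And>x. (\<lambda>i. s i x) \<longlonglongrightarrow> f x"
    using strongly_measurable_approximation[OF assms(1,3,5)] by metis
  obtain s' where s': "\<And>i. simple_function lborel (s' i)" "\<And>i x. s' i x \<in> M" "\<And>x. (\<lambda>i. s' i x) \<longlonglongrightarrow> g x"
    using strongly_measurable_approximation[OF assms(2,4,5)] by metis
  have "(\<lambda>i. h (s i x) (s' i x)) \<longlonglongrightarrow> h (f x) (g x)" for x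
    by (rule h) (use s s' assms(3,4) in auto)
  moreover have "simple_function lborel (\<lambda>x. h (s i x) (s' i x))" for i
    by (rule simple_function_compose2[OF s(1) s'(1)])
  ultimately show ?thesis unfolding strongly_measurable_def
    by (intro exI[of _ "\<lambda>i x. h (s i x) (s' i x)"]) auto
qed

lemma strongly_measurable_diff:
  "strongly_measurable f \<Longrightarrow> strongly_measurable g \<Longrightarrow> strongly_measurable (\<lambda>x. f x - g x)"
  by (rule strongly_measurable_compose2[where M=UNIV]) (auto intro: tendsto_diff)

lemma strongly_measurable_continuous:
  fixes f :: "real \<Rightarrow> 'a::real_normed_vector"
  assumes "continuous_on UNIV f" shows "strongly_measurable f"
proof (rule strongly_measurableI[of "f ` \<rat>"])
  have "f ` closure \<rat> \<subseteq> closure (f ` \<rat>)"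
    by (rule image_closure_subset[OF continuous_on_subset[OF assms] closed_closure closure_subset]) auto
  then show "range f \<subseteq> closure (f ` \<rat>)" by (simp add: Rats_closure_real)
  show "(\<lambda>x. dist (f x) d) \<in> borel_measurable borel" for d
    by (intro borel_measurable_continuous_onI continuous_intros assms)
qed (simp add: countable_rat)

lemma strongly_measurable_if:
  fixes f :: "real \<Rightarrow> 'a::real_normed_vector"
  assumes f: "strongly_measurable f" and P: "{x. P x} \<in> sets borel"
  shows "strongly_measurable (\<lambda>x. if P x then f x else 0)"
proof -
  obtain s where s: "\<And>i. simple_function lborel (s i)" "\<And>x. (\<lambda>i. s i x) \<longlonglongrightarrow> f x"
    using f unfolding strongly_measurable_def by blast
  have "simple_function lborel (\<lambda>x. if P x then s i x else 0)" for i
    by (rule simple_function_If[OF s(1) simple_function_const]) (use P in simp)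
  moreover have "(\<lambda>i. if P x then s i x else 0) \<longlonglongrightarrow> (if P x then f x else 0)" for x using s(2) by simp
  ultimately show ?thesis unfolding strongly_measurable_def
    by (intro exI[of _ "\<lambda>i x. if P x then s i x else 0"]) auto
qed

section \<open>Henstock--Kurzweil integrals in Banach spaces\<close>

text \<open>Riemann sums stay in the subspace \<open>M\<close> and are mapped by \<open>h\<close> to Riemann sums, so an operator that is
  defined and bounded on \<open>M\<close> only commutes with the integral. This serves for $B^*$ on the graph of $A^*$ and
  for groups that act on a closed subspace, where no bounded extension to the whole space is at hand.\<close>

lemma has_integral_on_subspace:
  fixes f :: "real \<Rightarrow> 'a::real_normed_vector" and h :: "'a \<Rightarrow> 'b::real_normed_vector"
  assumes I: "(f has_integral I) {a..b}" and M: "subspace M" "closed M" and fM: "\<And>x. x \<in> {a..b} \<Longrightarrow> f x \<in> M"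
    and add: "\<And>u v. u \<in> M \<Longrightarrow> v \<in> M \<Longrightarrow> h (u + v) = h u + h v"
    and scale: "\<And>r u. u \<in> M \<Longrightarrow> h (r *\<^sub>R u) = r *\<^sub>R h u"
    and bound: "\<And>u. u \<in> M \<Longrightarrow> norm (h u) \<le> K * norm u"
  shows "I \<in> M" "((\<lambda>x. h (f x)) has_integral h I) {a..b}"
proof -
  let ?F = "division_filter (cbox a b)" and ?S = "\<lambda>p. \<Sum>(x,k)\<in>p. measure lborel k *\<^sub>R f x"
  have lim: "(?S \<longlongrightarrow> I) ?F" using I unfolding box_real(2)[symmetric] has_integral_cbox .
  have tag: "\<forall>\<^sub>F p in ?F. p tagged_division_of cbox a b"
    unfolding eventually_division_filter by (rule exI[of _ "\<lambda>x. ball x 1"]) (use gauge_ball[of 1] in auto)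
  have S: "?S p \<in> M \<and> h (?S p) = (\<Sum>(x,k)\<in>p. measure lborel k *\<^sub>R h (f x))" if p: "p tagged_division_of cbox a b" for p
  proof -
    have fin: "finite p" using p by auto
    have x: "f x \<in> M" if "(x, k) \<in> p" for x k
    proof -
      have "x \<in> k" "k \<subseteq> cbox a b" using tagged_division_ofD(2,3)[OF p that] by auto
      then show ?thesis using fM by (auto simp: subset_iff)
    qed
    have "?S q \<in> M \<and> h (?S q) = (\<Sum>(x,k)\<in>q. measure lborel k *\<^sub>R h (f x))" if "finite q" "q \<subseteq> p" for q
      using that
    proof (induction q rule: finite_induct)
      case empty
      have "h (0 *\<^sub>R 0) = 0 *\<^sub>R h 0" by (rule scale[OF subspace_0[OF M(1)]])
      then show ?case using subspace_0[OF M(1)] by simp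
    next
      case (insert z q)
      obtain x k where z: "z = (x, k)" by (cases z)
      have "measure lborel k *\<^sub>R f x \<in> M" using x insert z by (intro subspace_scale M) auto
      with insert z x[of x k] show ?case by (simp add: add scale subspace_add[OF M(1)])
    qed
    then show ?thesis using fin by blast
  qed
  have ne: "?F \<noteq> bot" by (rule division_filter_not_empty)
  show IM: "I \<in> M"
    by (rule Lim_in_closed_set[OF M(2) _ ne lim]) (use tag S in \<open>auto elim: eventually_mono\<close>)
  have "((\<lambda>p. h (?S p)) \<longlongrightarrow> h I) ?F"
  proof (rule LIM_zero_cancel, rule Lim_null_comparison)
    show "\<forall>\<^sub>F p in ?F. norm (h (?S p) - h I) \<le> \<bar>K\<bar> * norm (?S p - I)"
      using tag
    proof eventually_elim
      case (elim p)
      have d: "?S p - I \<in> M" using S[OF elim] IM by (auto intro: subspace_diff[OF M(1)])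
      have "h (?S p) = h (?S p - I) + h I" using add[OF d IM] by simp
      moreover have "norm (h (?S p - I)) \<le> \<bar>K\<bar> * norm (?S p - I)"
        using bound[OF d] by (smt (verit) mult_right_mono norm_ge_zero)
      ultimately show ?case by simp
    qed
    have "((\<lambda>p. norm (?S p - I)) \<longlongrightarrow> 0) ?F" using lim by (simp add: LIM_zero tendsto_norm_zero)
    then show "((\<lambda>p. \<bar>K\<bar> * norm (?S p - I)) \<longlongrightarrow> 0) ?F" using tendsto_mult_right_zero by blast
  qed
  then have "((\<lambda>p. \<Sum>(x,k)\<in>p. measure lborel k *\<^sub>R h (f x)) \<longlongrightarrow> h I) ?F"
    by (rule Lim_transform_eventually) (use tag S in \<open>auto elim: eventually_mono\<close>)
  then show "((\<lambda>x. h (f x)) has_integral h I) {a..b}"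
    unfolding box_real(2)[symmetric] has_integral_cbox .
qed

lemma has_integral_gauge:
  fixes f :: "real \<Rightarrow> 'a::real_normed_vector"
  assumes "(f has_integral y) (cbox a b)" "e > 0"
  obtains \<gamma> where "gauge \<gamma>" "\<And>p. p tagged_division_of (cbox a b) \<Longrightarrow> \<gamma> fine p \<Longrightarrow>
    norm ((\<Sum>(x, k)\<in>p. measure lborel k *\<^sub>R f x) - y) < e"
  using assms(1)[unfolded has_integral, rule_format, OF assms(2)]
  by (elim exE conjE) (rule that, assumption, erule allE, erule mp, rule conjI)

text \<open>Riemann sums of \<open>f - fs n\<close> are dominated by Riemann sums of \<open>k n\<close>, which are close to the small number
  \<open>\<kappa> n\<close>; hence the integral of \<open>f\<close> is the limit of the integrals of \<open>fs n\<close>.\<close>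

lemma integrable_on_L1_limit:
  fixes f :: "real \<Rightarrow> 'a::banach"
  assumes fs: "\<And>n. fs n integrable_on {a..b}" and k: "\<And>n. (k n has_integral \<kappa> n) {a..b}"
    and le: "\<And>n x. x \<in> {a..b} \<Longrightarrow> norm (fs n x - f x) \<le> k n x" and \<kappa>: "\<kappa> \<longlonglongrightarrow> (0::real)"
  shows "f integrable_on {a..b}"
proof -
  define J where "J n = integral {a..b} (fs n)" for n
  have diff: "norm (J m - J n) \<le> \<kappa> m + \<kappa> n" for m n
  proof -
    have "norm (integral {a..b} (\<lambda>x. fs m x - fs n x)) \<le> integral {a..b} (\<lambda>x. k m x + k n x)"
    proof (rule integral_norm_bound_integral)
      fix x assume x: "x \<in> {a..b}"
      have "norm (fs m x - fs n x) = norm ((fs m x - f x) - (fs n x - f x))" by simp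
      also have "\<dots> \<le> norm (fs m x - f x) + norm (fs n x - f x)" by (rule norm_triangle_ineq4)
      also have "\<dots> \<le> k m x + k n x" using le[OF x] by (intro add_mono)
      finally show "norm (fs m x - fs n x) \<le> k m x + k n x" .
    qed (use fs k in \<open>auto intro!: integrable_diff integrable_add\<close>)
    then show ?thesis unfolding J_def
      using integral_diff[OF fs fs, of m n] integral_unique[OF has_integral_add[OF k k, of m n]] by simp
  qed
  have "Cauchy J"
  proof (rule metric_CauchyI)
    fix e :: real assume "e > 0"
    then obtain n0 where "\<And>n. n \<ge> n0 \<Longrightarrow> \<bar>\<kappa> n\<bar> < e / 2" using LIMSEQ_D[OF \<kappa>, of "e/2"] by auto
    then have "dist (J m) (J n) < e" if "m \<ge> n0" "n \<ge> n0" for m n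
      using diff[of m n] that unfolding dist_norm by (smt (verit) field_sum_of_halves)
    then show "\<exists>M. \<forall>m\<ge>M. \<forall>n\<ge>M. dist (J m) (J n) < e" by blast
  qed
  then obtain I where I: "J \<longlonglongrightarrow> I" using Cauchy_convergent convergent_def by blast
  have "(f has_integral I) (cbox a b)"
    unfolding has_integral
  proof (intro allI impI)
    fix e :: real assume e: "e > 0"
    obtain n1 where n1: "\<And>n. n \<ge> n1 \<Longrightarrow> \<bar>\<kappa> n\<bar> < e / 4" using LIMSEQ_D[OF \<kappa>, of "e/4"] e by auto
    obtain n2 where n2: "\<And>n. n \<ge> n2 \<Longrightarrow> norm (J n - I) < e / 4" using LIMSEQ_D[OF I, of "e/4"] e by auto
    define n where "n = max n1 n2"
    have n: "\<bar>\<kappa> n\<bar> < e / 4" "norm (J n - I) < e / 4" using n1 n2 by (auto simp: n_def)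
    have "(fs n has_integral J n) (cbox a b)" "(k n has_integral \<kappa> n) (cbox a b)"
      using fs[of n] k[of n] by (auto simp: J_def integrable_integral)
    note h = this
    have e4: "e / 4 > 0" using e by simp
    obtain g1 where g1: "gauge g1" "\<And>p. p tagged_division_of (cbox a b) \<Longrightarrow> g1 fine p \<Longrightarrow>
        norm ((\<Sum>(x, k)\<in>p. measure lborel k *\<^sub>R fs n x) - J n) < e/4"
      by (rule has_integral_gauge[OF h(1) e4]) (rule that)
    obtain g2 where g2: "gauge g2" "\<And>p. p tagged_division_of (cbox a b) \<Longrightarrow> g2 fine p \<Longrightarrow>
        norm ((\<Sum>(x, l)\<in>p. measure lborel l *\<^sub>R k n x) - \<kappa> n) < e/4"
      by (rule has_integral_gauge[OF h(2) e4]) (rule that)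
    show "\<exists>\<gamma>. gauge \<gamma> \<and> (\<forall>\<D>. \<D> tagged_division_of cbox a b \<and> \<gamma> fine \<D> \<longrightarrow>
            norm ((\<Sum>(x, k)\<in>\<D>. measure lborel k *\<^sub>R f x) - I) < e)"
    proof (intro exI[of _ "\<lambda>x. g1 x \<inter> g2 x"] conjI allI impI)
      show "gauge (\<lambda>x. g1 x \<inter> g2 x)" by (rule gauge_Int[OF g1(1) g2(1)])
      fix p assume "p tagged_division_of cbox a b \<and> (\<lambda>x. g1 x \<inter> g2 x) fine p"
      then have p: "p tagged_division_of cbox a b" "g1 fine p" "g2 fine p" by (auto simp: fine_Int)
      have "norm ((\<Sum>(x, l)\<in>p. measure lborel l *\<^sub>R fs n x) - (\<Sum>(x, l)\<in>p. measure lborel l *\<^sub>R f x))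
          = norm (\<Sum>(x, l)\<in>p. measure lborel l *\<^sub>R (fs n x - f x))"
        by (simp add: sum_subtractf[symmetric] case_prod_beta scaleR_diff_right)
      also have "\<dots> \<le> (\<Sum>(x, l)\<in>p. measure lborel l *\<^sub>R k n x)"
      proof (rule order_trans[OF norm_sum], rule sum_mono, clarsimp)
        fix x l assume "(x, l) \<in> p"
        then have "x \<in> l" "l \<subseteq> cbox a b" using tagged_division_ofD(2,3)[OF p(1)] by auto
        then have "x \<in> {a..b}" by auto
        then show "measure lborel l * norm (fs n x - f x) \<le> measure lborel l * k n x" by (simp add: le mult_left_mono)
      qed
      also have "\<dots> < \<kappa> n + e / 4" using g2(2)[OF p(1,3)] unfolding real_norm_def by linarith
      finally have 1: "norm ((\<Sum>(x, l)\<in>p. measure lborel l *\<^sub>R f x) - (\<Sum>(x, l)\<in>p. measure lborel l *\<^sub>R fs n x)) < e / 2"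
        using n(1) by (simp add: norm_minus_commute)
      have 2: "norm ((\<Sum>(x, l)\<in>p. measure lborel l *\<^sub>R fs n x) - J n) < e / 4" by (rule g1(2)[OF p(1,2)])
      have tri: "norm (A - B) \<le> norm (A - C) + norm (C - D) + norm (D - B)" for A B C D :: 'a
        using norm_triangle_ineq[of "A - C" "C - D"] norm_triangle_ineq[of "A - D" "D - B"] by simp
      show "norm ((\<Sum>(x, l)\<in>p. measure lborel l *\<^sub>R f x) - I) < e"
        using tri[of "\<Sum>(x, l)\<in>p. measure lborel l *\<^sub>R f x" I "\<Sum>(x, l)\<in>p. measure lborel l *\<^sub>R fs n x" "J n"] 1 2 n(2) by linarith
    qed
  qed
  then show ?thesis by auto
qed

lemma set_integrable_real_from_nn:
  fixes f :: "real \<Rightarrow> real"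
  assumes "f \<in> borel_measurable borel" "\<And>x. 0 \<le> f x" "(\<integral>\<^sup>+x\<in>A. ennreal (f x) \<partial>lborel) < \<infinity>" "A \<in> sets borel"
  shows "set_integrable lborel A f" "(\<integral>\<^sup>+x\<in>A. ennreal (f x) \<partial>lborel) = ennreal (LBINT x:A. f x)"
proof -
  have e: "ennreal (f x) * indicator A x = ennreal (indicator A x *\<^sub>R f x)" for x by (auto simp: indicator_def)
  show 1: "set_integrable lborel A f" unfolding set_integrable_def
  proof (rule integrableI_nonneg)
    show "(\<lambda>x. indicat_real A x *\<^sub>R f x) \<in> borel_measurable lborel" using assms(1,4) by simp
  qed (use assms e in auto)
  show "(\<integral>\<^sup>+x\<in>A. ennreal (f x) \<partial>lborel) = ennreal (LBINT x:A. f x)"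
    unfolding set_lebesgue_integral_def e
    by (rule nn_integral_eq_integral) (use 1 assms(2) in \<open>auto simp: set_integrable_def\<close>)
qed

text \<open>Bochner's criterion for the Henstock--Kurzweil integral: the dominated simple approximations converge
  in \<open>L\<^sup>1\<close>.\<close>

lemma strongly_measurable_integrable_on:
  fixes f :: "real \<Rightarrow> 'a::banach"
  assumes f: "strongly_measurable f" and fin: "(\<integral>\<^sup>+x\<in>{a..b}. ennreal (norm (f x)) \<partial>lborel) < \<infinity>"
  shows "f integrable_on {a..b}"
    "ennreal (norm (integral {a..b} f)) \<le> (\<integral>\<^sup>+x\<in>{a..b}. ennreal (norm (f x)) \<partial>lborel)"
proof -
  obtain s where s: "\<And>i. simple_function lborel (s i)" "\<And>x. (\<lambda>i. s i x) \<longlonglongrightarrow> f x"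
     "\<And>i x. norm (s i x - f x) \<le> norm (f x)"
    using strongly_measurable_approximation[OF f, of UNIV] by auto
  have nf: "set_integrable lborel {a..b} (\<lambda>x. norm (f x))"
    by (rule set_integrable_real_from_nn) (use fin strongly_measurable_norm[OF f] in auto)
  have ms: "strongly_measurable (\<lambda>x. s i x - f x)" for i
  proof (rule strongly_measurable_diff[OF _ f])
    show "strongly_measurable (s i)" unfolding strongly_measurable_def
      by (intro exI[of _ "\<lambda>_. s i"]) (use s(1) in auto)
  qed
  have ind: "set_integrable lborel {a..b} (\<lambda>x. norm (s i x - f x))" for i
    by (rule set_integrable_bound[OF nf])
      (use s(3) strongly_measurable_norm[OF ms] in \<open>auto simp: set_borel_measurable_def\<close>)
  define \<kappa> where "\<kappa> i = (LBINT x:{a..b}. norm (s i x - f x))" for i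
  show int: "f integrable_on {a..b}"
  proof (rule integrable_on_L1_limit[of s a b "\<lambda>i x. norm (s i x - f x)" \<kappa>])
    show "((\<lambda>x. norm (s n x - f x)) has_integral \<kappa> n) {a..b}" for n
      using set_borel_integral_eq_integral[OF ind[of n]] unfolding \<kappa>_def by (simp add: has_integral_iff)
    show "\<kappa> \<longlonglongrightarrow> 0"
    proof -
      have "(\<lambda>i. LINT x|lborel. indicat_real {a..b} x *\<^sub>R norm (s i x - f x)) \<longlonglongrightarrow> integral\<^sup>L lborel (\<lambda>x::real. 0::real)"
      proof (rule Bochner_Integration.integral_dominated_convergence[of "\<lambda>_. 0" lborel
          "\<lambda>i x. indicat_real {a..b} x *\<^sub>R norm (s i x - f x)" "\<lambda>x. indicat_real {a..b} x *\<^sub>R norm (f x)"])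
        show "integrable lborel (\<lambda>x. indicat_real {a..b} x *\<^sub>R norm (f x))" using nf by (simp add: set_integrable_def)
        show "AE x in lborel. (\<lambda>i. indicat_real {a..b} x *\<^sub>R norm (s i x - f x)) \<longlonglongrightarrow> 0"
        proof (intro AE_I2)
          fix x
          have "(\<lambda>i. norm (s i x - f x)) \<longlonglongrightarrow> 0" using s(2)[of x] by (simp add: LIM_zero tendsto_norm_zero)
          then show "(\<lambda>i. indicat_real {a..b} x *\<^sub>R norm (s i x - f x)) \<longlonglongrightarrow> 0"
            using tendsto_mult_right_zero by auto
        qed
        show "AE x in lborel. norm (indicat_real {a..b} x *\<^sub>R norm (s i x - f x)) \<le> indicat_real {a..b} x *\<^sub>R norm (f x)" for i
          using s(3) by (auto simp: indicator_def)
        show "(\<lambda>x. indicat_real {a..b} x *\<^sub>R norm (s i x - f x)) \<in> borel_measurable lborel" for i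
          using strongly_measurable_norm[OF ms[of i]] by simp
      qed simp
      then show ?thesis by (simp add: \<kappa>_def[abs_def] set_lebesgue_integral_def)
    qed
    show "s n integrable_on {a..b}" for n
    proof -
      have fin: "finite (range (s n))" using simple_functionD(1)[OF s(1)[of n]] by simp
      have "(\<lambda>x. indicat_real (s n -` {y}) x *\<^sub>R y) integrable_on {a..b}" for y
      proof -
        have meas: "s n -` {y} \<in> sets borel" using simple_functionD(2)[OF s(1)[of n], of "{y}"] by simp
        have "set_integrable lborel {a..b} (\<lambda>x. indicat_real (s n -` {y}) x)"
        proof (rule set_integrable_bound[of _ _ "\<lambda>_. 1::real"])
          show "set_integrable lborel {a..b} (\<lambda>_. 1::real)"
            by (rule borel_integrable_atLeastAtMost') auto
          show "set_borel_measurable lborel {a..b} (indicat_real (s n -` {y}))"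
            unfolding set_borel_measurable_def
            by (intro borel_measurable_scaleR borel_measurable_indicator) (use meas in auto)
        qed (auto simp: indicator_def)
        then have "(\<lambda>x. indicat_real (s n -` {y}) x) integrable_on {a..b}"
          by (rule set_borel_integral_eq_integral(1))
        from integrable_linear[OF this bounded_linear_scaleR_left[of y]] show ?thesis by (simp add: comp_def)
      qed
      then have "(\<lambda>x. \<Sum>y\<in>range (s n). indicat_real (s n -` {y}) x *\<^sub>R y) integrable_on {a..b}"
        by (intro integrable_sum fin)
      moreover have "(\<Sum>y\<in>range (s n). indicat_real (s n -` {y}) x *\<^sub>R y) = s n x" for x
      proof -
        have "(\<Sum>y\<in>range (s n). indicat_real (s n -` {y}) x *\<^sub>R y) = (\<Sum>y\<in>range (s n). if y = s n x then y else 0)"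
          by (rule sum.cong) (auto simp: indicator_def)
        also have "\<dots> = s n x" using fin by (simp add: sum.delta)
        finally show ?thesis .
      qed
      ultimately show ?thesis by simp
    qed
  qed auto
  have "norm (integral {a..b} f) \<le> integral {a..b} (\<lambda>x. norm (f x))"
    by (rule integral_norm_bound_integral[OF int]) (use set_borel_integral_eq_integral(1)[OF nf] in auto)
  also have "\<dots> = (LBINT x:{a..b}. norm (f x))" using set_borel_integral_eq_integral(2)[OF nf] by simp
  finally show "ennreal (norm (integral {a..b} f)) \<le> (\<integral>\<^sup>+x\<in>{a..b}. ennreal (norm (f x)) \<partial>lborel)"
    using set_integrable_real_from_nn(2)[of "\<lambda>x. norm (f x)" "{a..b}"] fin strongly_measurable_norm[OF f]
    by (simp add: ennreal_leI)
qed

section \<open>Locally square integrable functions and bounded pairings\<close>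

abbreviation energy :: "real \<Rightarrow> (real \<Rightarrow> 'a::real_normed_vector) \<Rightarrow> ennreal" where
  "energy \<tau> f \<equiv> \<integral>\<^sup>+t\<in>{-\<tau>..\<tau>}. ennreal (norm (f t) ^ 2) \<partial>lborel"

lemma Lloc2_iff: "f \<in> Lloc 2 X \<longleftrightarrow> (\<forall>t. f t \<in> X) \<and> strongly_measurable f \<and> (\<forall>\<tau>>0. energy \<tau> f < \<infinity>)"
  by (auto simp: Lloc_def)

lemma Lloc_tendsto2_iff: "Lloc_tendsto 2 fs f \<longleftrightarrow> (\<forall>\<tau>>0. (\<lambda>n. energy \<tau> (\<lambda>t. fs n t - f t)) \<longlonglongrightarrow> 0)"
  by (simp add: Lloc_tendsto_def)

lemma energy_sum_bound:
  fixes f g :: "real \<Rightarrow> 'a::real_normed_vector"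
  assumes f: "(\<lambda>t. norm (f t)) \<in> borel_measurable borel" and g: "(\<lambda>t. norm (g t)) \<in> borel_measurable borel"
    and h: "\<And>t. t \<in> {-\<tau>..\<tau>} \<Longrightarrow> norm (h t) \<le> norm (f t) + norm (g t)"
  shows "energy \<tau> h \<le> 2 * energy \<tau> f + 2 * energy \<tau> g"
proof -
  have "energy \<tau> h \<le> (\<integral>\<^sup>+t. 2 * (ennreal (norm (f t) ^ 2) * indicator {-\<tau>..\<tau>} t) +
      2 * (ennreal (norm (g t) ^ 2) * indicator {-\<tau>..\<tau>} t) \<partial>lborel)"
  proof (rule nn_integral_mono)
    fix t
    show "ennreal (norm (h t) ^ 2) * indicator {-\<tau>..\<tau>} t \<le> 2 * (ennreal (norm (f t) ^ 2) * indicator {-\<tau>..\<tau>} t) +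
      2 * (ennreal (norm (g t) ^ 2) * indicator {-\<tau>..\<tau>} t)"
    proof (cases "t \<in> {-\<tau>..\<tau>}")
      case True
      have "norm (h t) ^ 2 \<le> (norm (f t) + norm (g t)) ^ 2" using h[OF True] by (intro power_mono) auto
      also have "\<dots> \<le> 2 * norm (f t) ^ 2 + 2 * norm (g t) ^ 2"
        using zero_le_power2[of "norm (f t) - norm (g t)"] by (simp add: power2_eq_square algebra_simps)
      finally have "ennreal (norm (h t) ^ 2) \<le> ennreal (2 * norm (f t) ^ 2 + 2 * norm (g t) ^ 2)" by (rule ennreal_leI)
      then show ?thesis using True by (simp add: ennreal_plus ennreal_mult)
    qed simp
  qed
  also have "\<dots> = 2 * energy \<tau> f + 2 * energy \<tau> g"
    using f g by (subst nn_integral_add) (auto simp: nn_integral_cmult)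
  finally show ?thesis .
qed

lemma energy_finite_of_bounded:
  assumes "\<And>t. t \<in> {-\<tau>..\<tau>} \<Longrightarrow> norm (f t) \<le> K" shows "energy \<tau> f < \<infinity>"
proof -
  have "energy \<tau> f \<le> (\<integral>\<^sup>+t. ennreal (K ^ 2) * indicator {-\<tau>..\<tau>} t \<partial>lborel)"
    using assms by (intro nn_integral_mono) (auto simp: indicator_def intro!: ennreal_leI power_mono)
  also have "\<dots> < \<infinity>" by (simp add: nn_integral_cmult_indicator ennreal_mult_less_top emeasure_lborel_Icc_eq)
  finally show ?thesis .
qed

lemma compact_bounded:
  fixes f :: "real \<Rightarrow> 'a::real_normed_vector"
  assumes "continuous_on UNIV f" obtains K where "\<And>t. t \<in> {c..d} \<Longrightarrow> norm (f t) \<le> K"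
proof -
  have "compact (f ` {c..d})" by (rule compact_continuous_image[OF continuous_on_subset[OF assms]]) auto
  from compact_imp_bounded[OF this] show thesis unfolding bounded_iff by (elim exE) (rule that, erule bspec, rule imageI)
qed

lemma continuous_energy_finite:
  fixes f :: "real \<Rightarrow> 'a::real_normed_vector"
  assumes "continuous_on UNIV f" shows "energy \<tau> f < \<infinity>"
proof -
  obtain K where "\<And>t. t \<in> {-\<tau>..\<tau>} \<Longrightarrow> norm (f t) \<le> K" by (rule compact_bounded[OF assms]) (rule that)
  then show ?thesis by (rule energy_finite_of_bounded)
qed

lemma continuous_Lloc2:
  fixes f :: "real \<Rightarrow> 'a::real_normed_vector"
  shows "continuous_on UNIV f \<Longrightarrow> (\<And>t. f t \<in> Z) \<Longrightarrow> f \<in> Lloc 2 Z"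
  unfolding Lloc2_iff by (intro conjI allI impI strongly_measurable_continuous continuous_energy_finite)

text \<open>The Riesz--Fischer argument. Along a subsequence the increments have energy at most \<open>(1/4) ^ k\<close> on
  \<open>[-(k + 1), k + 1]\<close>, which gives convergence almost everywhere; Fatou's lemma turns this into convergence in
  the mean. The limit is redefined as 0 off the Borel set of convergence, so that it is strongly
  measurable and \<open>M\<close>-valued everywhere.\<close>

lemma Lloc2_complete:
  fixes fs :: "nat \<Rightarrow> real \<Rightarrow> 'a::banach"
  assumes M: "closed M" "0 \<in> M" and fs: "\<And>n. fs n \<in> Lloc 2 M"
    and cauchy: "\<And>\<tau> e. \<tau> > 0 \<Longrightarrow> e > 0 \<Longrightarrow> \<exists>N. \<forall>m\<ge>N. \<forall>n\<ge>N. energy \<tau> (\<lambda>t. fs m t - fs n t) \<le> ennreal e"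
  obtains z where "z \<in> Lloc 2 M" "Lloc_tendsto 2 fs z"
proof -
  have sm: "strongly_measurable (fs n)" for n using fs by (simp add: Lloc2_iff)
  have smd: "strongly_measurable (\<lambda>t. fs m t - fs n t)" for m n by (intro strongly_measurable_diff sm)
  note [measurable] = strongly_measurable_norm[OF sm] strongly_measurable_norm[OF smd]
  have "\<forall>k. \<exists>N. \<forall>m\<ge>N. \<forall>n\<ge>N. energy (real (Suc k)) (\<lambda>t. fs m t - fs n t) \<le> ennreal ((1/4) ^ k)"
    by (intro allI cauchy) auto
  from choice[OF this] obtain N where N0: "\<forall>k. \<forall>m\<ge>N k. \<forall>n\<ge>N k. energy (real (Suc k)) (\<lambda>t. fs m t - fs n t) \<le> ennreal ((1/4) ^ k)" ..
  note N = N0[rule_format]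
  define r where "r k = (\<Sum>j\<le>k. N j) + k" for k
  have rN: "r k \<ge> N k" for k using member_le_sum[of k "{..k}" N] by (simp add: r_def)
  have rmono: "r j \<ge> N k" if "j \<ge> k" for j k using member_le_sum[of k "{..j}" N] that by (simp add: r_def)
  have rk: "r k \<ge> k" for k by (simp add: r_def)
  define d where "d k t = norm (fs (r (Suc k)) t - fs (r k) t) * indicator {- real (Suc k)..real (Suc k)} t" for k t
  have [measurable]: "d k \<in> borel_measurable borel" for k unfolding d_def by measurable
  \<comment> \<open>The weights \<open>2 ^ k\<close> make finiteness of this sum imply summability of the increments themselves, by
    \<open>2 * d \<le> (1/2) ^ k + 2 ^ k * d\<^sup>2\<close>.\<close>
  define S where "S t = (\<Sum>k. ennreal (2 ^ k * (d k t)\<^sup>2))" for t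
  have [measurable]: "S \<in> borel_measurable borel" unfolding S_def by measurable
  have "(\<integral>\<^sup>+t. S t \<partial>lborel) = (\<Sum>k. \<integral>\<^sup>+t. ennreal (2 ^ k * (d k t)\<^sup>2) \<partial>lborel)"
    unfolding S_def by (rule nn_integral_suminf) measurable
  also have "\<dots> \<le> (\<Sum>k. ennreal ((1/2) ^ k))"
  proof (rule suminf_le)
    fix k
    have "(\<integral>\<^sup>+t. ennreal (2 ^ k * (d k t)\<^sup>2) \<partial>lborel) = (\<integral>\<^sup>+t. ennreal (2 ^ k) * (ennreal (norm (fs (r (Suc k)) t - fs (r k) t) ^ 2) * indicator {- real (Suc k)..real (Suc k)} t) \<partial>lborel)"
      by (rule nn_integral_cong) (auto simp: d_def indicator_def ennreal_mult)
    also have "\<dots> = ennreal (2 ^ k) * energy (real (Suc k)) (\<lambda>t. fs (r (Suc k)) t - fs (r k) t)"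
      by (rule nn_integral_cmult) measurable
    also have "\<dots> \<le> ennreal (2 ^ k) * ennreal ((1/4) ^ k)"
      by (intro mult_left_mono N rN rmono) auto
    also have "\<dots> = ennreal ((1/2) ^ k)" by (simp add: ennreal_mult[symmetric] power_mult_distrib[symmetric] del: power_mult_distrib)
    finally show "(\<integral>\<^sup>+t. ennreal (2 ^ k * (d k t)\<^sup>2) \<partial>lborel) \<le> ennreal ((1/2) ^ k)" .
  qed auto
  also have "\<dots> = ennreal (\<Sum>k. (1/2) ^ k)" by (intro suminf_ennreal2 summable_geometric) auto
  also have "\<dots> < \<infinity>" by simp
  finally have "AE t in lborel. S t \<noteq> \<infinity>" by (intro nn_integral_PInf_AE) auto
  define P where "P = {t. S t \<noteq> \<infinity>}"
  have P: "P \<in> sets borel" unfolding P_def by measurable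
  have AEP: "AE t in lborel. t \<in> P" using \<open>AE t in lborel. S t \<noteq> \<infinity>\<close> by (simp add: P_def)
  have conv: "convergent (\<lambda>k. fs (r k) t)" if t: "t \<in> P" for t
  proof -
    have "summable (\<lambda>k. 2 ^ k * (d k t)\<^sup>2)"
    proof (rule summable_suminf_not_top)
      show "(\<Sum>k. ennreal (2 ^ k * (d k t)\<^sup>2)) \<noteq> top" using t unfolding P_def S_def by (simp only: mem_Collect_eq infinity_ennreal_def not_False_eq_True)
    qed simp
    moreover have "summable (\<lambda>k. (1/2::real) ^ k)" by (rule summable_geometric) simp
    ultimately have "summable (\<lambda>k. (1/2::real) ^ k + 2 ^ k * (d k t)\<^sup>2)" by (intro summable_add)
    then have sd: "summable (\<lambda>k. d k t)"
    proof (rule summable_comparison_test'[where N=0])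
      fix k
      have "0 \<le> 2 ^ k * (d k t - (1/2) ^ k)\<^sup>2" by simp
      also have "\<dots> = 2 ^ k * (d k t)\<^sup>2 - 2 * d k t * (2 ^ k * (1/2) ^ k) + (2 ^ k * (1/2) ^ k) * (1/2) ^ k"
        by (simp add: power2_eq_square algebra_simps)
      also have "(2::real) ^ k * (1/2) ^ k = 1" by (simp add: power_mult_distrib[symmetric] del: power_mult_distrib)
      finally have "2 * d k t \<le> (1/2) ^ k + 2 ^ k * (d k t)\<^sup>2" by simp
      moreover have "d k t \<ge> 0" by (simp add: d_def)
      ultimately show "norm (d k t) \<le> (1/2) ^ k + 2 ^ k * (d k t)\<^sup>2" by simp
    qed
    have "summable (\<lambda>k. norm (fs (r (Suc k)) t - fs (r k) t))"
    proof (rule summable_comparison_test'[OF sd, where N="nat \<lceil>\<bar>t\<bar>\<rceil>"])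
      fix k assume "k \<ge> nat \<lceil>\<bar>t\<bar>\<rceil>"
      then have "\<bar>t\<bar> \<le> real (Suc k)" by linarith
      then show "norm (norm (fs (r (Suc k)) t - fs (r k) t)) \<le> d k t" by (auto simp: d_def indicator_def)
    qed
    then have "summable (\<lambda>k. fs (r (Suc k)) t - fs (r k) t)" by (rule summable_norm_cancel)
    from convergent_add[OF summable_LIMSEQ[OF this, THEN convergentI] convergent_const[of "fs (r 0) t"]]
    show ?thesis by (simp add: sum_lessThan_telescope[of "\<lambda>k. fs (r k) t"])
  qed
  define z where "z t = (if t \<in> P then lim (\<lambda>k. fs (r k) t) else 0)" for t
  have lim: "(\<lambda>k. if t \<in> P then fs (r k) t else 0) \<longlonglongrightarrow> z t" for t
    using conv[of t] by (auto simp: z_def convergent_LIMSEQ_iff)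
  have smz: "strongly_measurable z"
    by (rule strongly_measurable_LIMSEQ[OF strongly_measurable_if[OF sm] lim]) (use P in simp)
  note [measurable] = strongly_measurable_norm[OF strongly_measurable_diff[OF sm smz]]
  have zM: "z t \<in> M" for t
    by (rule closed_sequentially[OF M(1) _ lim]) (use M fs in \<open>auto simp: Lloc2_iff\<close>)
  have fatou: "energy \<tau> (\<lambda>t. fs n t - z t) \<le> ennreal e"
    if "\<And>k. k \<ge> K \<Longrightarrow> energy \<tau> (\<lambda>t. fs n t - fs (r k) t) \<le> ennreal e" for \<tau> e n K
  proof -
    have "energy \<tau> (\<lambda>t. fs n t - z t) =
        (\<integral>\<^sup>+t. liminf (\<lambda>k. ennreal (norm (fs n t - fs (r k) t) ^ 2) * indicator {-\<tau>..\<tau>} t) \<partial>lborel)"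
    proof (rule nn_integral_cong_AE, use AEP in eventually_elim)
      fix t assume "t \<in> P"
      then have "(\<lambda>k. fs (r k) t) \<longlonglongrightarrow> z t" using lim[of t] by simp
      then have "(\<lambda>k. ennreal (norm (fs n t - fs (r k) t) ^ 2) * indicator {-\<tau>..\<tau>} t) \<longlonglongrightarrow> ennreal (norm (fs n t - z t) ^ 2) * indicator {-\<tau>..\<tau>} t"
        by (cases "t \<in> {-\<tau>..\<tau>}") (auto intro!: tendsto_intros simp del: ennreal_power)
      from lim_imp_Liminf[OF sequentially_bot this]
      show "ennreal (norm (fs n t - z t) ^ 2) * indicator {-\<tau>..\<tau>} t = liminf (\<lambda>k. ennreal (norm (fs n t - fs (r k) t) ^ 2) * indicator {-\<tau>..\<tau>} t)"
        by simp
    qed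
    also have "\<dots> \<le> liminf (\<lambda>k. energy \<tau> (\<lambda>t. fs n t - fs (r k) t))"
      by (rule nn_integral_liminf) measurable
    also have "\<dots> \<le> liminf (\<lambda>k. ennreal e)"
      by (rule Liminf_mono) (use that in \<open>auto simp: eventually_sequentially\<close>)
    also have "\<dots> = ennreal e" by (simp add: Liminf_const)
    finally show ?thesis .
  qed
  have tend: "(\<lambda>n. energy \<tau> (\<lambda>t. fs n t - z t)) \<longlonglongrightarrow> 0" if "\<tau> > 0" for \<tau>
  proof (rule order_tendstoI)
    fix a :: ennreal assume "0 < a"
    then obtain e where e: "0 < ennreal e" "ennreal e < a" using ennreal_rat_dense[of 0 a] by metis
    then have "e > 0" by simp
    from cauchy[OF that this] obtain n0 where n0: "\<And>m n. m \<ge> n0 \<Longrightarrow> n \<ge> n0 \<Longrightarrow> energy \<tau> (\<lambda>t. fs m t - fs n t) \<le> ennreal e" by blast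
    have "energy \<tau> (\<lambda>t. fs n t - z t) \<le> ennreal e" if "n \<ge> n0" for n
      by (rule fatou[of n0], rule n0[OF that], erule order_trans[OF _ rk])
    from le_less_trans[OF this e(2)]
    show "\<forall>\<^sub>F n in sequentially. energy \<tau> (\<lambda>t. fs n t - z t) < a"
      by (rule eventually_sequentiallyI)
  qed simp
  have "energy \<tau> z < \<infinity>" if "\<tau> > 0" for \<tau>
  proof -
    have "\<forall>\<^sub>F n in sequentially. energy \<tau> (\<lambda>t. fs n t - z t) < 1"
      by (rule order_tendstoD(2)[OF tend[OF that]]) simp
    then obtain n where n: "energy \<tau> (\<lambda>t. fs n t - z t) < 1" by (auto simp: eventually_sequentially)
    have "energy \<tau> z \<le> 2 * energy \<tau> (fs n) + 2 * energy \<tau> (\<lambda>t. fs n t - z t)"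
      by (rule energy_sum_bound[OF strongly_measurable_norm[OF sm] strongly_measurable_norm[OF strongly_measurable_diff[OF sm smz]]])
        (metis norm_triangle_sub norm_minus_commute)
    also have "\<dots> < \<infinity>"
    proof -
      have "energy \<tau> (fs n) < top" using fs[of n] that by (simp add: Lloc2_iff)
      moreover have "energy \<tau> (\<lambda>t. fs n t - z t) < top" using n by (rule less_trans) simp
      moreover have "(2::ennreal) < top" by simp
      ultimately show ?thesis unfolding infinity_ennreal_def by (intro ennreal_add_less_top[THEN iffD2] conjI ennreal_mult_less_top[THEN iffD2] disjI2) auto
    qed
    finally show ?thesis .
  qed
  then show thesis using that[of z] smz zM tend by (auto simp: Lloc2_iff Lloc_tendsto2_iff)
qed

lemma ennreal_square_tendsto_0:
  fixes x :: "nat \<Rightarrow> ennreal"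
  assumes "\<And>n. (x n)\<^sup>2 \<le> a n" "a \<longlonglongrightarrow> 0" shows "x \<longlonglongrightarrow> 0"
proof (rule order_tendstoI)
  fix e :: ennreal assume "0 < e"
  then obtain r where r: "0 < ennreal r" "ennreal r < e" using ennreal_rat_dense[of 0 e] by metis
  then have "0 < (ennreal r)\<^sup>2" by (simp add: ennreal_power)
  then have "\<forall>\<^sub>F n in sequentially. a n < (ennreal r)\<^sup>2" by (rule order_tendstoD(2)[OF assms(2)])
  then show "\<forall>\<^sub>F n in sequentially. x n < e"
  proof eventually_elim
    case (elim n)
    have "x n < ennreal r"
    proof (rule ccontr)
      assume "\<not> x n < ennreal r"
      then have "(ennreal r)\<^sup>2 \<le> (x n)\<^sup>2" by (intro power_mono) auto
      also have "\<dots> \<le> a n" by (rule assms)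
      finally show False using elim by simp
    qed
    then show ?case using r by simp
  qed
qed simp

lemma product_tendsto_0:
  fixes a b :: "nat \<Rightarrow> real \<Rightarrow> real"
  assumes [measurable]: "\<And>n. a n \<in> borel_measurable borel" "\<And>n. b n \<in> borel_measurable borel"
    and pos: "\<And>n t. a n t \<ge> 0" "\<And>n t. b n t \<ge> 0"
    and a0: "(\<lambda>n. energy \<tau> (a n)) \<longlonglongrightarrow> 0" and b0: "\<And>n. energy \<tau> (b n) \<le> \<beta>" "\<beta> < \<infinity>"
  shows "(\<lambda>n. \<integral>\<^sup>+t\<in>{-\<tau>..\<tau>}. ennreal (a n t * b n t) \<partial>lborel) \<longlonglongrightarrow> 0"
proof (rule ennreal_square_tendsto_0)
  fix n
  let ?I = "\<lambda>t. indicator {-\<tau>..\<tau>} t :: ennreal"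
  have "(\<integral>\<^sup>+t\<in>{-\<tau>..\<tau>}. ennreal (a n t * b n t) \<partial>lborel) = (\<integral>\<^sup>+t. (ennreal (a n t) * ?I t) * (ennreal (b n t) * ?I t) \<partial>lborel)"
    using pos by (intro nn_integral_cong) (auto simp: indicator_def ennreal_mult)
  then have "(\<integral>\<^sup>+t\<in>{-\<tau>..\<tau>}. ennreal (a n t * b n t) \<partial>lborel)\<^sup>2 \<le>
     (\<integral>\<^sup>+t. (ennreal (a n t) * ?I t)\<^sup>2 \<partial>lborel) * (\<integral>\<^sup>+t. (ennreal (b n t) * ?I t)\<^sup>2 \<partial>lborel)"
    by (simp only:) (rule Cauchy_Schwarz_nn_integral; measurable)
  also have "(\<integral>\<^sup>+t. (ennreal (a n t) * ?I t)\<^sup>2 \<partial>lborel) = energy \<tau> (a n)"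
    using pos by (intro nn_integral_cong) (auto simp: indicator_def ennreal_power)
  also have "(\<integral>\<^sup>+t. (ennreal (b n t) * ?I t)\<^sup>2 \<partial>lborel) = energy \<tau> (b n)"
    using pos by (intro nn_integral_cong) (auto simp: indicator_def ennreal_power)
  also have "energy \<tau> (a n) * energy \<tau> (b n) \<le> energy \<tau> (a n) * \<beta>" by (intro mult_left_mono b0) auto
  finally show "(\<integral>\<^sup>+t\<in>{-\<tau>..\<tau>}. ennreal (a n t * b n t) \<partial>lborel)\<^sup>2 \<le> energy \<tau> (a n) * \<beta>" .
next
  have "(\<lambda>n. \<beta> * energy \<tau> (a n)) \<longlonglongrightarrow> \<beta> * 0"
    by (intro ennreal_tendsto_cmult a0) (use b0(2) in auto)
  then show "(\<lambda>n. energy \<tau> (a n) * \<beta>) \<longlonglongrightarrow> 0" by (simp add: mult.commute)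
qed

text \<open>The pairing is controlled on the subspace \<open>X\<close> only. The constant 1 in the bound suits inner products; other
  bounded forms are scaled before use.\<close>

locale bounded_pairing =
  fixes X :: "'a::real_normed_vector set" and B :: "'a \<Rightarrow> 'a \<Rightarrow> 'b::euclidean_space"
  assumes X: "subspace X"
    and add_left: "\<And>u v w. u \<in> X \<Longrightarrow> v \<in> X \<Longrightarrow> w \<in> X \<Longrightarrow> B (u + v) w = B u w + B v w"
    and add_right: "\<And>u v w. u \<in> X \<Longrightarrow> v \<in> X \<Longrightarrow> w \<in> X \<Longrightarrow> B w (u + v) = B w u + B w v"
    and bound: "\<And>u v. u \<in> X \<Longrightarrow> v \<in> X \<Longrightarrow> norm (B u v) \<le> norm u * norm v"
begin

lemma diff_bound:
  assumes "u \<in> X" "v \<in> X" "u' \<in> X" "v' \<in> X"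
  shows "norm (B u v - B u' v') \<le> norm (u - u') * norm v + norm u' * norm (v - v')"
proof -
  have d: "u - u' \<in> X" "v - v' \<in> X" using assms subspace_diff[OF X] by auto
  have "B u v = B (u - u') v + B u' v" "B u' v = B u' (v - v') + B u' v'"
    using add_left[OF d(1) assms(3,2)] add_right[OF d(2) assms(4,3)] by simp_all
  then have "B u v - B u' v' = B (u - u') v + B u' (v - v')" by simp
  also have "norm \<dots> \<le> norm (B (u - u') v) + norm (B u' (v - v'))" by (rule norm_triangle_ineq)
  also have "\<dots> \<le> norm (u - u') * norm v + norm u' * norm (v - v')" using assms d by (intro add_mono bound)
  finally show ?thesis .
qed

lemma B_tendsto:
  assumes "\<And>h. f h \<in> X" "\<And>h. g h \<in> X" "u \<in> X" "v \<in> X" "(f \<longlongrightarrow> u) F" "(g \<longlongrightarrow> v) F"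
  shows "((\<lambda>h. B (f h) (g h)) \<longlongrightarrow> B u v) F"
proof (rule LIM_zero_cancel, rule Lim_null_comparison)
  show "\<forall>\<^sub>F h in F. norm (B (f h) (g h) - B u v) \<le> norm (f h - u) * norm (g h) + norm u * norm (g h - v)"
    using diff_bound assms by (intro always_eventually) auto
  have "((\<lambda>h. norm (f h - u) * norm (g h) + norm u * norm (g h - v)) \<longlongrightarrow> 0 * norm v + norm u * 0) F"
    using assms(5,6) by (intro tendsto_intros) (simp_all add: LIM_zero tendsto_norm_zero)
  then show "((\<lambda>h. norm (f h - u) * norm (g h) + norm u * norm (g h - v)) \<longlongrightarrow> 0) F" by simp
qed

lemma B_measurable:
  assumes "strongly_measurable f" "strongly_measurable g" "\<And>t. f t \<in> X" "\<And>t. g t \<in> X"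
  shows "(\<lambda>t. B (f t) (g t)) \<in> borel_measurable borel"
proof -
  have "strongly_measurable (\<lambda>t. B (f t) (g t))"
    by (rule strongly_measurable_compose2[where M=X])
      (use assms subspace_0[OF X] in \<open>auto intro: B_tendsto\<close>)
  from strongly_measurable_borel_compose[OF this continuous_on_id] show ?thesis by simp
qed

text \<open>Bilinear expressions of sequences that converge in the mean square converge in the mean, by the
  Cauchy--Schwarz inequality.\<close>

lemma weighted_integral_tendsto:
  assumes f: "f \<in> Lloc 2 X" "\<And>n. fs n \<in> Lloc 2 X" "Lloc_tendsto 2 fs f"
    and g: "g \<in> Lloc 2 X" "\<And>n. gs n \<in> Lloc 2 X" "Lloc_tendsto 2 gs g"
    and A: "A \<in> sets borel" "A \<subseteq> {-\<tau>..\<tau>}" "\<tau> > 0"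
    and w: "w \<in> borel_measurable borel" "\<And>t. t \<in> A \<Longrightarrow> \<bar>w t\<bar> \<le> K"
  shows "set_integrable lborel A (\<lambda>t. w t *\<^sub>R B (f t) (g t))"
    "(\<lambda>n. LBINT t:A. w t *\<^sub>R B (fs n t) (gs n t)) \<longlonglongrightarrow> (LBINT t:A. w t *\<^sub>R B (f t) (g t))"
proof -
  have intg: "set_integrable lborel A (\<lambda>t. w t *\<^sub>R B (f t) (g t))" if "f \<in> Lloc 2 X" "g \<in> Lloc 2 X" for f g
  proof -
    note f = that(1)[unfolded Lloc2_iff] and g = that(2)[unfolded Lloc2_iff]
    have [measurable]: "(\<lambda>t. B (f t) (g t)) \<in> borel_measurable borel" using B_measurable f g by blast
    note [measurable] = f[THEN conjunct2, THEN conjunct1, THEN strongly_measurable_norm]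
      g[THEN conjunct2, THEN conjunct1, THEN strongly_measurable_norm] A(1) w(1)
    let ?h = "\<lambda>t. \<bar>K\<bar> * (norm (f t) ^ 2 + norm (g t) ^ 2)"
    have "(\<integral>\<^sup>+t\<in>{-\<tau>..\<tau>}. ennreal (norm (f t) ^ 2 + norm (g t) ^ 2) \<partial>lborel) = energy \<tau> f + energy \<tau> g"
      by (subst nn_integral_add[symmetric]) (auto intro!: nn_integral_cong simp: ennreal_plus distrib_right)
    also have "\<dots> < \<infinity>" using f g A(3) by simp
    finally have "set_integrable lborel {-\<tau>..\<tau>} (\<lambda>t. norm (f t) ^ 2 + norm (g t) ^ 2)"
      by (intro set_integrable_real_from_nn) auto
    then have "set_integrable lborel {-\<tau>..\<tau>} ?h" by (simp add: set_integrable_mult_right)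
    then have "set_integrable lborel A ?h" by (rule set_integrable_subset) (use A in auto)
    then show ?thesis
    proof (rule set_integrable_bound)
      show "set_borel_measurable lborel A (\<lambda>t. w t *\<^sub>R B (f t) (g t))" unfolding set_borel_measurable_def by measurable
      have "norm (w t *\<^sub>R B (f t) (g t)) \<le> norm (?h t)" if "t \<in> A" for t
      proof -
        have "norm (B (f t) (g t)) \<le> norm (f t) * norm (g t)" using f g by (intro bound) auto
        also have "\<dots> \<le> norm (f t) ^ 2 + norm (g t) ^ 2"
          using sum_squares_bound[of "norm (f t)" "norm (g t)"] mult_nonneg_nonneg[OF norm_ge_zero[of "f t"] norm_ge_zero[of "g t"]]
          by linarith
        finally have "\<bar>w t\<bar> * norm (B (f t) (g t)) \<le> \<bar>K\<bar> * (norm (f t) ^ 2 + norm (g t) ^ 2)"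
          using w(2)[OF that] by (intro mult_mono) auto
        then show ?thesis by (simp add: abs_mult)
      qed
      then show "AE t in lborel. t \<in> A \<longrightarrow> norm (w t *\<^sub>R B (f t) (g t)) \<le> norm (?h t)" by auto
    qed
  qed
  show "set_integrable lborel A (\<lambda>t. w t *\<^sub>R B (f t) (g t))" by (rule intg[OF f(1) g(1)])
  note fm = f(1)[unfolded Lloc2_iff] f(2)[unfolded Lloc2_iff] and gm = g(1)[unfolded Lloc2_iff] g(2)[unfolded Lloc2_iff]
  note smfd = strongly_measurable_diff[OF fm(2)[THEN conjunct2, THEN conjunct1] fm(1)[THEN conjunct2, THEN conjunct1]]
  note smgd = strongly_measurable_diff[OF gm(2)[THEN conjunct2, THEN conjunct1] gm(1)[THEN conjunct2, THEN conjunct1]]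
  note [measurable] = fm(1)[THEN conjunct2, THEN conjunct1, THEN strongly_measurable_norm]
      gm(1)[THEN conjunct2, THEN conjunct1, THEN strongly_measurable_norm]
      smfd[THEN strongly_measurable_norm] smgd[THEN strongly_measurable_norm] A(1) w(1)
  have ef: "(\<lambda>n. energy \<tau> (\<lambda>t. norm (fs n t - f t))) \<longlonglongrightarrow> 0" and eg: "(\<lambda>n. energy \<tau> (\<lambda>t. norm (gs n t - g t))) \<longlonglongrightarrow> 0"
    using f(3) g(3) A(3) by (auto simp: Lloc_tendsto2_iff)
  have Ef: "energy \<tau> f < \<infinity>" and Eg: "energy \<tau> g < \<infinity>" using fm gm A(3) by auto
  let ?P = "\<lambda>u v n. \<integral>\<^sup>+t\<in>{-\<tau>..\<tau>}. ennreal (norm (u n t) * norm (v n t)) \<partial>lborel"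
  have "\<forall>\<^sub>F n in sequentially. energy \<tau> (\<lambda>t. norm (gs n t - g t)) < 1"
    by (rule order_tendstoD(2)[OF eg]) simp
  then obtain n0 where n0: "\<And>n. n \<ge> n0 \<Longrightarrow> energy \<tau> (\<lambda>t. norm (gs n t - g t)) < 1" by (auto simp: eventually_sequentially)
  have 1: "(\<lambda>n. \<integral>\<^sup>+t\<in>{-\<tau>..\<tau>}. ennreal (norm (fs (n + n0) t - f t) * norm (gs (n + n0) t - g t)) \<partial>lborel) \<longlonglongrightarrow> 0"
  proof (rule product_tendsto_0[where \<beta>=1])
    show "energy \<tau> (\<lambda>t. norm (gs (n + n0) t - g t)) \<le> 1" for n using n0[of "n + n0"] by simp
    show "(\<lambda>n. energy \<tau> (\<lambda>t. norm (fs (n + n0) t - f t))) \<longlonglongrightarrow> 0" using LIMSEQ_ignore_initial_segment[OF ef] .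
  qed auto
  have 2: "(\<lambda>n. \<integral>\<^sup>+t\<in>{-\<tau>..\<tau>}. ennreal (norm (fs (n + n0) t - f t) * norm (g t)) \<partial>lborel) \<longlonglongrightarrow> 0"
    by (rule product_tendsto_0[where \<beta>="energy \<tau> g"]) (use LIMSEQ_ignore_initial_segment[OF ef] Eg in auto)
  have 3: "(\<lambda>n. \<integral>\<^sup>+t\<in>{-\<tau>..\<tau>}. ennreal (norm (gs (n + n0) t - g t) * norm (f t)) \<partial>lborel) \<longlonglongrightarrow> 0"
    by (rule product_tendsto_0[where \<beta>="energy \<tau> f"]) (use LIMSEQ_ignore_initial_segment[OF eg] Ef in auto)
  define R where "R n t = norm (fs n t - f t) * norm (gs n t - g t) + norm (fs n t - f t) * norm (g t) + norm (gs n t - g t) * norm (f t)" for n t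
  have R0: "R n t \<ge> 0" for n t by (simp add: R_def)
  have [measurable]: "R n \<in> borel_measurable borel" for n unfolding R_def by measurable
  have lim: "(\<lambda>n. ennreal \<bar>K\<bar> * (\<integral>\<^sup>+t\<in>{-\<tau>..\<tau>}. ennreal (R (n + n0) t) \<partial>lborel)) \<longlonglongrightarrow> 0"
  proof -
    have "(\<integral>\<^sup>+t\<in>{-\<tau>..\<tau>}. ennreal (R n t) \<partial>lborel) =
       (\<integral>\<^sup>+t\<in>{-\<tau>..\<tau>}. ennreal (norm (fs n t - f t) * norm (gs n t - g t)) \<partial>lborel)
     + (\<integral>\<^sup>+t\<in>{-\<tau>..\<tau>}. ennreal (norm (fs n t - f t) * norm (g t)) \<partial>lborel)
     + (\<integral>\<^sup>+t\<in>{-\<tau>..\<tau>}. ennreal (norm (gs n t - g t) * norm (f t)) \<partial>lborel)" for n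
      unfolding R_def
      by (subst nn_integral_add[symmetric]; (subst nn_integral_add[symmetric])?)
        (auto intro!: nn_integral_cong simp: ennreal_plus distrib_right)
    then have "(\<lambda>n. ennreal \<bar>K\<bar> * (\<integral>\<^sup>+t\<in>{-\<tau>..\<tau>}. ennreal (R (n + n0) t) \<partial>lborel)) \<longlonglongrightarrow> ennreal \<bar>K\<bar> * (0 + 0 + 0)"
      using 1 2 3 by (simp only:) (intro ennreal_tendsto_cmult tendsto_add; simp)
    then show ?thesis by simp
  qed
  have le: "(\<integral>\<^sup>+t. ennreal (norm (indicat_real A t *\<^sub>R (w t *\<^sub>R B (fs n t) (gs n t)) - indicat_real A t *\<^sub>R (w t *\<^sub>R B (f t) (g t)))) \<partial>lborel)
     \<le> ennreal \<bar>K\<bar> * (\<integral>\<^sup>+t\<in>{-\<tau>..\<tau>}. ennreal (R n t) \<partial>lborel)" for n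
  proof -
    have "norm (indicat_real A t *\<^sub>R (w t *\<^sub>R B (fs n t) (gs n t)) - indicat_real A t *\<^sub>R (w t *\<^sub>R B (f t) (g t)))
       \<le> \<bar>K\<bar> * R n t * indicator {-\<tau>..\<tau>} t" for t
    proof (cases "t \<in> A")
      case True
      have "norm (B (fs n t) (gs n t) - B (f t) (g t)) \<le> norm (fs n t - f t) * norm (gs n t) + norm (f t) * norm (gs n t - g t)"
        using fm gm by (intro diff_bound) auto
      also have "\<dots> \<le> norm (fs n t - f t) * (norm (gs n t - g t) + norm (g t)) + norm (f t) * norm (gs n t - g t)"
        by (intro add_mono mult_left_mono norm_triangle_sub order_refl norm_ge_zero) (metis add.commute norm_triangle_sub)
      also have "\<dots> = R n t" by (simp add: R_def algebra_simps)
      finally have "\<bar>w t\<bar> * norm (B (fs n t) (gs n t) - B (f t) (g t)) \<le> \<bar>K\<bar> * R n t"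
        using w(2)[OF True] by (intro mult_mono) auto
      then show ?thesis using True A(2) by (auto simp flip: scaleR_diff_right)
    qed (use R0 in auto)
    then have "(\<integral>\<^sup>+t. ennreal (norm (indicat_real A t *\<^sub>R (w t *\<^sub>R B (fs n t) (gs n t)) - indicat_real A t *\<^sub>R (w t *\<^sub>R B (f t) (g t)))) \<partial>lborel)
      \<le> (\<integral>\<^sup>+t. ennreal \<bar>K\<bar> * (ennreal (R n t) * indicator {-\<tau>..\<tau>} t) \<partial>lborel)"
      by (intro nn_integral_mono) (subst ennreal_indicator[symmetric], subst ennreal_mult[symmetric], (simp add: R0)+,
          subst ennreal_mult[symmetric], auto simp: R0 intro!: ennreal_leI simp: mult.assoc)
    also have "\<dots> = ennreal \<bar>K\<bar> * (\<integral>\<^sup>+t\<in>{-\<tau>..\<tau>}. ennreal (R n t) \<partial>lborel)"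
      by (rule nn_integral_cmult) measurable
    finally show ?thesis .
  qed
  have "(\<lambda>n. LBINT t:A. w t *\<^sub>R B (fs (n + n0) t) (gs (n + n0) t)) \<longlonglongrightarrow> (LBINT t:A. w t *\<^sub>R B (f t) (g t))"
    unfolding set_lebesgue_integral_def
  proof (rule tendsto_L1_int)
    show "(\<lambda>n. \<integral>\<^sup>+t. ennreal (norm (indicat_real A t *\<^sub>R (w t *\<^sub>R B (fs (n + n0) t) (gs (n + n0) t)) - indicat_real A t *\<^sub>R (w t *\<^sub>R B (f t) (g t)))) \<partial>lborel) \<longlonglongrightarrow> 0"
      by (rule tendsto_sandwich[OF _ _ tendsto_const lim]) (use le in auto)
  qed (use intg[OF f(2) g(2)] intg[OF f(1) g(1)] in \<open>auto simp: set_integrable_def\<close>)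
  then show "(\<lambda>n. LBINT t:A. w t *\<^sub>R B (fs n t) (gs n t)) \<longlonglongrightarrow> (LBINT t:A. w t *\<^sub>R B (f t) (g t))"
    by (rule LIMSEQ_offset)
qed

end

section \<open>Uniform boundedness\<close>

text \<open>If no uniform bound exists, every ball contains a smaller ball on which some operator is as large as
  desired: of \<open>p + h\<close> and \<open>p - h\<close> at least one has a large image when \<open>h\<close> has. A point common to a nested
  sequence of such balls contradicts pointwise boundedness.\<close>

lemma uniform_boundedness:
  fixes F :: "'i \<Rightarrow> 'a::banach \<Rightarrow> 'b::real_normed_vector"
  assumes F: "\<And>i. i \<in> I \<Longrightarrow> bounded_linear (F i)" and pw: "\<And>x. \<exists>K. \<forall>i\<in>I. norm (F i x) \<le> K"
  obtains K where "\<And>i x. i \<in> I \<Longrightarrow> norm (F i x) \<le> K * norm x"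
proof (rule ccontr)
  assume neg: "\<not> thesis"
  have ex: "\<exists>i\<in>I. \<exists>u. norm (F i u) > K * norm u" for K
    using that[of K] neg by (meson not_le)
  have ball: "\<exists>q s. 0 < s \<and> s \<le> e \<and> cball q s \<subseteq> cball p r \<and> (\<exists>i\<in>I. \<forall>y\<in>cball q s. norm (F i y) \<ge> real n)"
    if r: "r > 0" and e: "e > 0" for p :: 'a and r e :: real and n :: nat
  proof -
    \<comment> \<open>The constant is such that the image of the multiple \<open>h\<close> of \<open>u\<close> with norm \<open>r / 2\<close> exceeds \<open>n + 1\<close>.\<close>
    obtain i u where i: "i \<in> I" and u: "norm (F i u) > (2 * (real n + 1) / r) * norm u" using ex by blast
    interpret Fi: bounded_linear "F i" by (rule F[OF i])
    have u0: "norm u > 0" using u by (cases "u = 0") (auto simp: Fi.zero)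
    define h where "h = (r / (2 * norm u)) *\<^sub>R u"
    have nh: "norm h = r / 2" using u0 r by (simp add: h_def)
    have "norm (F i h) = r / (2 * norm u) * norm (F i u)" using r by (simp add: h_def Fi.scaleR)
    also have "\<dots> > r / (2 * norm u) * ((2 * (real n + 1) / r) * norm u)"
      by (rule mult_strict_left_mono[OF u]) (use u0 r in simp)
    also have "r / (2 * norm u) * ((2 * (real n + 1) / r) * norm u) = real n + 1" using u0 r by (simp add: field_simps)
    finally have big: "norm (F i h) > real n + 1" .
    have "2 *\<^sub>R F i h = F i (p + h) - F i (p - h)" by (simp add: Fi.add Fi.diff scaleR_2)
    then have "2 * norm (F i h) \<le> norm (F i (p + h)) + norm (F i (p - h))"
      using norm_triangle_ineq4[of "F i (p + h)" "F i (p - h)"] by (metis abs_numeral norm_scaleR)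
    then have "norm (F i (p + h)) > real n + 1 \<or> norm (F i (p - h)) > real n + 1" using big by linarith
    moreover have "dist p (p + h) \<le> r / 2" "dist p (p - h) \<le> r / 2" using nh by (simp_all add: dist_norm)
    ultimately have "\<exists>q. dist p q \<le> r / 2 \<and> norm (F i q) > real n + 1" by (elim disjE) (rule exI, rule conjI, assumption+)+
    then obtain q where q: "dist p q \<le> r / 2" "norm (F i q) > real n + 1" by (elim exE conjE)
    have "isCont (F i) q" by (rule Fi.isCont[OF continuous_ident])
    then obtain \<delta> where \<delta>: "\<delta> > 0" "\<And>y. dist y q < \<delta> \<Longrightarrow> dist (F i y) (F i q) < 1"
      unfolding continuous_at_eps_delta by (metis zero_less_one)
    define s where "s = Min {e, r / 2, \<delta> / 2}"
    have s: "0 < s" "s \<le> e" "s \<le> r / 2" "s < \<delta>" using e r \<delta>(1) by (auto simp: s_def)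
    have "cball q s \<subseteq> cball p r"
    proof
      fix y assume "y \<in> cball q s"
      then show "y \<in> cball p r" using dist_triangle[of p y q] q(1) s(3) by simp
    qed
    moreover have "norm (F i y) \<ge> real n" if "y \<in> cball q s" for y
    proof -
      have "dist (F i y) (F i q) < 1" using that s(4) by (intro \<delta>(2)) (simp add: dist_commute)
      then show ?thesis using q(2) norm_triangle_sub[of "F i q" "F i y"] by (simp add: dist_norm norm_minus_commute)
    qed
    ultimately show ?thesis using s i by blast
  qed
  let ?P = "\<lambda>n (pr :: 'a \<times> real). 0 < snd pr \<and> snd pr \<le> inverse (real (Suc n)) \<and>
      (\<exists>i\<in>I. \<forall>y\<in>cball (fst pr) (snd pr). norm (F i y) \<ge> real n)"
  have "\<exists>f. \<forall>n. ?P n (f n) \<and> cball (fst (f (Suc n))) (snd (f (Suc n))) \<subseteq> cball (fst (f n)) (snd (f n))"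
  proof (rule dependent_nat_choice)
    from ball[of 1 1 0 0] show "\<exists>x. ?P 0 x" by auto
  next
    fix pr n assume "?P n pr"
    then obtain q s where qs: "0 < s" "s \<le> inverse (real (Suc (Suc n)))" "cball q s \<subseteq> cball (fst pr) (snd pr)"
        "\<exists>i\<in>I. \<forall>y\<in>cball q s. norm (F i y) \<ge> real (Suc n)"
      using ball[of "snd pr" "inverse (real (Suc (Suc n)))" "fst pr" "Suc n"] by auto
    show "\<exists>y. ?P (Suc n) y \<and> cball (fst y) (snd y) \<subseteq> cball (fst pr) (snd pr)"
      by (intro exI[of _ "(q, s)"]) (use qs in simp)
  qed
  then obtain f where f: "\<And>n. ?P n (f n)" "\<And>n. cball (fst (f (Suc n))) (snd (f (Suc n))) \<subseteq> cball (fst (f n)) (snd (f n))" by blast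
  have "\<exists>a. \<forall>n. a \<in> cball (fst (f n)) (snd (f n))"
  proof (rule decreasing_closed_nest)
    show "cball (fst (f n)) (snd (f n)) \<noteq> {}" for n using f(1)[of n] by simp
    show "cball (fst (f n)) (snd (f n)) \<subseteq> cball (fst (f m)) (snd (f m))" if "m \<le> n" for m n
      using that by (rule lift_Suc_antimono_le[where f="\<lambda>n. cball (fst (f n)) (snd (f n))", OF f(2)])
    show "\<exists>n. \<forall>x\<in>cball (fst (f n)) (snd (f n)). \<forall>y\<in>cball (fst (f n)) (snd (f n)). dist x y < e" if e: "e > 0" for e
    proof -
      have "0 < e / 2" using e by simp
      from reals_Archimedean[OF this] obtain n where n: "inverse (real (Suc n)) < e / 2" ..
      have "dist x y < e" if "x \<in> cball (fst (f n)) (snd (f n))" "y \<in> cball (fst (f n)) (snd (f n))" for x y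
      proof -
        have "dist x y \<le> dist (fst (f n)) x + dist (fst (f n)) y" by (rule dist_triangle3)
        moreover have "dist (fst (f n)) x \<le> snd (f n)" "dist (fst (f n)) y \<le> snd (f n)" using that by (simp_all only: mem_cball)
        moreover have "snd (f n) \<le> inverse (real (Suc n))" using f(1)[of n] by blast
        ultimately show ?thesis using n by linarith
      qed
      then show ?thesis by blast
    qed
  qed auto
  then obtain a where a: "\<And>n. a \<in> cball (fst (f n)) (snd (f n))" by blast
  obtain K where K: "\<And>i. i \<in> I \<Longrightarrow> norm (F i a) \<le> K" using pw by blast
  obtain n where "real n > K" using reals_Archimedean2 by blast
  moreover obtain i where "i \<in> I" "norm (F i a) \<ge> real n" using f(1)[of n] a[of n] by blast
  ultimately show False using K[of i] by linarith
qed

section \<open>Derivatives and oriented integrals\<close>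

lemma has_vector_derivative_iff_quotient:
  "(f has_vector_derivative d) (at t) \<longleftrightarrow> ((\<lambda>h. (f (t + h) - f t) /\<^sub>R h) \<longlongrightarrow> d) (at (0::real))"
proof -
  have "(f has_vector_derivative d) (at t) \<longleftrightarrow> ((\<lambda>h. norm (f (t + h) - f t - h *\<^sub>R d) / norm h) \<longlongrightarrow> 0) (at 0)"
    by (simp add: has_vector_derivative_def has_derivative_at bounded_linear_scaleR_left)
  also have "\<dots> \<longleftrightarrow> ((\<lambda>h. norm ((f (t + h) - f t) /\<^sub>R h - d)) \<longlongrightarrow> 0) (at 0)"
  proof (rule filterlim_cong[OF refl refl], unfold eventually_at_filter, rule always_eventually, intro allI impI)
    fix h :: real assume h: "h \<noteq> 0"
    then have "(f (t + h) - f t) /\<^sub>R h - d = (f (t + h) - f t - h *\<^sub>R d) /\<^sub>R h" by (simp add: scaleR_diff_right)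
    then show "norm (f (t + h) - f t - h *\<^sub>R d) / norm h = norm ((f (t + h) - f t) /\<^sub>R h - d)"
      by (simp add: divide_inverse_commute)
  qed
  also have "\<dots> \<longleftrightarrow> ((\<lambda>h. (f (t + h) - f t) /\<^sub>R h) \<longlongrightarrow> d) (at 0)"
    by (simp add: tendsto_norm_zero_iff LIM_zero_iff)
  finally show ?thesis .
qed

lemma bilinear_has_vector_derivative:
  assumes "bounded_bilinear B" "(f has_vector_derivative f') (at t)" "(g has_vector_derivative g') (at t)"
  shows "((\<lambda>t. B (f t) (g t)) has_vector_derivative B (f t) g' + B f' (g t)) (at t)"
  using bounded_bilinear.FDERIV[OF assms(1) assms(2,3)[unfolded has_vector_derivative_def]]
  unfolding has_vector_derivative_def
  by (simp add: bounded_bilinear.scaleR_left[OF assms(1)] bounded_bilinear.scaleR_right[OF assms(1)] scaleR_add_right)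

lemma norm_increment_le:
  fixes F :: "real \<Rightarrow> 'a::real_normed_vector"
  assumes F: "\<And>s. \<bar>s\<bar> \<le> \<bar>u\<bar> \<Longrightarrow> (F has_vector_derivative f s) (at s)"
    and B: "\<And>s. \<bar>s\<bar> \<le> \<bar>u\<bar> \<Longrightarrow> norm (f s) \<le> B"
  shows "norm (F u - F 0) \<le> B * \<bar>u\<bar>"
proof -
  have "norm (F u - F 0) \<le> B * norm (u - 0)"
  proof (rule differentiable_bound[of "{-\<bar>u\<bar>..\<bar>u\<bar>}" F "\<lambda>s h. h *\<^sub>R f s"])
    show "(F has_derivative (\<lambda>h. h *\<^sub>R f s)) (at s within {- \<bar>u\<bar>..\<bar>u\<bar>})" if "s \<in> {- \<bar>u\<bar>..\<bar>u\<bar>}" for s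
    proof -
      have "\<bar>s\<bar> \<le> \<bar>u\<bar>" using that by auto
      from F[OF this] show ?thesis unfolding has_vector_derivative_def by (rule has_derivative_at_withinI)
    qed
    show "onorm (\<lambda>h. h *\<^sub>R f s) \<le> B" if "s \<in> {- \<bar>u\<bar>..\<bar>u\<bar>}" for s
    proof (rule onorm_le)
      fix h :: real
      have "\<bar>s\<bar> \<le> \<bar>u\<bar>" using that by auto
      from B[OF this] show "norm (h *\<^sub>R f s) \<le> B * norm h" by (simp add: mult.commute[of B] mult_left_mono)
    qed
  qed auto
  then show ?thesis by simp
qed

lemma oriented_integral_has_vector_derivative:
  fixes f :: "real \<Rightarrow> 'a::banach"
  assumes f: "continuous_on UNIV f"
  shows "((\<lambda>u. oriented_integral 0 u f) has_vector_derivative f u) (at u)"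
proof -
  define N where "N = \<bar>u\<bar> + 1"
  have int: "f integrable_on {a..b}" for a b
    by (rule integrable_continuous_real) (use f continuous_on_subset in blast)
  have eq: "oriented_integral 0 v f = integral {-N..v} f - integral {-N..0} f" if "v \<in> {-N..N}" for v
  proof (cases "0 \<le> v")
    case True
    then show ?thesis using Henstock_Kurzweil_Integration.integral_combine[OF _ True int, of "-N"] that
      by (simp add: oriented_integral_def N_def algebra_simps)
  next
    case False
    then show ?thesis using Henstock_Kurzweil_Integration.integral_combine[OF _ _ int, of "-N" v 0] that
      by (simp add: oriented_integral_def algebra_simps)
  qed
  have "((\<lambda>v. integral {-N..v} f) has_vector_derivative f u) (at u within {-N..N})"
    by (rule integral_has_vector_derivative) (use f continuous_on_subset in \<open>auto simp: N_def\<close>)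
  then have "((\<lambda>v. integral {-N..v} f - integral {-N..0} f) has_vector_derivative f u - 0) (at u within {-N..N})"
    by (intro has_vector_derivative_diff has_vector_derivative_const)
  then have "((\<lambda>v. oriented_integral 0 v f) has_vector_derivative f u) (at u within {-N..N})"
    unfolding diff_0_right by (rule has_vector_derivative_transform[rotated 2]) (auto simp: eq N_def)
  moreover have "at u within {-N..N} = at u" by (rule at_within_interior) (auto simp: N_def)
  ultimately show ?thesis by simp
qed

lemma has_integral_of_derivative:
  fixes F :: "real \<Rightarrow> 'a::banach"
  assumes "\<And>u. (F has_vector_derivative f u) (at u)" "a \<le> b"
  shows "(f has_integral F b - F a) {a..b}"
  by (rule fundamental_theorem_of_calculus[OF assms(2)]) (rule has_vector_derivative_at_within[OF assms(1)])

lemma oriented_integral_of_derivative: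
  fixes F :: "real \<Rightarrow> 'a::banach"
  assumes "\<And>u. (F has_vector_derivative f u) (at u)"
  shows "oriented_integral a b f = F b - F a"
proof (cases "a \<le> b")
  case True
  then show ?thesis using integral_unique[OF has_integral_of_derivative[OF assms True]] by (simp add: oriented_integral_def)
next
  case False
  then have "b \<le> a" by simp
  from integral_unique[OF has_integral_of_derivative[OF assms this]] show ?thesis
    using False by (simp add: oriented_integral_def)
qed

lemma oriented_integral_bounded_linear:
  fixes f :: "real \<Rightarrow> 'a::banach"
  assumes L: "bounded_linear L" and f: "f integrable_on {a..b}" "f integrable_on {b..a}"
  shows "oriented_integral a b (\<lambda>s. L (f s)) = L (oriented_integral a b f)"
  using integral_linear[OF f(1) L] integral_linear[OF f(2) L] linear_neg[OF bounded_linear.linear[OF L]]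
  by (simp add: oriented_integral_def comp_def)

section \<open>Strongly continuous groups on a closed subspace\<close>

text \<open>The real-linear content of \<open>generates_group\<close>. The closed subspace \<open>X\<close> allows one development to serve both
  $e^{tA}$ on the whole of $H$ and \<open>V\<close> on the dual of $H$, which for complex scalars is in general a
  proper subspace of the bounded real-linear maps.\<close>

locale strongly_continuous_real_group =
  fixes X :: "'a::banach set" and S :: "real \<Rightarrow> 'a \<Rightarrow> 'a" and D :: "'a set" and G :: "'a \<Rightarrow> 'a"
  assumes X: "subspace X" "closed X"
    and S_in: "\<And>t x. x \<in> X \<Longrightarrow> S t x \<in> X"
    and S_add: "\<And>t x y. x \<in> X \<Longrightarrow> y \<in> X \<Longrightarrow> S t (x + y) = S t x + S t y"
    and S_scaleR: "\<And>t r x. x \<in> X \<Longrightarrow> S t (r *\<^sub>R x) = r *\<^sub>R S t x"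
    and S_bounded: "\<And>t. \<exists>K. \<forall>x\<in>X. norm (S t x) \<le> K * norm x"
    and S_0: "\<And>x. x \<in> X \<Longrightarrow> S 0 x = x"
    and S_plus: "\<And>s t x. x \<in> X \<Longrightarrow> S (s + t) x = S s (S t x)"
    and S_cont: "\<And>x. x \<in> X \<Longrightarrow> continuous_on UNIV (\<lambda>t. S t x)"
    and D: "D = {x\<in>X. \<exists>y. ((\<lambda>t. (S t x - x) /\<^sub>R t) \<longlongrightarrow> y) (at 0)}"
    and G: "\<And>x. x \<in> D \<Longrightarrow> ((\<lambda>t. (S t x - x) /\<^sub>R t) \<longlongrightarrow> G x) (at 0)"
begin

lemma S_diff: "x \<in> X \<Longrightarrow> y \<in> X \<Longrightarrow> S t (x - y) = S t x - S t y"
  using S_add[of x "(-1) *\<^sub>R y" t] S_scaleR[of y t "-1"] subspace_scale[OF X(1), of y "-1"] by simp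

lemma D_X: "x \<in> D \<Longrightarrow> x \<in> X" using D by auto

lemma S_tendsto:
  assumes x: "x \<in> X" and f: "\<And>h. f h \<in> X" and lim: "(f \<longlongrightarrow> x) F"
  shows "((\<lambda>h. S t (f h)) \<longlongrightarrow> S t x) F"
proof -
  obtain K where K: "\<And>x. x \<in> X \<Longrightarrow> norm (S t x) \<le> K * norm x" using S_bounded by metis
  show ?thesis
  proof (rule LIM_zero_cancel, rule Lim_null_comparison)
  have "norm (S t (f h) - S t x) \<le> K * norm (f h - x)" for h
    using K[of "f h - x"] S_diff[OF f x] subspace_diff[OF X(1) f x] by simp
  then show "\<forall>\<^sub>F h in F. norm (S t (f h) - S t x) \<le> K * norm (f h - x)" by simp
  have "((\<lambda>h. norm (f h - x)) \<longlongrightarrow> 0) F" using lim by (simp add: LIM_zero tendsto_norm_zero)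
  then show "((\<lambda>h. K * norm (f h - x)) \<longlongrightarrow> 0) F" using tendsto_mult_right_zero by blast
  qed
qed

lemma quotient_in_X: "x \<in> X \<Longrightarrow> (S h x - x) /\<^sub>R h \<in> X"
  by (intro subspace_scale subspace_diff X S_in)

lemma G_in_X: "x \<in> D \<Longrightarrow> G x \<in> X"
  by (rule Lim_in_closed_set[OF X(2) _ _ G])
    (rule always_eventually, rule allI, rule quotient_in_X, erule D_X, simp, assumption)

lemma S_quotient: "x \<in> X \<Longrightarrow> S t ((S h x - x) /\<^sub>R h) = (S (t + h) x - S t x) /\<^sub>R h"
  by (simp add: S_scaleR S_diff S_in S_plus subspace_diff[OF X(1)])

lemma quotient_tendsto:
  assumes x: "x \<in> D" shows "((\<lambda>h. (S (t + h) x - S t x) /\<^sub>R h) \<longlongrightarrow> S t (G x)) (at 0)"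
  using S_tendsto[OF G_in_X[OF x] quotient_in_X[OF D_X[OF x]] G[OF x], of t]
  by (simp add: S_quotient D_X[OF x])

lemma S_has_vector_derivative:
  "x \<in> D \<Longrightarrow> ((\<lambda>t. S t x) has_vector_derivative S t (G x)) (at t)"
  unfolding has_vector_derivative_iff_quotient by (rule quotient_tendsto)

lemma D_I: "x \<in> X \<Longrightarrow> ((\<lambda>t. (S t x - x) /\<^sub>R t) \<longlongrightarrow> y) (at 0) \<Longrightarrow> x \<in> D \<and> G x = y"
  using D G[of x] tendsto_unique[of "at (0::real)"] by auto

lemma S_in_D: assumes x: "x \<in> D" shows "S t x \<in> D" "G (S t x) = S t (G x)"
proof -
  have "((\<lambda>h. (S h (S t x) - S t x) /\<^sub>R h) \<longlongrightarrow> S t (G x)) (at 0)"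
    using quotient_tendsto[OF x, of t] by (simp add: add.commute flip: S_plus[OF D_X[OF x]])
  from D_I[OF S_in[OF D_X[OF x]] this] show "S t x \<in> D" "G (S t x) = S t (G x)" by auto
qed

definition primitive :: "'a \<Rightarrow> real \<Rightarrow> 'a" where
  "primitive x u = oriented_integral 0 u (\<lambda>s. S s x)"

lemma integrable_orbit: "x \<in> X \<Longrightarrow> (\<lambda>s. S s x) integrable_on {a..b}"
  by (rule integrable_continuous_real) (use S_cont continuous_on_subset in blast)

lemma primitive_derivative: "x \<in> X \<Longrightarrow> (primitive x has_vector_derivative S u x) (at u)"
  unfolding primitive_def[abs_def] by (rule oriented_integral_has_vector_derivative[OF S_cont])

lemma primitive_0 [simp]: "primitive x 0 = 0" by (simp add: primitive_def oriented_integral_def)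

text \<open>Both sides are integrals of the orbit, over \<open>[a, b]\<close> shifted by \<open>r\<close>.\<close>

lemma S_increment:
  assumes x: "x \<in> X" and ab: "a \<le> b"
  shows "primitive x b - primitive x a \<in> X"
    "S r (primitive x b - primitive x a) = primitive x (b + r) - primitive x (a + r)"
proof -
  obtain K where K: "\<And>x. x \<in> X \<Longrightarrow> norm (S r x) \<le> K * norm x" using S_bounded by metis
  have 1: "((\<lambda>s. S s x) has_integral primitive x b - primitive x a) {a..b}"
    by (rule has_integral_of_derivative[OF primitive_derivative[OF x] ab])
  note sub = has_integral_on_subspace[OF 1 X S_in[OF x] S_add S_scaleR K]
  show "primitive x b - primitive x a \<in> X" by (rule sub(1))
  have "((\<lambda>u. primitive x (u + r)) has_vector_derivative S (u + r) x) (at u)" for u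
    using primitive_derivative[OF x, of "u + r"] by (simp add: has_vector_derivative_iff_quotient add_ac)
  from has_integral_of_derivative[OF this ab]
  have "((\<lambda>s. S (s + r) x) has_integral primitive x (b + r) - primitive x (a + r)) {a..b}" .
  moreover have "((\<lambda>s. S (s + r) x) has_integral S r (primitive x b - primitive x a)) {a..b}"
    using sub(2) by (simp only: add.commute[of _ r] S_plus[OF x])
  ultimately show "S r (primitive x b - primitive x a) = primitive x (b + r) - primitive x (a + r)"
    using has_integral_unique by blast
qed

lemma primitive_in_X: assumes x: "x \<in> X" shows "primitive x u \<in> X"
proof (cases "0 \<le> u")
  case True then show ?thesis using S_increment(1)[OF x True] by simp
next
  case False
  then have "- primitive x u \<in> X" using S_increment(1)[OF x, of u 0] by simp
  from subspace_neg[OF X(1) this] show ?thesis by simp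
qed

lemma S_primitive: assumes x: "x \<in> X" shows "S r (primitive x u) = primitive x (u + r) - primitive x r"
proof (cases "0 \<le> u")
  case True then show ?thesis using S_increment(2)[OF x True, of r] by simp
next
  case False
  then have "S r (0 - primitive x u) = primitive x r - primitive x (u + r)" using S_increment(2)[OF x, of u 0 r] by simp
  moreover have "S r (0 - primitive x u) = S r 0 - S r (primitive x u)"
    by (rule S_diff[OF subspace_0[OF X(1)] primitive_in_X[OF x]])
  moreover have "S r 0 = 0" using S_scaleR[OF subspace_0[OF X(1)], of r 0] by simp
  ultimately show ?thesis by (simp add: algebra_simps)
qed

text \<open>Integrated orbits lie in the domain of the generator for every initial value; later this replaces density
  arguments for \<open>V\<close>.\<close>

lemma primitive_in_D: assumes x: "x \<in> X" shows "primitive x u \<in> D" "G (primitive x u) = S u x - x"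
proof -
  have "((\<lambda>h. (primitive x (u + h) - primitive x u) /\<^sub>R h - (primitive x (0 + h) - primitive x 0) /\<^sub>R h) \<longlongrightarrow> S u x - S 0 x) (at 0)"
    using primitive_derivative[OF x] unfolding has_vector_derivative_iff_quotient by (intro tendsto_diff)
  also have "(\<lambda>h. (primitive x (u + h) - primitive x u) /\<^sub>R h - (primitive x (0 + h) - primitive x 0) /\<^sub>R h) =
     (\<lambda>h. (S h (primitive x u) - primitive x u) /\<^sub>R h)"
    by (rule ext) (simp add: S_primitive[OF x] scaleR_diff_right)
  finally have "((\<lambda>h. (S h (primitive x u) - primitive x u) /\<^sub>R h) \<longlongrightarrow> S u x - x) (at 0)" by (simp add: S_0[OF x])
  from D_I[OF primitive_in_X[OF x] this] show "primitive x u \<in> D" "G (primitive x u) = S u x - x" by auto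
qed

lemma D_scaleR: assumes x: "x \<in> D" shows "r *\<^sub>R x \<in> D" "G (r *\<^sub>R x) = r *\<^sub>R G x"
proof -
  have "((\<lambda>h. r *\<^sub>R ((S h x - x) /\<^sub>R h)) \<longlongrightarrow> r *\<^sub>R G x) (at 0)" by (intro tendsto_intros G x)
  also have "(\<lambda>h. r *\<^sub>R ((S h x - x) /\<^sub>R h)) = (\<lambda>h. (S h (r *\<^sub>R x) - r *\<^sub>R x) /\<^sub>R h)"
    by (rule ext) (simp add: S_scaleR[OF D_X[OF x]] scaleR_diff_right mult.commute)
  finally have "((\<lambda>h. (S h (r *\<^sub>R x) - r *\<^sub>R x) /\<^sub>R h) \<longlongrightarrow> r *\<^sub>R G x) (at 0)" .
  from D_I[OF subspace_scale[OF X(1) D_X[OF x]] this] show "r *\<^sub>R x \<in> D" "G (r *\<^sub>R x) = r *\<^sub>R G x" by auto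
qed

lemma G_primitive_commute: assumes x: "x \<in> D" shows "primitive (G x) u = S u x - x"
  unfolding primitive_def using oriented_integral_of_derivative[OF S_has_vector_derivative[OF x], of 0 u] S_0[OF D_X[OF x]] by simp

lemma primitive_add: "x \<in> X \<Longrightarrow> y \<in> X \<Longrightarrow> primitive (x + y) u = primitive x u + primitive y u"
  unfolding primitive_def oriented_integral_def
  by (simp add: S_add integral_add integrable_orbit)

lemma primitive_scaleR: "x \<in> X \<Longrightarrow> primitive (r *\<^sub>R x) u = r *\<^sub>R primitive x u"
  unfolding primitive_def oriented_integral_def
  by (simp add: S_scaleR)

definition mean :: "real \<Rightarrow> 'a \<Rightarrow> 'a" where
  "mean h x = primitive x h /\<^sub>R h"

lemma mean_tendsto: assumes x: "x \<in> X" shows "((\<lambda>h. mean h x) \<longlongrightarrow> x) (at 0)"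
  using primitive_derivative[OF x, of 0] unfolding has_vector_derivative_iff_quotient mean_def by (simp add: S_0[OF x])

lemma mean_LIMSEQ: "x \<in> X \<Longrightarrow> (\<lambda>n. mean (inverse (real (Suc n))) x) \<longlonglongrightarrow> x"
  by (rule filterlim_compose[OF mean_tendsto filterlim_atI]) (assumption, rule LIMSEQ_inverse_real_of_nat, simp)

end

lemma generates_group_real:
  fixes scl :: "'k::real_or_complex \<Rightarrow> 'a::banach \<Rightarrow> 'a"
  assumes "generates_group scl X D G S" "subspace X" "closed X"
    and scl: "\<And>r x. scl (of_real r) x = r *\<^sub>R x"
  shows "strongly_continuous_real_group X S D G"
proof -
  note g = assms(1)[unfolded generates_group_def strongly_continuous_group_def bounded_operator_def]
  have "S t (r *\<^sub>R x) = r *\<^sub>R S t x" if "x \<in> X" for t r x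
    using g that by (metis scl)
  then show ?thesis using g assms(2,3) by unfold_locales (auto; fail | metis)+
qed

section \<open>The adjoint group and its smoothing operators\<close>

lemma eq_on_dense:
  fixes f g :: "'a::real_normed_vector \<Rightarrow>\<^sub>L 'b::real_normed_vector"
  assumes "\<And>x. x \<in> D \<Longrightarrow> blinfun_apply f x = blinfun_apply g x" "\<And>x. x \<in> closure D"
  shows "f = g"
proof (rule blinfun_eqI)
  fix x
  have "closed {x. blinfun_apply f x = blinfun_apply g x}" by (intro closed_Collect_eq continuous_intros)
  then have "closure D \<subseteq> {x. blinfun_apply f x = blinfun_apply g x}" by (rule closure_minimal[rotated]) (use assms in auto)
  then show "blinfun_apply f x = blinfun_apply g x" using assms(2) by auto
qed

lemma subspace_closure:
  fixes M :: "'a::real_normed_vector set"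
  assumes M: "subspace M" shows "subspace (closure M)"
  unfolding subspace_def
proof (intro conjI ballI allI)
  show "0 \<in> closure M" using subspace_0[OF M] closure_subset by blast
  fix x assume x: "x \<in> closure M"
  then obtain xs where xs: "\<forall>n. xs n \<in> M" "xs \<longlonglongrightarrow> x" unfolding closure_sequential by (elim exE conjE)
  show "c *\<^sub>R x \<in> closure M" for c
    unfolding closure_sequential
    by (rule exI[of _ "\<lambda>n. c *\<^sub>R xs n"]) (use xs subspace_scale[OF M] in \<open>auto intro: tendsto_intros\<close>)
  fix y assume "y \<in> closure M"
  then obtain ys where ys: "\<forall>n. ys n \<in> M" "ys \<longlonglongrightarrow> y" unfolding closure_sequential by (elim exE conjE)
  show "x + y \<in> closure M"
    unfolding closure_sequential
    by (rule exI[of _ "\<lambda>n. xs n + ys n"]) (use xs ys subspace_add[OF M] in \<open>auto intro: tendsto_intros\<close>)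
qed

lemma adj_apply [simp]:
  assumes "bounded_linear F" shows "blinfun_apply (adj F f) x = blinfun_apply f (F x)"
  unfolding adj_def
  by (rule bounded_linear_Blinfun_apply[THEN fun_cong])
    (rule bounded_linear_compose[OF blinfun.bounded_linear_right assms])

lemma norm_adj_le:
  assumes "bounded_linear F" "\<And>x. norm (F x) \<le> K * norm x" "0 \<le> K"
  shows "norm (adj F f) \<le> K * norm f"
proof (rule norm_blinfun_bound)
  fix x
  have "norm (blinfun_apply f (F x)) \<le> norm f * norm (F x)" by (rule norm_blinfun)
  also have "\<dots> \<le> norm f * (K * norm x)" by (intro mult_left_mono assms) auto
  finally show "norm (blinfun_apply (adj F f) x) \<le> K * norm f * norm x" using assms(1) by (simp add: mult_ac)
qed (use assms in simp)

lemma bounded_linear_adj: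
  assumes F: "bounded_linear F" shows "bounded_linear (adj F :: ('b::banach \<Rightarrow>\<^sub>L 'k::real_or_complex) \<Rightarrow> ('a::banach \<Rightarrow>\<^sub>L 'k))"
proof -
  obtain K where K: "0 \<le> K" "\<And>x. norm (F x) \<le> K * norm x"
    using bounded_linear.nonneg_bounded[OF F] by (metis mult.commute)
  show ?thesis
  proof (rule bounded_linear_intro[where K=K])
    show "adj F (x + y) = adj F x + adj F y" for x y :: "'b \<Rightarrow>\<^sub>L 'k"
      by (rule blinfun_eqI) (simp add: F plus_blinfun.rep_eq)
    show "adj F (r *\<^sub>R x) = r *\<^sub>R adj F x" for r and x :: "'b \<Rightarrow>\<^sub>L 'k"
      by (rule blinfun_eqI) (simp add: F scaleR_blinfun.rep_eq)
    show "norm (adj F x) \<le> norm x * K" for x :: "'b \<Rightarrow>\<^sub>L 'k"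
      using norm_adj_le[OF F K(2,1), of x] by (simp add: mult.commute)
  qed
qed

locale group_system =
  fixes \<Sigma> :: "('k::real_or_complex, 'h::banach, 'u::banach) csys"
  assumes hilbert_H: "hilbert_space (scaleH \<Sigma>) (ipH \<Sigma>)" and hilbert_U: "hilbert_space (scaleU \<Sigma>) (ipU \<Sigma>)"
    and H1: "H1 \<Sigma>"
begin

sublocale H: hilbert_space "scaleH \<Sigma>" "ipH \<Sigma>" by (rule hilbert_H)
sublocale U: hilbert_space "scaleU \<Sigma>" "ipU \<Sigma>" by (rule hilbert_U)

lemma expA_generates: "generates_group (scaleH \<Sigma>) UNIV (domA \<Sigma>) (opA \<Sigma>) (expA \<Sigma>)"
  using H1 unfolding H1_def expA_def by (rule someI_ex)

sublocale E: strongly_continuous_real_group UNIV "expA \<Sigma>" "domA \<Sigma>" "opA \<Sigma>"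
  by (rule generates_group_real[OF expA_generates]) (auto simp: H.scale_of_real)

abbreviation "E \<equiv> expA \<Sigma>"
abbreviation "X \<equiv> dualH \<Sigma>"
abbreviation "D \<equiv> domAstar \<Sigma>"
abbreviation "As \<equiv> opAstar \<Sigma>"

lemma E_scale: "E t (scaleH \<Sigma> c x) = scaleH \<Sigma> c (E t x)"
proof -
  have "\<forall>t. bounded_operator (scaleH \<Sigma>) UNIV (E t)"
    using expA_generates unfolding generates_group_def strongly_continuous_group_def by (elim conjE)
  then show ?thesis by (simp add: bounded_operator_def)
qed

lemma E_bounded_linear: "bounded_linear (E t)"
proof -
  obtain K where K: "\<forall>x\<in>UNIV. norm (E t x) \<le> K * norm x" using E.S_bounded[of t] ..
  show ?thesis
  proof (rule bounded_linear_intro[where K=K])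
    show "norm (E t x) \<le> norm x * K" for x using K by (simp add: mult.commute)
  qed (simp_all add: E.S_add E.S_scaleR)
qed

lemma E_locally_bounded: obtains K where "0 \<le> K" "\<And>t x. \<bar>t\<bar> \<le> \<tau> \<Longrightarrow> norm (E t x) \<le> K * norm x"
proof -
  obtain K where K: "\<And>t x. t \<in> {-\<tau>..\<tau>} \<Longrightarrow> norm (E t x) \<le> K * norm x"
  proof (rule uniform_boundedness[of "{-\<tau>..\<tau>}" E])
    show "bounded_linear (E t)" for t by (rule E_bounded_linear)
    show "\<exists>K. \<forall>i\<in>{-\<tau>..\<tau>}. norm (E i x) \<le> K" for x
    proof -
      have "compact ((\<lambda>t. E t x) ` {-\<tau>..\<tau>})"
        by (rule compact_continuous_image[OF continuous_on_subset[OF E.S_cont]]) auto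
      from compact_imp_bounded[OF this] show ?thesis unfolding bounded_iff by auto
    qed
  qed (rule that)
  show thesis
  proof (rule that[of "max K 0"])
    fix t x assume "\<bar>t\<bar> \<le> \<tau>"
    then have "norm (E t x) \<le> K * norm x" by (intro K) auto
    also have "\<dots> \<le> max K 0 * norm x" by (intro mult_right_mono) auto
    finally show "norm (E t x) \<le> max K 0 * norm x" .
  qed simp
qed

text \<open>The group $e^{-tA^*}$. As \<open>expA\<close> consists of bounded operators on $H$, it acts by composition on all bounded
  real-linear maps, not merely on the dual.\<close>

definition S :: "real \<Rightarrow> ('h \<Rightarrow>\<^sub>L 'k) \<Rightarrow> ('h \<Rightarrow>\<^sub>L 'k)" where "S t f = expAstar \<Sigma> (- t) f"

lemma S_apply [simp]: "blinfun_apply (S t f) x = blinfun_apply f (E (- t) x)"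
  by (simp add: S_def expAstar_def E_bounded_linear)

lemma S_bounded_linear: "bounded_linear (S t)"
  unfolding S_def[abs_def] expAstar_def by (rule bounded_linear_adj[OF E_bounded_linear])

lemmas S_linear = linear_add[OF bounded_linear.linear[OF S_bounded_linear]]
  linear_diff[OF bounded_linear.linear[OF S_bounded_linear]]
  linear_scale[OF bounded_linear.linear[OF S_bounded_linear]]
  linear_0[OF bounded_linear.linear[OF S_bounded_linear]]

lemma S_plus: "S (s + t) f = S s (S t f)"
  by (rule blinfun_eqI) (simp add: E.S_plus[of _ "- t" "- s", symmetric] algebra_simps)

lemma S_0 [simp]: "S 0 f = f"
  by (rule blinfun_eqI) (simp add: E.S_0)

lemma S_X: "f \<in> X \<Longrightarrow> S t f \<in> X"
  by (simp add: antidual_def E_scale)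

lemma S_scale: "S t (scale_dual c f) = scale_dual c (S t f)"
  by (rule blinfun_eqI) simp

lemma S_locally_bounded: obtains K where "0 \<le> K" "\<And>t f. \<bar>t\<bar> \<le> \<tau> \<Longrightarrow> norm (S t f) \<le> K * norm f"
proof -
  obtain K where K: "0 \<le> K" "\<And>t x. \<bar>t\<bar> \<le> \<tau> \<Longrightarrow> norm (E t x) \<le> K * norm x"
    by (rule E_locally_bounded[of "\<tau>"]) (rule that)
  show thesis
  proof (rule that[OF K(1)])
    fix t f assume "\<bar>t\<bar> \<le> \<tau>"
    then have "\<And>x. norm (E (- t) x) \<le> K * norm x" by (intro K) auto
    then show "norm (S t f) \<le> K * norm f" unfolding S_def expAstar_def by (intro norm_adj_le E_bounded_linear K(1))
  qed
qed

lemma domA_dense: "x \<in> closure (domA \<Sigma>)"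
proof (rule closed_sequentially[OF closed_closure _ E.mean_LIMSEQ[OF UNIV_I]])
  fix n
  have "E.mean (inverse (real (Suc n))) x \<in> domA \<Sigma>"
    unfolding E.mean_def
    using E.primitive_in_D(1)[of x] E.D_scaleR by simp
  then show "E.mean (inverse (real (Suc n))) x \<in> closure (domA \<Sigma>)" using closure_subset by blast
qed

lemma domAstar_iff: "f \<in> D \<longleftrightarrow> f \<in> X \<and> (\<exists>g\<in>X. \<forall>h\<in>domA \<Sigma>. blinfun_apply f (opA \<Sigma> h) = blinfun_apply g h)"
  unfolding domAstar_def pair_def pair'_def by (auto, (metis sconj_sconj)+)

lemma domAstar_I:
  assumes "f \<in> X" "g \<in> X" "\<And>h. h \<in> domA \<Sigma> \<Longrightarrow> blinfun_apply f (opA \<Sigma> h) = blinfun_apply g h"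
  shows "f \<in> D" "As f = g"
proof -
  show "f \<in> D" unfolding domAstar_iff by (intro conjI assms(1) bexI[OF _ assms(2)] ballI assms(3))
  show "As f = g"
    unfolding opAstar_def
  proof (rule the_equality)
    show "g \<in> X \<and> (\<forall>x\<in>domA \<Sigma>. pair (opA \<Sigma> x) f = pair x g)"
      using assms by (simp add: pair_def pair'_def)
    fix z assume z: "z \<in> X \<and> (\<forall>x\<in>domA \<Sigma>. pair (opA \<Sigma> x) f = pair x z)"
    show "z = g"
    proof (rule eq_on_dense[OF _ domA_dense])
      fix h assume "h \<in> domA \<Sigma>"
      then show "blinfun_apply z h = blinfun_apply g h"
        using z assms(3) unfolding pair_def pair'_def by (metis sconj_sconj)
    qed
  qed
qed

lemma As: assumes "f \<in> D"
  shows "f \<in> X" "As f \<in> X" "\<And>h. h \<in> domA \<Sigma> \<Longrightarrow> blinfun_apply f (opA \<Sigma> h) = blinfun_apply (As f) h"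
proof -
  from assms obtain g where g: "f \<in> X" "g \<in> X" "\<And>h. h \<in> domA \<Sigma> \<Longrightarrow> blinfun_apply f (opA \<Sigma> h) = blinfun_apply g h"
    unfolding domAstar_iff by blast
  from domAstar_I(2)[OF g] g show "f \<in> X" "As f \<in> X" "\<And>h. h \<in> domA \<Sigma> \<Longrightarrow> blinfun_apply f (opA \<Sigma> h) = blinfun_apply (As f) h"
    by auto
qed

lemma As_add: assumes "f \<in> D" "g \<in> D" shows "f + g \<in> D" "As (f + g) = As f + As g"
  using domAstar_I[of "f + g" "As f + As g"] As[OF assms(1)] As[OF assms(2)] H.antidual_add
  by (auto simp: plus_blinfun.rep_eq)

lemma As_scaleR: assumes "f \<in> D" shows "r *\<^sub>R f \<in> D" "As (r *\<^sub>R f) = r *\<^sub>R As f"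
  using domAstar_I[of "r *\<^sub>R f" "r *\<^sub>R As f"] As[OF assms(1)] H.antidual_scaleR
  by (auto simp: scaleR_blinfun.rep_eq)

lemma As_scale: assumes "f \<in> D" shows "scale_dual c f \<in> D" "As (scale_dual c f) = scale_dual c (As f)"
  using domAstar_I[of "scale_dual c f" "scale_dual c (As f)"] As[OF assms(1)] H.scale_dual_in_antidual
  by auto

lemma D_0: "0 \<in> D" "As 0 = 0"
  using domAstar_I[of 0 0] H.antidual_zero by auto

lemma As_diff: assumes "f \<in> D" "g \<in> D" shows "f - g \<in> D" "As (f - g) = As f - As g"
  using As_add[OF assms(1) As_scaleR(1)[OF assms(2)], of "-1"] As_scaleR[OF assms(2), of "-1"] by auto

lemma subspace_D: "Real_Vector_Spaces.subspace D"
  unfolding Real_Vector_Spaces.subspace_def using D_0 As_add As_scaleR by auto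

lemma S_D: assumes "f \<in> D" shows "S t f \<in> D" "As (S t f) = S t (As f)"
proof -
  have "blinfun_apply (S t f) (opA \<Sigma> h) = blinfun_apply (S t (As f)) h" if "h \<in> domA \<Sigma>" for h
    using As(3)[OF assms E.S_in_D(1)[OF that, of "- t"]] E.S_in_D(2)[OF that, of "- t"] by simp
  from domAstar_I[OF S_X[OF As(1)[OF assms]] S_X[OF As(2)[OF assms]] this]
  show "S t f \<in> D" "As (S t f) = S t (As f)" by auto
qed

text \<open>Smoothing is defined by duality, \<open>R m f = f \<circ> P m\<close> with averages \<open>P m\<close> of $e^{-sA}$ over \<open>[0, step m]\<close>.
  Strong integrals are then needed in $H$ only, so that \<open>R m\<close> is available before the strong continuity of
  the adjoint group is known. The negative argument of \<open>E.mean\<close> accounts for the sign in $e^{-sA}$.\<close>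

definition step :: "nat \<Rightarrow> real" where "step m = inverse (real (Suc m))"

lemma step: "0 < step m" "step m \<le> 1" "step \<longlonglongrightarrow> 0"
  using LIMSEQ_inverse_real_of_nat by (auto simp: step_def[abs_def] field_simps)

lemma step_nonzero: "step m \<noteq> 0" using step(1)[of m] by simp

definition P :: "nat \<Rightarrow> 'h \<Rightarrow> 'h" where "P m = E.mean (- step m)"

definition R :: "nat \<Rightarrow> ('h \<Rightarrow>\<^sub>L 'k) \<Rightarrow> ('h \<Rightarrow>\<^sub>L 'k)" where "R m = adj (P m)"

lemma primitive_bound:
  assumes K: "\<And>t x. \<bar>t\<bar> \<le> \<tau> \<Longrightarrow> norm (E t x) \<le> K * norm x" and u: "\<bar>u\<bar> \<le> \<tau>"
  shows "norm (E.primitive x u) \<le> K * norm x * \<bar>u\<bar>"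
  using norm_increment_le[of u "E.primitive x" "\<lambda>s. E s x" "K * norm x"] E.primitive_derivative[of x] K u by auto

lemma P_bound: obtains K where "0 \<le> K" "\<And>m x. norm (P m x) \<le> K * norm x"
proof -
  obtain K where K: "0 \<le> K" "\<And>t x. \<bar>t\<bar> \<le> 1 \<Longrightarrow> norm (E t x) \<le> K * norm x"
    by (rule E_locally_bounded[of "1"]) (rule that)
  have "norm (P m x) \<le> K * norm x" for m x
  proof -
    have "norm (E.primitive x (- step m)) \<le> K * norm x * step m"
      using primitive_bound[OF K(2), where u="- step m" and x=x] step(1,2)[of m] by simp
    then show ?thesis using step(1)[of m] by (simp add: P_def E.mean_def field_simps)
  qed
  then show thesis using that K(1) by blast
qed

lemma P_bounded_linear: "bounded_linear (P m)"
proof -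
  obtain K where K: "0 \<le> K" "\<And>m x. norm (P m x) \<le> K * norm x" by (rule P_bound) (rule that)
  show ?thesis
    by (rule bounded_linear_intro[where K=K])
      (use K in \<open>auto simp: P_def E.mean_def E.primitive_add E.primitive_scaleR scaleR_add_right mult.commute\<close>)
qed

lemma R_apply [simp]: "blinfun_apply (R m f) x = blinfun_apply f (P m x)"
  by (simp add: R_def P_bounded_linear)

lemma R_bounded_linear: "bounded_linear (R m)"
  unfolding R_def by (rule bounded_linear_adj[OF P_bounded_linear])

lemmas R_linear = linear_add[OF bounded_linear.linear[OF R_bounded_linear]]
  linear_diff[OF bounded_linear.linear[OF R_bounded_linear]]
  linear_scale[OF bounded_linear.linear[OF R_bounded_linear]]
  linear_0[OF bounded_linear.linear[OF R_bounded_linear]]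
  linear_neg[OF bounded_linear.linear[OF R_bounded_linear]]

lemma R_bound: obtains K where "0 \<le> K" "\<And>m f. norm (R m f) \<le> K * norm f"
proof -
  obtain K where K: "0 \<le> K" "\<And>m x. norm (P m x) \<le> K * norm x" by (rule P_bound) (rule that)
  show thesis by (rule that[OF K(1)]) (unfold R_def, rule norm_adj_le[OF P_bounded_linear K(2,1)])
qed

lemma P_scale: "P m (scaleH \<Sigma> c x) = scaleH \<Sigma> c (P m x)"
proof -
  have bl: "bounded_linear (scaleH \<Sigma> c)"
    by (rule bounded_linear_intro[where K="norm c"])
      (auto simp: H.norm_scl mult.commute H.scale_right_distrib simp flip: H.scale_of_real)
  have "E.primitive (scaleH \<Sigma> c x) u = scaleH \<Sigma> c (E.primitive x u)" for u
    unfolding E.primitive_def E_scale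
    by (rule oriented_integral_bounded_linear[OF bl]) (auto intro: E.integrable_orbit)
  then show ?thesis unfolding P_def E.mean_def by (simp only: linear_scale[OF bounded_linear.linear[OF bl]])
qed

lemma R_X: "f \<in> X \<Longrightarrow> R m f \<in> X"
  by (simp add: antidual_def P_scale)

lemma R_scale: "R m (scale_dual c f) = scale_dual c (R m f)"
  by (rule blinfun_eqI) simp

lemma P_E: "P m (E t x) = E t (P m x)"
proof -
  have "E.primitive (E t x) u = E t (E.primitive x u)" for u
  proof -
    have "((\<lambda>s. E.primitive x (s + t)) has_vector_derivative E s (E t x)) (at s)" for s
      using E.primitive_derivative[of x "s + t"] by (simp add: has_vector_derivative_iff_quotient add_ac E.S_plus)
    from oriented_integral_of_derivative[OF this, of 0 u] show ?thesis
      by (simp add: E.primitive_def[of "E t x"] E.S_primitive)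
  qed
  then show ?thesis unfolding P_def E.mean_def by (simp only: E.S_scaleR[OF UNIV_I])
qed

lemma R_S: "R m (S t f) = S t (R m f)"
  by (rule blinfun_eqI) (simp add: P_E)

text \<open>The bounded operator \<open>- A\<^sup>* R m\<close> (lemma \<open>R_D\<close>).\<close>

definition Q :: "nat \<Rightarrow> ('h \<Rightarrow>\<^sub>L 'k) \<Rightarrow> ('h \<Rightarrow>\<^sub>L 'k)" where "Q m f = (S (step m) f - f) /\<^sub>R step m"

lemma opA_P: "P m h \<in> domA \<Sigma>" "opA \<Sigma> (P m h) = (E (- step m) h - h) /\<^sub>R (- step m)"
  using E.primitive_in_D[OF UNIV_I, of h "- step m"] E.D_scaleR[of "E.primitive h (- step m)" "inverse (- step m)"]
  unfolding P_def E.mean_def by simp_all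

lemma P_opA: "h \<in> domA \<Sigma> \<Longrightarrow> P m (opA \<Sigma> h) = opA \<Sigma> (P m h)"
  unfolding opA_P by (simp add: P_def E.mean_def E.G_primitive_commute)

lemma R_D: assumes "f \<in> X" shows "R m f \<in> D" "As (R m f) = - Q m f"
proof -
  have "- Q m f \<in> X" unfolding Q_def
    by (intro H.antidual_neg H.antidual_scaleR
      H.antidual_diff S_X assms)
  moreover have "blinfun_apply (R m f) (opA \<Sigma> h) = blinfun_apply (- Q m f) h" if "h \<in> domA \<Sigma>" for h
    by (simp add: P_opA[OF that] opA_P Q_def minus_blinfun.rep_eq uminus_blinfun.rep_eq scaleR_blinfun.rep_eq blinfun.scaleR_right
        blinfun.diff_right blinfun.minus_right)
  ultimately show "R m f \<in> D" "As (R m f) = - Q m f" using domAstar_I[OF R_X[OF assms]] by auto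
qed

lemma R_As: assumes "f \<in> D" shows "R m (As f) = - Q m f"
proof -
  have "As (R m f) = R m (As f)"
    by (rule domAstar_I(2)[OF R_X R_X]) (use As[OF assms] in \<open>auto simp: P_opA opA_P(1)\<close>)
  then show ?thesis using R_D(2)[OF As(1)[OF assms]] by simp
qed

lemma Q_bounded_linear: "bounded_linear (Q m)"
  unfolding Q_def[abs_def]
  by (intro bounded_linear_compose[OF bounded_linear_scaleR_right] bounded_linear_sub S_bounded_linear bounded_linear_ident)

lemma S_minus_id_on_D:
  assumes K: "\<And>t x. \<bar>t\<bar> \<le> 1 \<Longrightarrow> norm (E t x) \<le> K * norm x" "0 \<le> K" and f: "f \<in> D" and t: "\<bar>t\<bar> \<le> 1"
  shows "norm (S t f - f) \<le> norm (As f) * K * \<bar>t\<bar>"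
proof (rule norm_blinfun_bound)
  fix h
  have "blinfun_apply (S t f - f) h = blinfun_apply f (opA \<Sigma> (E.primitive h (- t)))"
    by (simp add: E.primitive_in_D minus_blinfun.rep_eq blinfun.diff_right)
  also have "\<dots> = blinfun_apply (As f) (E.primitive h (- t))" by (rule As(3)[OF f E.primitive_in_D(1)]) simp
  also have "norm \<dots> \<le> norm (As f) * norm (E.primitive h (- t))" by (rule norm_blinfun)
  also have "\<dots> \<le> norm (As f) * (K * norm h * \<bar>t\<bar>)"
    using primitive_bound[OF K(1), where u="- t" and x=h] t by (intro mult_left_mono) auto
  finally show "norm (blinfun_apply (S t f - f) h) \<le> norm (As f) * K * \<bar>t\<bar> * norm h" by (simp add: mult_ac)
qed (use K in simp)

text \<open>The orthogonal complement of the closure of $D(A^*)$ is trivial: if \<open>w = riesz k\<close> is orthogonal to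
  all \<open>R m w\<close>, then \<open>w (P m k)\<close> has real part 0 for all \<open>m\<close>, and \<open>m \<longlonglongrightarrow> \<infinity>\<close> gives \<open>(norm k)\<^sup>2 = 0\<close>.\<close>

lemma D_dense: assumes x: "x \<in> X" shows "x \<in> closure D"
proof -
  let ?M = "closure D"
  have MX: "?M \<subseteq> X" by (rule closure_minimal) (use As(1) H.closed_antidual in auto)
  have in1: "\<bar>z \<bullet> 1\<bar> \<le> norm z" for z :: 'k using Cauchy_Schwarz_ineq2[of z 1] by simp
  obtain m where m: "m \<in> ?M" "\<And>v. v \<in> ?M \<Longrightarrow> H.dip m v \<bullet> 1 = H.dip x v \<bullet> 1"
  proof (rule symmetric_form_represents_functional[of ?M "\<lambda>f g. H.dip f g \<bullet> 1" 1 1 "\<lambda>v. H.dip x v \<bullet> 1" "norm x"])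
    show "Real_Vector_Spaces.subspace ?M" by (rule subspace_closure[OF subspace_D])
    fix u v w and r :: real assume u: "u \<in> ?M" and v: "v \<in> ?M"
    have uX: "u \<in> X" and vX: "v \<in> X" using u v MX by auto
    show "H.dip u v \<bullet> 1 = H.dip v u \<bullet> 1" using inner_sconj_one[of "H.dip u v"] H.dip_commute[OF uX vX] by simp
    show "H.dip (r *\<^sub>R u) v \<bullet> 1 = r * (H.dip u v \<bullet> 1)" by (simp add: H.dip_scaleR_left[OF uX vX])
    show "\<bar>H.dip u v \<bullet> 1\<bar> \<le> 1 * norm u * norm v" using order_trans[OF in1 H.dip_bound[OF uX vX]] by simp
    show "H.dip x (u + v) \<bullet> 1 = H.dip x u \<bullet> 1 + H.dip x v \<bullet> 1" by (simp add: H.dip_add_right inner_add)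
    show "H.dip x (r *\<^sub>R u) \<bullet> 1 = r * (H.dip x u \<bullet> 1)" by (simp add: H.dip_scaleR_right)
    show "\<bar>H.dip x u \<bullet> 1\<bar> \<le> norm x * norm u" by (rule order_trans[OF in1 H.dip_bound[OF x uX]])
    show "1 * (norm v)\<^sup>2 \<le> H.dip v v \<bullet> 1" unfolding H.dip_self[OF vX] by (simp add: of_real_def inner_one_one del: scaleR_power)
    assume "w \<in> ?M"
    then have wX: "w \<in> X" using MX by auto
    show "H.dip (u + v) w \<bullet> 1 = H.dip u w \<bullet> 1 + H.dip v w \<bullet> 1" by (simp add: H.dip_add_left[OF uX vX wX] inner_add)
  qed auto
  define w where "w = x - m"
  have mX: "m \<in> X" using m MX by auto
  have wX: "w \<in> X" unfolding w_def by (rule H.antidual_diff[OF x mX])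
  obtain k where k: "w = Jtilde \<Sigma> k" using H.riesz_surj[OF wX] ..
  have orth: "H.dip v w \<bullet> 1 = 0" if "v \<in> D" for v
  proof -
    have vM: "v \<in> ?M" using that closure_subset by blast
    have vX: "v \<in> X" using vM MX by auto
    have "H.dip x v = H.dip w v + H.dip m v" using H.dip_add_left[OF wX mX vX] by (simp add: w_def)
    then have "H.dip w v \<bullet> 1 = 0" using m(2)[OF vM] by (simp add: inner_add)
    then show ?thesis using inner_sconj_one[of "H.dip w v"] H.dip_commute[OF wX vX] by simp
  qed
  have "(\<lambda>n. blinfun_apply w (P n k) \<bullet> 1) \<longlonglongrightarrow> blinfun_apply w k \<bullet> 1"
  proof (intro tendsto_intros)
    show "(\<lambda>n. P n k) \<longlonglongrightarrow> k" unfolding P_def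
      by (rule filterlim_compose[OF E.mean_tendsto[OF UNIV_I] filterlim_atI])
        (use tendsto_minus[OF step(3)] in \<open>auto intro!: always_eventually simp: step_nonzero\<close>)
  qed
  moreover have "blinfun_apply w (P n k) \<bullet> 1 = 0" for n
  proof -
    have "H.dip w (R n w) = sconj (blinfun_apply w (P n k))"
      unfolding H.dip_def pair_def pair'_def R_apply[symmetric] using k by simp
    moreover have "H.dip (R n w) w \<bullet> 1 = 0" by (rule orth[OF R_D(1)[OF wX]])
    ultimately show ?thesis
      using H.dip_commute[OF R_X[OF wX] wX, of n] inner_sconj_one[of "H.dip (R n w) w"]
        inner_sconj_one[of "blinfun_apply w (P n k)"] by simp
  qed
  ultimately have "blinfun_apply w k \<bullet> 1 = 0" by (simp add: LIMSEQ_const_iff)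
  then have "(norm k)\<^sup>2 = 0" unfolding k H.riesz_apply H.ip_self by (simp add: of_real_def inner_one_one)
  then have "norm w = 0" unfolding k H.norm_riesz by simp
  then have "w = 0" by simp
  then show ?thesis using m(1) by (simp add: w_def)
qed

text \<open>On $D(A^*)$ the orbit is Lipschitz near 0 (\<open>S_minus_id_on_D\<close>); density and local boundedness do the
  rest.\<close>

lemma S_tendsto_id: assumes x: "x \<in> X" shows "((\<lambda>t. S t x) \<longlongrightarrow> x) (at 0)"
proof (rule tendstoI)
  fix e :: real assume e: "e > 0"
  obtain K where K: "0 \<le> K" "\<And>t x. \<bar>t\<bar> \<le> 1 \<Longrightarrow> norm (E t x) \<le> K * norm x"
    by (rule E_locally_bounded[of "1"]) (rule that)
  obtain L where L: "0 \<le> L" "\<And>t f. \<bar>t\<bar> \<le> 1 \<Longrightarrow> norm (S t f) \<le> L * norm f"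
    by (rule S_locally_bounded[of 1]) (rule that)
  have "e / (2 * (L + 1)) > 0" using e L by simp
  with D_dense[OF x] obtain d where d: "d \<in> D" "dist d x < e / (2 * (L + 1))" unfolding closure_approachable by blast
  define a where "a = norm (As d) * K + 1"
  have a: "a > 0" using K by (simp add: a_def add_nonneg_pos)
  have "dist (S t x) x < e" if t: "\<bar>t\<bar> \<le> 1" "\<bar>t\<bar> < e / (2 * a)" for t
  proof -
    have "S t x - x = S t (x - d) + (S t d - d) + (d - x)"
      by (simp add: S_linear(2))
    then have "norm (S t x - x) \<le> norm (S t (x - d)) + norm (S t d - d) + norm (d - x)"
      by (metis norm_triangle_le norm_triangle_ineq add_right_mono order_refl)
    also have "\<dots> \<le> L * norm (x - d) + norm (As d) * K * \<bar>t\<bar> + norm (d - x)"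
      using L(2)[OF t(1)] S_minus_id_on_D[OF K(2,1) d(1) t(1)] by (intro add_mono) auto
    also have "\<dots> = (L + 1) * dist d x + norm (As d) * K * \<bar>t\<bar>" by (simp add: dist_norm norm_minus_commute algebra_simps)
    also have "norm (As d) * K * \<bar>t\<bar> \<le> a * \<bar>t\<bar>" by (intro mult_right_mono) (auto simp: a_def)
    also have "(L + 1) * dist d x + a * \<bar>t\<bar> < (L + 1) * (e / (2 * (L + 1))) + a * (e / (2 * a))"
      using d(2) t(2) a L(1) by (intro add_strict_mono mult_strict_left_mono) auto
    also have "\<dots> = e" using a L(1) by (simp add: field_simps)
    finally show ?thesis by (simp add: dist_norm)
  qed
  then show "\<forall>\<^sub>F t in at 0. dist (S t x) x < e"
    unfolding eventually_at using e a by (intro exI[of _ "min 1 (e / (2 * a))"]) (auto simp: dist_norm)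
qed

lemma S_continuous: assumes x: "x \<in> X" shows "continuous_on UNIV (\<lambda>t. S t x)"
  unfolding continuous_on_eq_continuous_at[OF open_UNIV]
proof
  fix t
  have "((\<lambda>h. S t (S h x)) \<longlongrightarrow> S t x) (at 0)"
    by (rule bounded_linear.tendsto[OF S_bounded_linear S_tendsto_id[OF x]])
  then have "((\<lambda>h. S (t + h) x) \<longlongrightarrow> S t x) (at 0)" by (simp add: S_plus)
  then show "isCont (\<lambda>t. S t x) t" unfolding isCont_iff .
qed

text \<open>$A^*$ is defined as an adjoint, not as a generator. Weak differentiability, tested against the dense
  domain of $A$, identifies the orbit with an integral of a strongly continuous function, which is
  strongly differentiable.\<close>

lemma S_has_vector_derivative:
  assumes f: "f \<in> D" shows "((\<lambda>t. S t f) has_vector_derivative - S t (As f)) (at t)"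
proof -
  let ?\<Psi> = "\<lambda>t. oriented_integral 0 t (\<lambda>s. S s (As f))"
  have c: "continuous_on UNIV (\<lambda>s. S s (As f))" by (rule S_continuous[OF As(2)[OF f]])
  have int: "(\<lambda>s. S s (As f)) integrable_on {a..b}" for a b
    by (rule integrable_continuous_real) (use c continuous_on_subset in blast)
  have "S t f = f - ?\<Psi> t" for t
  proof (rule eq_on_dense[OF _ domA_dense])
    fix h assume h: "h \<in> domA \<Sigma>"
    have "((\<lambda>s. blinfun_apply f (E (- s) h)) has_vector_derivative - blinfun_apply (S s (As f)) h) (at s)" for s
    proof -
      have "((\<lambda>s. E s h) has_vector_derivative E (- s) (opA \<Sigma> h)) (at (- s))" by (rule E.S_has_vector_derivative[OF h])
      from vector_diff_chain_at[OF has_vector_derivative_minus[OF has_vector_derivative_id] this]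
      have "((\<lambda>s. E (- s) h) has_vector_derivative - E (- s) (opA \<Sigma> h)) (at s)" by (simp add: comp_def)
      from bounded_linear.has_vector_derivative[OF blinfun.bounded_linear_right this, of f]
      show ?thesis using As(3)[OF f E.S_in_D(1)[OF h]] by (simp add: E.S_in_D(2)[OF h, symmetric] blinfun.minus_right)
    qed
    from oriented_integral_of_derivative[OF this, of 0 t]
    have 1: "oriented_integral 0 t (\<lambda>s. - blinfun_apply (S s (As f)) h) = blinfun_apply f (E (- t) h) - blinfun_apply f h"
      by (simp add: E.S_0)
    have "bounded_linear (\<lambda>g :: 'h \<Rightarrow>\<^sub>L 'k. - blinfun_apply g h)"
      by (intro bounded_linear_minus blinfun.bounded_linear_left)
    from oriented_integral_bounded_linear[OF this int int, of 0 t]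
    show "blinfun_apply (S t f) h = blinfun_apply (f - ?\<Psi> t) h"
      using 1 by (simp add: minus_blinfun.rep_eq algebra_simps)
  qed
  moreover have "((\<lambda>t. f - ?\<Psi> t) has_vector_derivative 0 - S t (As f)) (at t)"
    by (intro has_vector_derivative_diff has_vector_derivative_const oriented_integral_has_vector_derivative[OF c])
  ultimately show ?thesis by simp
qed

text \<open>The error at \<open>h\<close> is an average of \<open>(S s x - x) h\<close> over \<open>0 \<le> s \<le> step m\<close>; the mean value inequality replaces
  an integral of vector-valued functions.\<close>

lemma R_tendsto: assumes x: "x \<in> X" shows "(\<lambda>m. R m x) \<longlonglongrightarrow> x"
proof (rule LIMSEQ_I)
  fix e :: real assume e: "e > 0"
  then have "e / 2 > 0" by simp
  from tendstoD[OF S_tendsto_id[OF x] this] obtain d where d: "d > 0" "\<And>t. t \<noteq> 0 \<Longrightarrow> \<bar>t\<bar> < d \<Longrightarrow> norm (S t x - x) < e / 2"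
    unfolding eventually_at dist_norm by auto
  have d': "norm (S t x - x) \<le> e / 2" if "\<bar>t\<bar> < d" for t using d(2)[of t] that e by (cases "t = 0") auto
  from LIMSEQ_D[OF step(3) d(1)] obtain m0 where m0: "\<And>m. m \<ge> m0 \<Longrightarrow> step m < d" using step(1) by force
  have "norm (R m x - x) < e" if m: "m \<ge> m0" for m
  proof -
    have "norm (R m x - x) \<le> e / 2"
    proof (rule norm_blinfun_bound)
      fix h
      let ?F = "\<lambda>s. blinfun_apply x (E.primitive h s) - s *\<^sub>R blinfun_apply x h"
      have "norm (?F (- step m) - ?F 0) \<le> e / 2 * norm h * \<bar>- step m\<bar>"
      proof (rule norm_increment_le[of _ _ "\<lambda>s. blinfun_apply x (E s h) - 1 *\<^sub>R blinfun_apply x h"])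
        fix s :: real assume s: "\<bar>s\<bar> \<le> \<bar>- step m\<bar>"
        show "(?F has_vector_derivative blinfun_apply x (E s h) - 1 *\<^sub>R blinfun_apply x h) (at s)"
          by (intro has_vector_derivative_diff bounded_linear.has_vector_derivative[OF blinfun.bounded_linear_right]
              E.primitive_derivative has_vector_derivative_scaleR) (auto intro!: derivative_eq_intros)
        have "\<bar>- s\<bar> < d" using s m0[OF m] step(1)[of m] by simp
        from d'[OF this] have "norm (S (- s) x - x) * norm h \<le> e / 2 * norm h" by (rule mult_right_mono) simp
        then show "norm (blinfun_apply x (E s h) - 1 *\<^sub>R blinfun_apply x h) \<le> e / 2 * norm h"
          using norm_blinfun[of "S (- s) x - x" h] by (simp add: minus_blinfun.rep_eq)
      qed
      then have "norm (blinfun_apply x (E.primitive h (- step m)) + step m *\<^sub>R blinfun_apply x h) \<le> e / 2 * norm h * step m"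
        using step(1)[of m] by (simp add: blinfun.zero_right)
      moreover have "blinfun_apply (R m x - x) h = (blinfun_apply x (E.primitive h (- step m)) + step m *\<^sub>R blinfun_apply x h) /\<^sub>R (- step m)"
        using step(1)[of m] by (simp add: minus_blinfun.rep_eq P_def E.mean_def blinfun.scaleR_right blinfun.minus_right algebra_simps)
      then have "norm (blinfun_apply (R m x - x) h) = norm (blinfun_apply x (E.primitive h (- step m)) + step m *\<^sub>R blinfun_apply x h) / step m"
        using step(1)[of m] by (simp only: norm_scaleR) (simp add: divide_inverse mult.commute)
      ultimately show "norm (blinfun_apply (R m x - x) h) \<le> e / 2 * norm h"
        using step(1)[of m] by (simp only: pos_divide_le_eq)
    qed (use e in simp)
    then show ?thesis using e by simp
  qed
  then show "\<exists>no. \<forall>n\<ge>no. norm (R n x - x) < e" by blast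
qed

end

section \<open>Integrands that depend on a parameter\<close>

lemma strongly_measurable_simple_parameter:
  fixes F :: "real \<Rightarrow> 'a::real_normed_vector \<Rightarrow> 'b::real_normed_vector"
  assumes s: "simple_function lborel s" "\<And>x. s x \<in> M" and F: "\<And>v. v \<in> M \<Longrightarrow> strongly_measurable (\<lambda>r. F r v)"
  shows "strongly_measurable (\<lambda>r. F r (s r))"
proof -
  let ?I = "range s"
  have fin: "finite ?I" using simple_functionD(1)[OF s(1)] by simp
  have IM: "v \<in> M" if "v \<in> ?I" for v using that s(2) by auto
  have sm: "s \<in> measurable borel (count_space ?I)"
    unfolding measurable_count_space_eq2[OF fin] using simple_functionD(2)[OF s(1)] by auto
  have "\<forall>v. \<exists>D. v \<in> ?I \<longrightarrow> countable D \<and> range (\<lambda>r. F r v) \<subseteq> closure D"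
    using strongly_measurable_separable_range[OF F[OF IM]] by metis
  from choice[OF this] obtain D where D: "\<And>v. v \<in> ?I \<Longrightarrow> countable (D v) \<and> range (\<lambda>r. F r v) \<subseteq> closure (D v)" by auto
  show ?thesis
  proof (rule strongly_measurableI[of "\<Union>v\<in>?I. D v"])
    show "countable (\<Union>v\<in>?I. D v)" using D by (intro countable_UN countable_finite[OF fin]) auto
    show "range (\<lambda>r. F r (s r)) \<subseteq> closure (\<Union>v\<in>?I. D v)"
    proof
      fix z assume "z \<in> range (\<lambda>r. F r (s r))"
      then obtain r where z: "z = F r (s r)" by auto
      have "z \<in> closure (D (s r))" using D[of "s r"] z by auto
      moreover have "closure (D (s r)) \<subseteq> closure (\<Union>v\<in>?I. D v)" by (rule closure_mono) auto
      ultimately show "z \<in> closure (\<Union>v\<in>?I. D v)" by auto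
    qed
    show "(\<lambda>r. dist (F r (s r)) d) \<in> borel_measurable borel" for d
      by (rule measurable_compose_countable'[where f="\<lambda>v r. dist (F r v) d", OF strongly_measurable_dist[OF F[OF IM]] sm])
        (use fin in \<open>auto intro: countable_finite\<close>)
  qed
qed

lemma strongly_measurable_parameter:
  fixes F :: "real \<Rightarrow> 'a::real_normed_vector \<Rightarrow> 'b::real_normed_vector"
  assumes f: "strongly_measurable f" "range f \<subseteq> M" "0 \<in> M"
    and F: "\<And>v. v \<in> M \<Longrightarrow> strongly_measurable (\<lambda>r. F r v)"
    and cont: "\<And>r vs v. (\<And>i::nat. vs i \<in> M) \<Longrightarrow> v \<in> M \<Longrightarrow> vs \<longlonglongrightarrow> v \<Longrightarrow> (\<lambda>i. F r (vs i)) \<longlonglongrightarrow> F r v"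
  shows "strongly_measurable (\<lambda>r. F r (f r))"
proof -
  obtain s where s: "\<And>i. simple_function lborel (s i)" "\<And>i x. s i x \<in> M" "\<And>x. (\<lambda>i. s i x) \<longlonglongrightarrow> f x"
    using strongly_measurable_approximation[OF f] by metis
  show ?thesis
    by (rule strongly_measurable_LIMSEQ[where fs="\<lambda>i r. F r (s i r)"])
      (use f(2) in \<open>auto intro!: cont s strongly_measurable_simple_parameter[OF s(1,2) F]\<close>)
qed

text \<open>Joint measurability of \<open>(t, r) \<mapsto> k t r (f r)\<close>, the hypothesis of Tonelli's theorem, again by simple
  approximation of \<open>f\<close>.\<close>

lemma kernel_measurable:
  fixes k :: "real \<Rightarrow> real \<Rightarrow> 'a::real_normed_vector \<Rightarrow> real"
  assumes f: "strongly_measurable f" "range f \<subseteq> M" "0 \<in> M"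
    and k: "\<And>v. v \<in> M \<Longrightarrow> (\<lambda>(t, r). k t r v) \<in> borel_measurable (borel \<Otimes>\<^sub>M borel)"
    and cont: "\<And>t r vs v. (\<And>i::nat. vs i \<in> M) \<Longrightarrow> v \<in> M \<Longrightarrow> vs \<longlonglongrightarrow> v \<Longrightarrow> (\<lambda>i. k t r (vs i)) \<longlonglongrightarrow> k t r v"
  shows "(\<lambda>(t, r). k t r (f r)) \<in> borel_measurable (borel \<Otimes>\<^sub>M borel)"
proof -
  obtain s where s: "\<And>i. simple_function lborel (s i)" "\<And>i x. s i x \<in> M" "\<And>x. (\<lambda>i. s i x) \<longlonglongrightarrow> f x"
    using strongly_measurable_approximation[OF f] by metis
  have "(\<lambda>p. k (fst p) (snd p) (s i (snd p))) \<in> borel_measurable (borel \<Otimes>\<^sub>M borel)" for i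
  proof -
    let ?I = "range (s i)"
    have fin: "finite ?I" using simple_functionD(1)[OF s(1)[of i]] by simp
    have sm: "s i \<in> measurable borel (count_space ?I)"
      unfolding measurable_count_space_eq2[OF fin] using simple_functionD(2)[OF s(1)[of i]] by auto
    have sm2: "(\<lambda>p. s i (snd p)) \<in> measurable (borel \<Otimes>\<^sub>M borel) (count_space ?I)"
      by (rule measurable_compose[OF measurable_snd sm])
    show ?thesis
      by (rule measurable_compose_countable'[where f="\<lambda>v p. k (fst p) (snd p) v", OF _ sm2])
        (use k s(2) fin in \<open>auto intro: countable_finite simp: case_prod_beta'\<close>)
  qed
  then have "(\<lambda>p. k (fst p) (snd p) (f (snd p))) \<in> borel_measurable (borel \<Otimes>\<^sub>M borel)"
    by (rule borel_measurable_LIMSEQ_metric[where f="\<lambda>i p. k (fst p) (snd p) (s i (snd p))"])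
      (use f(2) in \<open>auto intro!: cont s\<close>)
  then show ?thesis by (simp add: case_prod_beta')
qed

text \<open>The constant 4 comes from \<open>a + b \<le> 2 * max a b\<close>, which avoids subtraction.\<close>

lemma ennreal_sum_square_le: "(a + b)\<^sup>2 \<le> 4 * (a\<^sup>2 + b\<^sup>2)" for a b :: ennreal
proof -
  have "(a + b)\<^sup>2 \<le> (2 * max a b)\<^sup>2" unfolding mult_2 by (intro power_mono add_mono) auto
  also have "\<dots> = 4 * (max a b)\<^sup>2" by (simp add: power_mult_distrib)
  also have "\<dots> \<le> 4 * (a\<^sup>2 + b\<^sup>2)" by (intro mult_left_mono) (auto simp: max_def)
  finally show ?thesis .
qed

lemma nn_integral_shift_le:
  fixes f :: "real \<Rightarrow> ennreal"
  assumes f: "f \<in> borel_measurable borel" and ab: "\<And>t. t \<in> A \<Longrightarrow> t + c \<in> B" and B: "B \<in> sets borel"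
  shows "(\<integral>\<^sup>+t\<in>A. f (t + c) \<partial>lborel) \<le> (\<integral>\<^sup>+t\<in>B. f t \<partial>lborel)"
proof -
  have "(\<integral>\<^sup>+t\<in>B. f t \<partial>lborel) = (\<integral>\<^sup>+t. f (c + 1 * t) * indicator B (c + 1 * t) \<partial>lborel)"
    using nn_integral_real_affine[of "\<lambda>t. f t * indicator B t" 1 c] f B by simp
  moreover have "(\<integral>\<^sup>+t\<in>A. f (t + c) \<partial>lborel) \<le> (\<integral>\<^sup>+t. f (c + 1 * t) * indicator B (c + 1 * t) \<partial>lborel)"
    by (rule nn_integral_mono) (use ab in \<open>auto simp: indicator_def add.commute\<close>)
  ultimately show ?thesis by simp
qed

section \<open>Observation operator and admissibility\<close>

locale admissible_system = group_system \<Sigma>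
  for \<Sigma> :: "('k::real_or_complex, 'h::banach, 'u::banach) csys" +
  assumes H2: "H2 \<Sigma>" and H3: "H3 \<Sigma>"
begin

abbreviation "b \<equiv> Bstar \<Sigma>"
abbreviation "Y \<equiv> dualU \<Sigma>"
abbreviation "emb \<equiv> embDAstar \<Sigma>"

lemmas opB = H2[unfolded H2_def, THEN conjunct1, rule_format]
  H2[unfolded H2_def, THEN conjunct2, THEN conjunct1, rule_format]
  H2[unfolded H2_def, THEN conjunct2, THEN conjunct2, THEN conjunct1, rule_format]
  H2[unfolded H2_def, THEN conjunct2, THEN conjunct2, THEN conjunct2, THEN conjunct1, rule_format]

lemma opB_bound: obtains K where "0 \<le> K" "\<And>u x. x \<in> D \<Longrightarrow> norm (opB \<Sigma> u x) \<le> K * norm u * norm (emb x)"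
proof -
  obtain K where K: "\<forall>u. \<forall>x\<in>D. norm (opB \<Sigma> u x) \<le> K * norm u * norm (emb x)"
    using H2[unfolded H2_def, THEN conjunct2, THEN conjunct2, THEN conjunct2, THEN conjunct2] ..
  have "norm (opB \<Sigma> u x) \<le> max K 0 * norm u * norm (emb x)" if "x \<in> D" for u x
  proof -
    have "norm (opB \<Sigma> u x) \<le> K * norm u * norm (emb x)" using K that by simp
    also have "\<dots> \<le> max K 0 * norm u * norm (emb x)" by (intro mult_right_mono) auto
    finally show ?thesis .
  qed
  then show thesis using that[of "max K 0"] by simp
qed

lemma opB_scaleR_u: "x \<in> D \<Longrightarrow> opB \<Sigma> (r *\<^sub>R u) x = r *\<^sub>R opB \<Sigma> u x"
  using opB(4)[of x "of_real r" u] by (simp add: U.scale_of_real scaleR_conv_of_real)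

lemma b_apply: assumes x: "x \<in> D" shows "blinfun_apply (b x) u = sconj (opB \<Sigma> u x)"
proof -
  obtain K where K: "0 \<le> K" "\<And>u x. x \<in> D \<Longrightarrow> norm (opB \<Sigma> u x) \<le> K * norm u * norm (emb x)"
    by (rule opB_bound) (rule that)
  have "bounded_linear (\<lambda>u. sconj (opB \<Sigma> u x))"
    by (rule bounded_linear_intro[where K="K * norm (emb x)"])
      (use K(2)[OF x] in \<open>auto simp: opB(3)[OF x] opB_scaleR_u[OF x] sconj_add mult_ac\<close>)
  then show ?thesis unfolding Bstar_def by (simp add: bounded_linear_Blinfun_apply)
qed

lemma b_Y: "x \<in> D \<Longrightarrow> b x \<in> Y"
  by (simp add: antidual_def b_apply opB(4) sconj_mult)

lemma b_add: "x \<in> D \<Longrightarrow> y \<in> D \<Longrightarrow> b (x + y) = b x + b y"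
  by (rule blinfun_eqI) (simp add: b_apply As_add(1) opB(1) sconj_add plus_blinfun.rep_eq)

lemma b_scale: "x \<in> D \<Longrightarrow> b (scale_dual c x) = scale_dual c (b x)"
  by (rule blinfun_eqI) (simp add: b_apply As_scale(1) opB(2) sconj_mult)

lemma scale_dual_of_real: "scale_dual (of_real r) f = r *\<^sub>R f"
  by (rule blinfun_eqI) (simp add: H.scale_dual_apply scaleR_blinfun.rep_eq scaleR_conv_of_real)

lemma b_scaleR: assumes "x \<in> D" shows "b (r *\<^sub>R x) = r *\<^sub>R b x"
proof (rule blinfun_eqI)
  fix u
  have "r *\<^sub>R x = scale_dual (of_real r) x"
    by (rule blinfun_eqI) (simp add: scaleR_blinfun.rep_eq scaleR_conv_of_real)
  then show "blinfun_apply (b (r *\<^sub>R x)) u = blinfun_apply (r *\<^sub>R b x) u"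
    using b_scale[OF assms, of "of_real r"] by (simp add: scaleR_blinfun.rep_eq scaleR_conv_of_real)
qed

lemma b_diff: "x \<in> D \<Longrightarrow> y \<in> D \<Longrightarrow> b (x - y) = b x - b y"
  using b_add[OF _ As_scaleR(1), of x y "-1"] b_scaleR[of y "-1"] by simp

lemma b_bound: obtains K where "0 \<le> K" "\<And>x. x \<in> D \<Longrightarrow> norm (b x) \<le> K * norm (emb x)"
proof -
  obtain K where K: "0 \<le> K" "\<And>u x. x \<in> D \<Longrightarrow> norm (opB \<Sigma> u x) \<le> K * norm u * norm (emb x)"
    by (rule opB_bound) (rule that)
  have "norm (b x) \<le> K * norm (emb x)" if "x \<in> D" for x
    by (rule norm_blinfun_bound) (use K(1) K(2)[OF that] in \<open>auto simp: b_apply[OF that] mult_ac\<close>)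
  with K(1) show thesis by (rule that)
qed

text \<open>The graph of $A^*$: the space $D(A^*)$ with its graph norm, as a closed subspace of a product space.
  The operators \<open>b\<close> and \<open>S t\<close> are bounded on it.\<close>

abbreviation "M \<equiv> emb ` D"

lemma emb_linear: "x \<in> D \<Longrightarrow> y \<in> D \<Longrightarrow> emb (x + y) = emb x + emb y" "x \<in> D \<Longrightarrow> emb (r *\<^sub>R x) = r *\<^sub>R emb x"
  "x \<in> D \<Longrightarrow> y \<in> D \<Longrightarrow> emb (x - y) = emb x - emb y" "emb 0 = 0"
  by (auto simp: embDAstar_def As_add As_scaleR As_diff D_0 zero_prod_def)

lemma emb_M: "x \<in> D \<Longrightarrow> emb x \<in> M" by simp

lemma fst_emb [simp]: "fst (emb x) = x" "snd (emb x) = As x" by (auto simp: embDAstar_def)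

lemma subspace_M: "Real_Vector_Spaces.subspace M"
  unfolding Real_Vector_Spaces.subspace_def
proof (intro conjI ballI allI)
  show "0 \<in> M" using emb_M[OF D_0(1)] by (simp add: emb_linear)
  fix p q and c :: real assume "p \<in> M"
  then obtain x where x: "x \<in> D" "p = emb x" by auto
  show "c *\<^sub>R p \<in> M" using emb_M[OF As_scaleR(1)[OF x(1)]] x by (simp add: emb_linear)
  assume "q \<in> M"
  then obtain y where y: "y \<in> D" "q = emb y" by auto
  show "p + q \<in> M" using emb_M[OF As_add(1)[OF x(1) y(1)]] x y by (simp add: emb_linear)
qed

lemma closed_M: "closed M"
  unfolding closed_sequential_limits
proof (intro allI impI)
  fix ps p assume "(\<forall>n. ps n \<in> M) \<and> ps \<longlonglongrightarrow> p"
  then have ps: "\<And>n. ps n \<in> M" "ps \<longlonglongrightarrow> p" by auto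
  have f: "(\<lambda>n. fst (ps n)) \<longlonglongrightarrow> fst p" "(\<lambda>n. snd (ps n)) \<longlonglongrightarrow> snd p" using ps(2) by (auto intro: tendsto_intros)
  have D: "fst (ps n) \<in> D" "snd (ps n) = As (fst (ps n))" for n using ps(1)[of n] by auto
  have X: "fst p \<in> X" "snd p \<in> X"
    by (rule closed_sequentially[OF H.closed_antidual _ f(1)], rule As(1)[OF D(1)])
       (rule closed_sequentially[OF H.closed_antidual _ f(2)], unfold D(2), rule As(2)[OF D(1)])
  have "blinfun_apply (fst p) (opA \<Sigma> h) = blinfun_apply (snd p) h" if h: "h \<in> domA \<Sigma>" for h
  proof (rule LIMSEQ_unique)
    show "(\<lambda>n. blinfun_apply (fst (ps n)) (opA \<Sigma> h)) \<longlonglongrightarrow> blinfun_apply (fst p) (opA \<Sigma> h)" by (intro tendsto_intros f)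
    show "(\<lambda>n. blinfun_apply (fst (ps n)) (opA \<Sigma> h)) \<longlonglongrightarrow> blinfun_apply (snd p) h"
      unfolding As(3)[OF D(1) h] D(2)[symmetric] by (intro tendsto_intros f)
  qed
  from domAstar_I[OF X this] have "fst p \<in> D" "p = emb (fst p)" by (auto simp: embDAstar_def)
  then show "p \<in> M" by blast
qed

definition b_graph :: "('h \<Rightarrow>\<^sub>L 'k) \<times> ('h \<Rightarrow>\<^sub>L 'k) \<Rightarrow> ('u \<Rightarrow>\<^sub>L 'k)" where "b_graph p = b (fst p)"

lemma M_D: "p \<in> M \<Longrightarrow> fst p \<in> D" "p \<in> M \<Longrightarrow> emb (fst p) = p" by auto

lemma b_graph: "p \<in> M \<Longrightarrow> q \<in> M \<Longrightarrow> b_graph (p + q) = b_graph p + b_graph q" "p \<in> M \<Longrightarrow> b_graph (r *\<^sub>R p) = r *\<^sub>R b_graph p"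
  "p \<in> M \<Longrightarrow> q \<in> M \<Longrightarrow> b_graph (p - q) = b_graph p - b_graph q"
  by (simp_all add: b_graph_def b_add b_scaleR b_diff M_D)

lemma b_graph_tendsto:
  assumes "\<And>i. ps i \<in> M" "p \<in> M" "(ps \<longlongrightarrow> p) F" shows "((\<lambda>i. b_graph (ps i)) \<longlongrightarrow> b_graph p) F"
proof -
  obtain K where K: "0 \<le> K" "\<And>x. x \<in> D \<Longrightarrow> norm (b x) \<le> K * norm (emb x)" by (rule b_bound) (rule that)
  show ?thesis
  proof (rule LIM_zero_cancel, rule Lim_null_comparison)
    have "norm (b_graph (ps i) - b_graph p) \<le> K * norm (ps i - p)" for i
      using K(2)[OF M_D(1)[OF Real_Vector_Spaces.subspace_diff[OF subspace_M assms(1,2)]], of i]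
        M_D(2)[OF Real_Vector_Spaces.subspace_diff[OF subspace_M assms(1,2)], of i] b_graph(3)[OF assms(1,2), of i]
      by (simp add: b_graph_def)
    then show "\<forall>\<^sub>F i in F. norm (b_graph (ps i) - b_graph p) \<le> K * norm (ps i - p)" by simp
    have "((\<lambda>i. norm (ps i - p)) \<longlongrightarrow> 0) F" using assms(3) by (simp add: LIM_zero tendsto_norm_zero)
    then show "((\<lambda>i. K * norm (ps i - p)) \<longlongrightarrow> 0) F" by (rule tendsto_mult_right_zero)
  qed
qed

lemma b_continuous:
  fixes f :: "'t::topological_space \<Rightarrow> _"
  assumes "\<And>t. f t \<in> D" "continuous_on UNIV f" "continuous_on UNIV (\<lambda>t. As (f t))"
  shows "continuous_on UNIV (\<lambda>t. b (f t))"
proof -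
  have "continuous_on UNIV (\<lambda>t. emb (f t))" unfolding embDAstar_def by (intro continuous_intros assms)
  then have "continuous_on UNIV (\<lambda>t. b_graph (emb (f t)))"
    unfolding continuous_on_def using b_graph_tendsto[of "\<lambda>t. emb (f t)"] assms(1) by auto
  then show ?thesis by (simp add: b_graph_def)
qed

lemma b_S_continuous: "x \<in> D \<Longrightarrow> continuous_on UNIV (\<lambda>t. b (S t x))"
  by (rule b_continuous) (auto simp: S_D intro: S_continuous As)

lemma b_S_measurable: "x \<in> D \<Longrightarrow> (\<lambda>t. norm (b (S t x))) \<in> borel_measurable borel"
  by (intro borel_measurable_continuous_onI continuous_on_norm b_S_continuous)

text \<open>Admissibility is assumed on \<open>[0, T]\<close>; the group property moves it to the symmetric interval, with the
  initial value \<open>S (- \<tau>) x\<close>.\<close>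

lemma orbit_energy_bound:
  assumes \<tau>: "\<tau> > 0"
  obtains c where "0 \<le> c" "\<And>x. x \<in> D \<Longrightarrow> energy \<tau> (\<lambda>t. b (S t x)) \<le> ennreal (c * (norm x)\<^sup>2)"
proof -
  have "2 * \<tau> > 0" using \<tau> by simp
  from H3[unfolded H3_def, rule_format, OF this] obtain c1 where c1: "c1 > 0" "\<And>x. x \<in> D \<Longrightarrow>
     (LBINT t:{0..2*\<tau>}. (norm (Bstar \<Sigma> (expAstar \<Sigma> (- t) x)))\<^sup>2) \<le> c1 * (norm x)\<^sup>2" by auto
  obtain K where K: "0 \<le> K" "\<And>t f. \<bar>t\<bar> \<le> \<tau> \<Longrightarrow> norm (S t f) \<le> K * norm f" by (rule S_locally_bounded[of \<tau>]) (rule that)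
  have "energy \<tau> (\<lambda>t. b (S t x)) \<le> ennreal (c1 * K\<^sup>2 * (norm x)\<^sup>2)" if x: "x \<in> D" for x
  proof -
    define z where "z = S (- \<tau>) x"
    have z: "z \<in> D" unfolding z_def by (rule S_D(1)[OF x])
    have Sz: "S (t + \<tau>) z = S t x" for t by (simp add: z_def flip: S_plus)
    note [measurable] = b_S_measurable[OF z]
    have m: "(\<lambda>t. (norm (b (S t z)))\<^sup>2) \<in> borel_measurable borel" by measurable
    have fin: "(\<integral>\<^sup>+t\<in>{0..2*\<tau>}. ennreal ((norm (b (S t z)))\<^sup>2) \<partial>lborel) < \<infinity>"
    proof (rule le_less_trans)
      show "(\<integral>\<^sup>+t\<in>{0..2*\<tau>}. ennreal ((norm (b (S t z)))\<^sup>2) \<partial>lborel) \<le> energy (2*\<tau>) (\<lambda>t. b (S t z))"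
        using \<tau> by (intro nn_integral_mono) (auto simp: indicator_def)
    qed (rule continuous_energy_finite[OF b_S_continuous[OF z]])
    have "energy \<tau> (\<lambda>t. b (S t x)) = (\<integral>\<^sup>+t\<in>{-\<tau>..\<tau>}. ennreal ((norm (b (S (t + \<tau>) z)))\<^sup>2) \<partial>lborel)" by (simp add: Sz)
    also have "\<dots> \<le> (\<integral>\<^sup>+t\<in>{0..2*\<tau>}. ennreal ((norm (b (S t z)))\<^sup>2) \<partial>lborel)"
      by (rule nn_integral_shift_le) auto
    also have "\<dots> = ennreal (LBINT t:{0..2*\<tau>}. (norm (b (S t z)))\<^sup>2)"
      by (rule set_integrable_real_from_nn(2)[OF m]) (use fin in auto)
    also have "\<dots> \<le> ennreal (c1 * (norm z)\<^sup>2)" using c1(2)[OF z] by (intro ennreal_leI) (simp add: S_def)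
    also have "\<dots> \<le> ennreal (c1 * (K * norm x)\<^sup>2)"
      unfolding z_def using c1(1) \<tau> by (intro ennreal_leI mult_left_mono power_mono K) auto
    finally show ?thesis by (simp add: power_mult_distrib mult.assoc)
  qed
  then show thesis using that[of "c1 * K\<^sup>2"] c1(1) by simp
qed

end

section \<open>A priori estimate for mild solutions\<close>

lemma bounded_linear_strongly_measurable:
  assumes "bounded_linear L" "strongly_measurable f" shows "strongly_measurable (\<lambda>x. L (f x))"
  by (rule strongly_measurable_compose2[where h="\<lambda>u v. L u" and M=UNIV and g=f])
    (use assms bounded_linear.tendsto[OF assms(1)] in auto)

context admissible_system begin

abbreviation "Ldom \<equiv> L1loc_domAstar \<Sigma>"

lemma Ldom:
  assumes "g \<in> Ldom"
  shows "g r \<in> D" "strongly_measurable (\<lambda>r. emb (g r))" "strongly_measurable g" "range (\<lambda>r. emb (g r)) \<subseteq> M"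
    "\<tau> > 0 \<Longrightarrow> (\<integral>\<^sup>+r\<in>{-\<tau>..\<tau>}. ennreal (norm (emb (g r))) \<partial>lborel) < \<infinity>"
proof -
  have L: "(\<lambda>r. emb (g r)) \<in> Lloc 1 M" using assms by (simp add: L1loc_domAstar_def)
  then have M: "\<And>r. emb (g r) \<in> M" by (simp add: Lloc_def)
  show "g r \<in> D" for r using M_D(1)[OF M, of r] by simp
  show sm: "strongly_measurable (\<lambda>r. emb (g r))" using L by (simp add: Lloc_def)
  show "strongly_measurable g" using bounded_linear_strongly_measurable[OF bounded_linear_fst sm] by simp
  show "range (\<lambda>r. emb (g r)) \<subseteq> M" using M by auto
  show "\<tau> > 0 \<Longrightarrow> (\<integral>\<^sup>+r\<in>{-\<tau>..\<tau>}. ennreal (norm (emb (g r))) \<partial>lborel) < \<infinity>"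
    using L by (simp add: Lloc_def)
qed

definition S_graph :: "real \<Rightarrow> ('h \<Rightarrow>\<^sub>L 'k) \<times> ('h \<Rightarrow>\<^sub>L 'k) \<Rightarrow> ('h \<Rightarrow>\<^sub>L 'k) \<times> ('h \<Rightarrow>\<^sub>L 'k)" where
  "S_graph t p = (S t (fst p), S t (snd p))"

lemma S_graph_emb: "x \<in> D \<Longrightarrow> S_graph t (emb x) = emb (S t x)"
  by (simp add: S_graph_def embDAstar_def S_D)

lemma S_graph_M: "p \<in> M \<Longrightarrow> S_graph t p \<in> M"
  using S_graph_emb S_D(1) by auto

lemma S_graph_bounded_linear: "bounded_linear (S_graph t)"
  unfolding S_graph_def[abs_def]
  by (intro bounded_linear_Pair bounded_linear_compose[OF S_bounded_linear] bounded_linear_fst bounded_linear_snd)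

lemma S_graph_continuous: "p \<in> M \<Longrightarrow> continuous_on UNIV (\<lambda>t. S_graph t p)"
  unfolding S_graph_def using As by (intro continuous_on_Pair S_continuous) auto

lemma continuous_on_shifted: "continuous_on UNIV f \<Longrightarrow> continuous_on UNIV (\<lambda>r. f (t - r :: real))"
  by (rule continuous_on_compose2[where f="\<lambda>r. t - r"]) (auto intro!: continuous_intros)

lemma S_graph_measurable:
  assumes g: "g \<in> Ldom" shows "strongly_measurable (\<lambda>r. S_graph (t - r) (emb (g r)))"
proof (rule strongly_measurable_parameter[where F="\<lambda>r v. S_graph (t - r) v" and M=M, OF Ldom(2,4)[OF g]])
  show "0 \<in> M" using Real_Vector_Spaces.subspace_0[OF subspace_M] .
  show "strongly_measurable (\<lambda>r. S_graph (t - r) v)" if "v \<in> M" for v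
    by (intro strongly_measurable_continuous continuous_on_shifted S_graph_continuous that)
qed (rule bounded_linear.tendsto[OF S_graph_bounded_linear])

lemma b_S_graph_measurable:
  assumes g: "g \<in> Ldom" shows "strongly_measurable (\<lambda>r. b (S (t - r) (g r)))"
proof -
  have r: "range (\<lambda>r. S_graph (t - r) (emb (g r))) \<subseteq> M"
    by (rule image_subsetI) (rule S_graph_M[OF emb_M[OF Ldom(1)[OF g]]])
  have "strongly_measurable (\<lambda>r. b_graph (S_graph (t - r) (emb (g r))))"
    by (rule strongly_measurable_compose2[where h="\<lambda>u v. b_graph u" and M=M, OF S_graph_measurable[OF g] S_graph_measurable[OF g] r r])
      (rule Real_Vector_Spaces.subspace_0[OF subspace_M], rule b_graph_tendsto)
  then show ?thesis by (simp add: S_graph_emb Ldom(1)[OF g] b_graph_def)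
qed

lemma S_graph_locally_bounded: obtains K where "0 \<le> K" "\<And>t p. \<bar>t\<bar> \<le> \<tau> \<Longrightarrow> norm (S_graph t p) \<le> K * norm p"
proof -
  obtain K where K: "0 \<le> K" "\<And>t f. \<bar>t\<bar> \<le> \<tau> \<Longrightarrow> norm (S t f) \<le> K * norm f"
    by (rule S_locally_bounded[of \<tau>]) (rule that)
  have "norm (S_graph t p) \<le> K * norm p" if "\<bar>t\<bar> \<le> \<tau>" for t p
  proof -
    have "norm (S_graph t p) = sqrt ((norm (S t (fst p)))\<^sup>2 + (norm (S t (snd p)))\<^sup>2)" by (simp add: S_graph_def norm_Pair)
    also have "\<dots> \<le> sqrt ((K * norm (fst p))\<^sup>2 + (K * norm (snd p))\<^sup>2)"
      by (intro real_sqrt_le_mono add_mono power_mono K(2)[OF that]) auto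
    also have "\<dots> = K * norm p"
      using K(1) by (simp add: power_mult_distrib norm_prod_def real_sqrt_mult flip: distrib_left)
    finally show ?thesis .
  qed
  with K(1) show thesis by (rule that)
qed

lemma S_graph_integral_finite:
  assumes g: "g \<in> Ldom" shows "(\<integral>\<^sup>+r\<in>{a..c}. ennreal (norm (S_graph (t - r) (emb (g r)))) \<partial>lborel) < \<infinity>"
proof -
  define \<tau> where "\<tau> = \<bar>a\<bar> + \<bar>c\<bar> + \<bar>t\<bar> + 1"
  have \<tau>: "\<tau> > 0" "{a..c} \<subseteq> {-\<tau>..\<tau>}" "\<And>r. r \<in> {a..c} \<Longrightarrow> \<bar>t - r\<bar> \<le> \<tau>" by (auto simp: \<tau>_def)
  obtain K where K: "0 \<le> K" "\<And>t p. \<bar>t\<bar> \<le> \<tau> \<Longrightarrow> norm (S_graph t p) \<le> K * norm p" by (rule S_graph_locally_bounded[of \<tau>]) (rule that)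
  have "(\<integral>\<^sup>+r\<in>{a..c}. ennreal (norm (S_graph (t - r) (emb (g r)))) \<partial>lborel) \<le>
    (\<integral>\<^sup>+r. ennreal K * (ennreal (norm (emb (g r))) * indicator {-\<tau>..\<tau>} r) \<partial>lborel)"
  proof (rule nn_integral_mono)
    fix r
    show "ennreal (norm (S_graph (t - r) (emb (g r)))) * indicator {a..c} r \<le> ennreal K * (ennreal (norm (emb (g r))) * indicator {-\<tau>..\<tau>} r)"
    proof (cases "r \<in> {a..c}")
      case True
      then have "r \<in> {-\<tau>..\<tau>}" using \<tau>(2) by auto
      moreover have "ennreal (norm (S_graph (t - r) (emb (g r)))) \<le> ennreal (K * norm (emb (g r)))"
        by (intro ennreal_leI K(2) \<tau>(3) True)
      ultimately show ?thesis using True K(1) by (simp add: ennreal_mult)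
    qed simp
  qed
  also have "\<dots> = ennreal K * (\<integral>\<^sup>+r\<in>{-\<tau>..\<tau>}. ennreal (norm (emb (g r))) \<partial>lborel)"
  proof -
    note [measurable] = strongly_measurable_norm[OF Ldom(2)[OF g]]
    show ?thesis by (rule nn_integral_cmult) measurable
  qed
  also have "\<dots> < \<infinity>" using Ldom(5)[OF g \<tau>(1)] by (simp add: ennreal_mult_less_top)
  finally show ?thesis .
qed

text \<open>The integrand is integrated as a curve in the graph of $A^*$. Closedness of the graph puts the integral
  into $D(A^*)$, and \<open>b\<close>, bounded on the graph, passes under the integral sign.\<close>

lemma Duhamel_has_integral:
  assumes g: "g \<in> Ldom"
  shows "(\<lambda>r. S (t - r) (g r)) integrable_on {a..c}" "integral {a..c} (\<lambda>r. S (t - r) (g r)) \<in> D"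
    "((\<lambda>r. b (S (t - r) (g r))) has_integral b (integral {a..c} (\<lambda>r. S (t - r) (g r)))) {a..c}"
proof -
  let ?w = "\<lambda>r. S_graph (t - r) (emb (g r))"
  have w: "?w r = emb (S (t - r) (g r))" for r by (rule S_graph_emb[OF Ldom(1)[OF g]])
  have int: "?w integrable_on {a..c}"
    by (rule strongly_measurable_integrable_on(1)[OF S_graph_measurable[OF g] S_graph_integral_finite[OF g]])
  have I: "(?w has_integral integral {a..c} ?w) {a..c}" by (rule integrable_integral[OF int])
  have wM: "?w r \<in> M" for r unfolding w by (rule emb_M[OF S_D(1)[OF Ldom(1)[OF g]]])
  obtain L where L: "0 \<le> L" "\<And>x. x \<in> D \<Longrightarrow> norm (b x) \<le> L * norm (emb x)" by (rule b_bound) (rule that)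
  have bgb: "norm (b_graph p) \<le> L * norm p" if "p \<in> M" for p
    using L(2)[OF M_D(1)[OF that]] M_D(2)[OF that] by (simp add: b_graph_def)
  note sub = has_integral_on_subspace[OF I subspace_M closed_M wM b_graph(1) b_graph(2) bgb]
  have f: "((\<lambda>r. S (t - r) (g r)) has_integral fst (integral {a..c} ?w)) {a..c}"
    using has_integral_linear[OF I bounded_linear_fst] by (simp add: comp_def w)
  then show "(\<lambda>r. S (t - r) (g r)) integrable_on {a..c}" by blast
  have e: "integral {a..c} (\<lambda>r. S (t - r) (g r)) = fst (integral {a..c} ?w)" using integral_unique[OF f] .
  show "integral {a..c} (\<lambda>r. S (t - r) (g r)) \<in> D" unfolding e by (rule M_D(1)[OF sub(1)])
  show "((\<lambda>r. b (S (t - r) (g r))) has_integral b (integral {a..c} (\<lambda>r. S (t - r) (g r)))) {a..c}"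
    unfolding e using sub(2) by (simp add: b_graph_def w)
qed

definition kernel_integral :: "real \<Rightarrow> (real \<Rightarrow> ('h \<Rightarrow>\<^sub>L 'k)) \<Rightarrow> real \<Rightarrow> ennreal" where
  "kernel_integral \<tau> g t = (\<integral>\<^sup>+r\<in>{-\<tau>..\<tau>}. ennreal (norm (b (S (t - r) (g r)))) \<partial>lborel)"

lemma b_Duhamel_le:
  assumes g: "g \<in> Ldom" and ac: "{a..c} \<subseteq> {-\<tau>..\<tau>}"
  shows "ennreal (norm (b (integral {a..c} (\<lambda>r. S (t - r) (g r))))) \<le> kernel_integral \<tau> g t"
proof -
  let ?f = "\<lambda>r. b (S (t - r) (g r))"
  obtain L where L: "0 \<le> L" "\<And>x. x \<in> D \<Longrightarrow> norm (b x) \<le> L * norm (emb x)" by (rule b_bound) (rule that)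
  have le: "norm (?f r) \<le> L * norm (S_graph (t - r) (emb (g r)))" for r
    using L(2)[OF S_D(1)[OF Ldom(1)[OF g]]] by (simp add: S_graph_emb Ldom(1)[OF g])
  have "(\<integral>\<^sup>+r\<in>{a..c}. ennreal (norm (?f r)) \<partial>lborel) \<le> (\<integral>\<^sup>+r. ennreal L * (ennreal (norm (S_graph (t - r) (emb (g r)))) * indicator {a..c} r) \<partial>lborel)"
    by (intro nn_integral_mono) (use le L(1) in \<open>auto simp: indicator_def ennreal_mult[symmetric] intro!: ennreal_leI\<close>)
  also have "\<dots> = ennreal L * (\<integral>\<^sup>+r\<in>{a..c}. ennreal (norm (S_graph (t - r) (emb (g r)))) \<partial>lborel)"
  proof -
    note [measurable] = strongly_measurable_norm[OF S_graph_measurable[OF g, of t]]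
    show ?thesis by (rule nn_integral_cmult) measurable
  qed
  also have "\<dots> < \<infinity>" using S_graph_integral_finite[OF g, where a=a and c=c and t=t] by (simp add: ennreal_mult_less_top)
  finally have fin: "(\<integral>\<^sup>+r\<in>{a..c}. ennreal (norm (?f r)) \<partial>lborel) < \<infinity>" .
  have "ennreal (norm (integral {a..c} ?f)) \<le> (\<integral>\<^sup>+r\<in>{a..c}. ennreal (norm (?f r)) \<partial>lborel)"
    by (rule strongly_measurable_integrable_on(2)[OF b_S_graph_measurable[OF g] fin])
  also have "\<dots> \<le> kernel_integral \<tau> g t"
    unfolding kernel_integral_def by (intro nn_integral_mono) (use ac in \<open>auto simp: indicator_def\<close>)
  finally show ?thesis unfolding integral_unique[OF Duhamel_has_integral(3)[OF g]] .
qed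

lemma kernel_borel:
  assumes g: "g \<in> Ldom"
  shows "(\<lambda>(t, r). norm (b (S (t - r) (g r)))) \<in> borel_measurable (borel \<Otimes>\<^sub>M borel)"
proof -
  have "(\<lambda>(t, r). norm (b_graph (S_graph (t - r) (emb (g r))))) \<in> borel_measurable (borel \<Otimes>\<^sub>M borel)"
  proof (rule kernel_measurable[where k="\<lambda>t r v. norm (b_graph (S_graph (t - r) v))", OF Ldom(2,4)[OF g]])
    show "0 \<in> M" using Real_Vector_Spaces.subspace_0[OF subspace_M] .
    show "(\<lambda>(t, r). norm (b_graph (S_graph (t - r) v))) \<in> borel_measurable (borel \<Otimes>\<^sub>M borel)" if v: "v \<in> M" for v
    proof -
      have "(\<lambda>s. norm (b (S s (fst v)))) \<in> borel_measurable borel" by (rule b_S_measurable[OF M_D(1)[OF v]])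
      then have "(\<lambda>p. norm (b (S (fst p - snd p) (fst v)))) \<in> borel_measurable (borel \<Otimes>\<^sub>M borel)"
        by (rule measurable_compose[rotated]) measurable
      then show ?thesis by (simp add: case_prod_beta' b_graph_def S_graph_def)
    qed
    show "(\<lambda>i. norm (b_graph (S_graph (t - r) (vs i)))) \<longlonglongrightarrow> norm (b_graph (S_graph (t - r) v))"
      if "\<And>i::nat. vs i \<in> M" "v \<in> M" "vs \<longlonglongrightarrow> v" for t r vs v
      by (intro tendsto_norm b_graph_tendsto S_graph_M that bounded_linear.tendsto[OF S_graph_bounded_linear])
  qed
  then show ?thesis by (simp add: b_graph_def S_graph_emb Ldom(1)[OF g])
qed

lemma kernel_integral_measurable:
  assumes g: "g \<in> Ldom" shows "kernel_integral \<tau> g \<in> borel_measurable borel"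
proof -
  note [measurable] = kernel_borel[OF g]
  have "(\<lambda>t. \<integral>\<^sup>+r\<in>{-\<tau>..\<tau>}. ennreal (norm (b (S (t - r) (g r)))) \<partial>lborel) \<in> borel_measurable borel"
    by measurable
  then show ?thesis by (simp add: kernel_integral_def[abs_def])
qed

text \<open>Minkowski's integral inequality for \<open>k t r = norm (b (S (t - r) (g r)))\<close>. Splitting
  \<open>k = sqrt n * (k / sqrt n)\<close> with \<open>n r = norm (g r)\<close> and applying the Cauchy--Schwarz inequality in \<open>r\<close> bounds the
  square by \<open>N\<close> times the integral of \<open>k\<^sup>2 / n\<close>, where \<open>N\<close> is the integral of \<open>n\<close>; by Tonelli's theorem and
  admissibility the latter is at most \<open>c * N\<close> after integration in \<open>t\<close>.\<close>

lemma kernel_integral_energy: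
  assumes \<tau>: "\<tau> > 0"
  obtains c where "0 \<le> c" "\<And>g. g \<in> Ldom \<Longrightarrow> (\<integral>\<^sup>+t\<in>{-\<tau>..\<tau>}. (kernel_integral \<tau> g t)\<^sup>2 \<partial>lborel)
     \<le> ennreal c * (\<integral>\<^sup>+r\<in>{-\<tau>..\<tau>}. ennreal (norm (g r)) \<partial>lborel)\<^sup>2"
proof -
  have "2 * \<tau> > 0" using \<tau> by simp
  then obtain c where c: "0 \<le> c" "\<And>x. x \<in> D \<Longrightarrow> energy (2 * \<tau>) (\<lambda>t. b (S t x)) \<le> ennreal (c * (norm x)\<^sup>2)"
    by (rule orbit_energy_bound) (rule that)
  have "(\<integral>\<^sup>+t\<in>{-\<tau>..\<tau>}. (kernel_integral \<tau> g t)\<^sup>2 \<partial>lborel)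
     \<le> ennreal c * (\<integral>\<^sup>+r\<in>{-\<tau>..\<tau>}. ennreal (norm (g r)) \<partial>lborel)\<^sup>2" if g: "g \<in> Ldom" for g
  proof -
    note [measurable] = kernel_borel[OF g] strongly_measurable_norm[OF Ldom(3)[OF g]]
    let ?I = "indicator {-\<tau>..\<tau>} :: real \<Rightarrow> ennreal"
    define n where "n r = norm (g r)" for r
    have [measurable]: "n \<in> borel_measurable borel" by (simp add: n_def[abs_def])
    define k where "k t r = norm (b (S (t - r) (g r)))" for t r
    have [measurable]: "(\<lambda>(t, r). k t r) \<in> borel_measurable (borel \<Otimes>\<^sub>M borel)" by (simp add: k_def)
    have [measurable]: "k t \<in> borel_measurable borel" for t
      using strongly_measurable_norm[OF b_S_graph_measurable[OF g, of t]] by (simp add: k_def[abs_def])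
    have n0: "n r \<ge> 0" "k t r \<ge> 0" for t r by (auto simp: n_def k_def)
    \<comment> \<open>Division by \<open>n r = 0\<close> yields 0, which is harmless because the kernel vanishes there as well.\<close>
    have kn: "k t r = 0" if "n r = 0" for t r
    proof -
      have "g r = 0" using that by (simp add: n_def)
      moreover have "b 0 = 0" using b_scaleR[OF D_0(1), of 0] by simp
      ultimately show ?thesis by (simp add: k_def S_linear(4))
    qed
    define N where "N = (\<integral>\<^sup>+r\<in>{-\<tau>..\<tau>}. ennreal (n r) \<partial>lborel)"
    have CS: "(kernel_integral \<tau> g t)\<^sup>2 \<le> N * (\<integral>\<^sup>+r. ennreal ((k t r)\<^sup>2 / n r) * ?I r \<partial>lborel)" for t
    proof -
      have "kernel_integral \<tau> g t = (\<integral>\<^sup>+r. (ennreal (sqrt (n r)) * ?I r) * (ennreal (k t r / sqrt (n r)) * ?I r) \<partial>lborel)"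
        unfolding kernel_integral_def
      proof (rule nn_integral_cong)
        fix r
        have "k t r = sqrt (n r) * (k t r / sqrt (n r))" using kn[of r t] n0(1)[of r] by (cases "n r = 0") auto
        then have "ennreal (k t r) = ennreal (sqrt (n r)) * ennreal (k t r / sqrt (n r))"
          using n0 by (subst ennreal_mult[symmetric]) auto
        then show "ennreal (norm (b (S (t - r) (g r)))) * ?I r = (ennreal (sqrt (n r)) * ?I r) * (ennreal (k t r / sqrt (n r)) * ?I r)"
          by (auto simp: indicator_def k_def)
      qed
      then have "(kernel_integral \<tau> g t)\<^sup>2 \<le> (\<integral>\<^sup>+r. (ennreal (sqrt (n r)) * ?I r)\<^sup>2 \<partial>lborel) * (\<integral>\<^sup>+r. (ennreal (k t r / sqrt (n r)) * ?I r)\<^sup>2 \<partial>lborel)"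
        by (simp only:) (rule Cauchy_Schwarz_nn_integral; measurable)
      also have "(\<integral>\<^sup>+r. (ennreal (sqrt (n r)) * ?I r)\<^sup>2 \<partial>lborel) = N"
        unfolding N_def using n0 by (intro nn_integral_cong) (auto simp: indicator_def ennreal_power)
      also have "(\<integral>\<^sup>+r. (ennreal (k t r / sqrt (n r)) * ?I r)\<^sup>2 \<partial>lborel) = (\<integral>\<^sup>+r. ennreal ((k t r)\<^sup>2 / n r) * ?I r \<partial>lborel)"
        using n0 by (intro nn_integral_cong) (auto simp: indicator_def ennreal_power power_divide)
      finally show ?thesis .
    qed
    have inner: "(\<integral>\<^sup>+t. ennreal ((k t r)\<^sup>2 / n r) * ?I t \<partial>lborel) \<le> ennreal c * ennreal (n r)" if r: "r \<in> {-\<tau>..\<tau>}" for r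
    proof -
      have [measurable]: "(\<lambda>t. norm (b (S t (g r)))) \<in> borel_measurable borel" by (rule b_S_measurable[OF Ldom(1)[OF g]])
      have [measurable]: "(\<lambda>t. k t r) \<in> borel_measurable borel" by measurable
      have "(\<integral>\<^sup>+t. ennreal ((k t r)\<^sup>2 / n r) * ?I t \<partial>lborel) = (\<integral>\<^sup>+t. ennreal (1 / n r) * (ennreal ((k t r)\<^sup>2) * ?I t) \<partial>lborel)"
        using n0 by (intro nn_integral_cong) (auto simp: indicator_def ennreal_mult[symmetric])
      also have "\<dots> = ennreal (1 / n r) * (\<integral>\<^sup>+t\<in>{-\<tau>..\<tau>}. ennreal ((k t r)\<^sup>2) \<partial>lborel)"
        by (rule nn_integral_cmult) measurable
      also have "(\<integral>\<^sup>+t\<in>{-\<tau>..\<tau>}. ennreal ((k t r)\<^sup>2) \<partial>lborel) = (\<integral>\<^sup>+t\<in>{-\<tau>..\<tau>}. ennreal ((norm (b (S (t + - r) (g r))))\<^sup>2) \<partial>lborel)"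
        by (simp add: k_def)
      also have "\<dots> \<le> energy (2 * \<tau>) (\<lambda>t. b (S t (g r)))"
      proof (rule nn_integral_shift_le)
        show "(\<lambda>t. ennreal ((norm (b (S t (g r))))\<^sup>2)) \<in> borel_measurable borel" by measurable
      qed (use r in auto)
      also have "\<dots> \<le> ennreal (c * (n r)\<^sup>2)" unfolding n_def by (rule c(2)[OF Ldom(1)[OF g]])
      also have "ennreal (1 / n r) * ennreal (c * (n r)\<^sup>2) = ennreal c * ennreal (n r)"
        using n0(1)[of r] c(1) by (cases "n r = 0") (simp_all add: ennreal_mult[symmetric] power2_eq_square)
      finally show ?thesis by (simp add: mult_left_mono)
    qed
    have "(\<integral>\<^sup>+t\<in>{-\<tau>..\<tau>}. (kernel_integral \<tau> g t)\<^sup>2 \<partial>lborel) \<le> (\<integral>\<^sup>+t. N * (\<integral>\<^sup>+r. ennreal ((k t r)\<^sup>2 / n r) * ?I r * ?I t \<partial>lborel) \<partial>lborel)"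
      using CS by (intro nn_integral_mono) (auto simp: indicator_def)
    also have "\<dots> = N * (\<integral>\<^sup>+t. \<integral>\<^sup>+r. ennreal ((k t r)\<^sup>2 / n r) * ?I r * ?I t \<partial>lborel \<partial>lborel)"
      by (rule nn_integral_cmult) measurable
    also have "(\<integral>\<^sup>+t. \<integral>\<^sup>+r. ennreal ((k t r)\<^sup>2 / n r) * ?I r * ?I t \<partial>lborel \<partial>lborel)
        = (\<integral>\<^sup>+r. \<integral>\<^sup>+t. ennreal ((k t r)\<^sup>2 / n r) * ?I r * ?I t \<partial>lborel \<partial>lborel)"
      by (rule lborel_pair.Fubini') measurable
    also have "N * \<dots> \<le> N * (\<integral>\<^sup>+r. ennreal c * (ennreal (n r) * ?I r) \<partial>lborel)"
    proof (intro mult_left_mono nn_integral_mono)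
      fix r
      show "(\<integral>\<^sup>+t. ennreal ((k t r)\<^sup>2 / n r) * ?I r * ?I t \<partial>lborel) \<le> ennreal c * (ennreal (n r) * ?I r)"
        using inner[of r] by (cases "r \<in> {-\<tau>..\<tau>}") auto
    qed simp
    also have "(\<integral>\<^sup>+r. ennreal c * (ennreal (n r) * ?I r) \<partial>lborel) = ennreal c * N"
      unfolding N_def by (rule nn_integral_cmult) measurable
    finally show ?thesis unfolding N_def[symmetric] n_def[symmetric] by (simp add: power2_eq_square mult_ac)
  qed
  then show thesis using that c(1) by blast
qed

lemma mild_D:
  assumes "y \<in> D" "g \<in> Ldom"
  shows "mild \<Sigma> y g t \<in> D" "\<bar>t\<bar> \<le> \<tau> \<Longrightarrow> ennreal (norm (b (mild \<Sigma> y g t))) \<le> ennreal (norm (b (S t y))) + kernel_integral \<tau> g t"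
proof -
  let ?o = "oriented_integral 0 t (\<lambda>r. S (t - r) (g r))"
  have m: "mild \<Sigma> y g t = S t y + ?o" by (simp add: mild_def S_def)
  have o: "?o \<in> D"
    using Duhamel_has_integral(2)[OF assms(2)] As_scaleR(1)[of _ "-1"] by (auto simp: oriented_integral_def)
  show "mild \<Sigma> y g t \<in> D" unfolding m by (rule As_add(1)[OF S_D(1)[OF assms(1)] o])
  assume t: "\<bar>t\<bar> \<le> \<tau>"
  have "ennreal (norm (b ?o)) \<le> kernel_integral \<tau> g t"
  proof (cases "0 \<le> t")
    case True
    then show ?thesis using b_Duhamel_le[OF assms(2), of 0 t \<tau> t] t by (auto simp: oriented_integral_def)
  next
    case False
    have "b (- integral {t..0} (\<lambda>r. S (t - r) (g r))) = - b (integral {t..0} (\<lambda>r. S (t - r) (g r)))"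
      using b_scaleR[OF Duhamel_has_integral(2)[OF assms(2)], of "-1" t 0 t] by simp
    then show ?thesis using b_Duhamel_le[OF assms(2), of t 0 \<tau> t] t False by (auto simp: oriented_integral_def)
  qed
  then have 1: "ennreal (norm (b (S t y))) + ennreal (norm (b ?o)) \<le> ennreal (norm (b (S t y))) + kernel_integral \<tau> g t"
    by (rule add_left_mono)
  have "ennreal (norm (b (mild \<Sigma> y g t))) \<le> ennreal (norm (b (S t y)) + norm (b ?o))"
    unfolding m b_add[OF S_D(1)[OF assms(1)] o] by (rule ennreal_leI[OF norm_triangle_ineq])
  then have "ennreal (norm (b (mild \<Sigma> y g t))) \<le> ennreal (norm (b (S t y))) + ennreal (norm (b ?o))"
    unfolding ennreal_plus[OF norm_ge_zero norm_ge_zero] .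
  from order_trans[OF this 1]
  show "ennreal (norm (b (mild \<Sigma> y g t))) \<le> ennreal (norm (b (S t y))) + kernel_integral \<tau> g t" .
qed

lemma mild_diff:
  assumes "g \<in> Ldom" "g' \<in> Ldom"
  shows "mild \<Sigma> (y - y') (\<lambda>r. g r - g' r) t = mild \<Sigma> y g t - mild \<Sigma> y' g' t"
proof -
  show ?thesis
    unfolding mild_def S_def[symmetric] oriented_integral_def S_linear(2)
    using integral_diff[OF Duhamel_has_integral(1)[OF assms(1), where t=t] Duhamel_has_integral(1)[OF assms(2), where t=t]] by auto
qed

lemma Ldom_diff: assumes "g \<in> Ldom" "g' \<in> Ldom" shows "(\<lambda>r. g r - g' r) \<in> Ldom"
proof -
  note g = Ldom[OF assms(1)] and g' = Ldom[OF assms(2)]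
  have e: "emb (g r - g' r) = emb (g r) - emb (g' r)" for r by (rule emb_linear(3)[OF g(1) g'(1)])
  note [measurable] = strongly_measurable_norm[OF g(2)] strongly_measurable_norm[OF g'(2)]
  have fin: "(\<integral>\<^sup>+r\<in>{-\<tau>..\<tau>}. ennreal (norm (emb (g r) - emb (g' r))) \<partial>lborel) < \<infinity>" if "\<tau> > 0" for \<tau>
  proof -
    have "(\<integral>\<^sup>+r\<in>{-\<tau>..\<tau>}. ennreal (norm (emb (g r) - emb (g' r))) \<partial>lborel) \<le>
      (\<integral>\<^sup>+r. ennreal (norm (emb (g r))) * indicator {-\<tau>..\<tau>} r + ennreal (norm (emb (g' r))) * indicator {-\<tau>..\<tau>} r \<partial>lborel)"
      by (intro nn_integral_mono) (auto simp: indicator_def ennreal_plus[symmetric] simp del: ennreal_plus intro!: ennreal_leI norm_triangle_ineq4)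
    also have "\<dots> = (\<integral>\<^sup>+r\<in>{-\<tau>..\<tau>}. ennreal (norm (emb (g r))) \<partial>lborel) + (\<integral>\<^sup>+r\<in>{-\<tau>..\<tau>}. ennreal (norm (emb (g' r))) \<partial>lborel)"
      by (rule nn_integral_add) measurable
    also have "\<dots> < \<infinity>" using g(5)[OF that] g'(5)[OF that] by simp
    finally show ?thesis .
  qed
  have "emb (g r) - emb (g' r) \<in> M" for r
    by (rule Real_Vector_Spaces.subspace_diff[OF subspace_M emb_M[OF g(1)] emb_M[OF g'(1)]])
  then show ?thesis
    unfolding L1loc_domAstar_def Lloc_def mem_Collect_eq e power_one_right
    by (intro conjI allI impI strongly_measurable_diff g(2) g'(2) fin)
qed

text \<open>The majorant \<open>q\<close> is measurable although \<open>f\<close> itself is not known to be; integrals of such majorants can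
  be added.\<close>

definition majorized :: "real \<Rightarrow> (real \<Rightarrow> ('u \<Rightarrow>\<^sub>L 'k)) \<Rightarrow> ennreal \<Rightarrow> bool" where
  "majorized \<tau> f B \<longleftrightarrow> (\<exists>q. q \<in> borel_measurable borel \<and> (\<forall>t\<in>{-\<tau>..\<tau>}. ennreal (norm (f t)) \<le> q t) \<and>
     (\<integral>\<^sup>+t\<in>{-\<tau>..\<tau>}. (q t)\<^sup>2 \<partial>lborel) \<le> B)"

text \<open>The estimate that makes \<open>(y, g) \<mapsto> b (mild y g)\<close> extend to all data.\<close>

lemma mild_estimate:
  assumes \<tau>: "\<tau> > 0"
  obtains c where "0 \<le> c" "\<And>y g. y \<in> D \<Longrightarrow> g \<in> Ldom \<Longrightarrow> majorized \<tau> (\<lambda>t. b (mild \<Sigma> y g t))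
     (ennreal c * (ennreal (norm y) ^ 2 + (\<integral>\<^sup>+r\<in>{-\<tau>..\<tau>}. ennreal (norm (g r)) \<partial>lborel)\<^sup>2))"
proof -
  obtain c1 where c1: "0 \<le> c1" "\<And>x. x \<in> D \<Longrightarrow> energy \<tau> (\<lambda>t. b (S t x)) \<le> ennreal (c1 * (norm x)\<^sup>2)"
    by (rule orbit_energy_bound[OF \<tau>]) (rule that)
  obtain c2 where c2: "0 \<le> c2" "\<And>g. g \<in> Ldom \<Longrightarrow> (\<integral>\<^sup>+t\<in>{-\<tau>..\<tau>}. (kernel_integral \<tau> g t)\<^sup>2 \<partial>lborel)
     \<le> ennreal c2 * (\<integral>\<^sup>+r\<in>{-\<tau>..\<tau>}. ennreal (norm (g r)) \<partial>lborel)\<^sup>2"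
    by (rule kernel_integral_energy[OF \<tau>]) (rule that)
  show thesis
  proof (rule that[of "4 * (c1 + c2)"])
    fix y g assume y: "y \<in> D" and g: "g \<in> Ldom"
    let ?q = "\<lambda>t. ennreal (norm (b (S t y))) + kernel_integral \<tau> g t"
    let ?N = "\<integral>\<^sup>+r\<in>{-\<tau>..\<tau>}. ennreal (norm (g r)) \<partial>lborel"
    note [measurable] = b_S_measurable[OF y] kernel_integral_measurable[OF g]
    have "(\<integral>\<^sup>+t\<in>{-\<tau>..\<tau>}. (?q t)\<^sup>2 \<partial>lborel) \<le> (\<integral>\<^sup>+t. 4 * (ennreal ((norm (b (S t y)))\<^sup>2) * indicator {-\<tau>..\<tau>} t + (kernel_integral \<tau> g t)\<^sup>2 * indicator {-\<tau>..\<tau>} t) \<partial>lborel)"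
      using ennreal_sum_square_le by (intro nn_integral_mono) (auto simp: indicator_def ennreal_power[symmetric])
    also have "\<dots> = 4 * (energy \<tau> (\<lambda>t. b (S t y)) + (\<integral>\<^sup>+t\<in>{-\<tau>..\<tau>}. (kernel_integral \<tau> g t)\<^sup>2 \<partial>lborel))"
      by (subst nn_integral_cmult, measurable, subst nn_integral_add, measurable)
    also have "\<dots> \<le> 4 * (ennreal (c1 * (norm y)\<^sup>2) + ennreal c2 * ?N\<^sup>2)"
      by (intro mult_left_mono add_mono c1(2)[OF y] c2(2)[OF g]) auto
    also have "ennreal (c1 * (norm y)\<^sup>2) = ennreal c1 * ennreal (norm y) ^ 2"
      using c1(1) by (simp add: ennreal_mult ennreal_power)
    also have "4 * (ennreal c1 * ennreal (norm y) ^ 2 + ennreal c2 * ?N\<^sup>2) \<le> 4 * (ennreal (c1 + c2) * ennreal (norm y) ^ 2 + ennreal (c1 + c2) * ?N\<^sup>2)"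
      using c1(1) c2(1) by (intro mult_left_mono add_mono mult_right_mono ennreal_leI) auto
    also have "\<dots> = ennreal (4 * (c1 + c2)) * (ennreal (norm y) ^ 2 + ?N\<^sup>2)"
    proof -
      have "ennreal (4 * (c1 + c2)) = 4 * ennreal (c1 + c2)" using c1(1) c2(1) by (subst ennreal_mult) auto
      then show ?thesis by (simp only: distrib_left mult.assoc)
    qed
    finally have e: "(\<integral>\<^sup>+t\<in>{-\<tau>..\<tau>}. (?q t)\<^sup>2 \<partial>lborel) \<le> ennreal (4 * (c1 + c2)) * (ennreal (norm y) ^ 2 + ?N\<^sup>2)" .
    show "majorized \<tau> (\<lambda>t. b (mild \<Sigma> y g t)) (ennreal (4 * (c1 + c2)) * (ennreal (norm y) ^ 2 + ?N\<^sup>2))"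
      unfolding majorized_def by (rule exI[of _ ?q], intro conjI ballI mild_D(2)[OF y g] e) (measurable, auto)
  qed (use c1(1) c2(1) in simp)
qed

end

section \<open>Extension of the observation along trajectories\<close>

lemma ennreal_square_null:
  fixes x :: "nat \<Rightarrow> ennreal" assumes "x \<longlonglongrightarrow> 0" shows "(\<lambda>n. (x n)\<^sup>2) \<longlonglongrightarrow> 0"
proof (rule tendsto_sandwich[OF _ _ tendsto_const assms])
  have "\<forall>\<^sub>F n in sequentially. x n < 1" by (rule order_tendstoD(2)[OF assms]) simp
  then show "\<forall>\<^sub>F n in sequentially. (x n)\<^sup>2 \<le> x n"
  proof eventually_elim
    case (elim n)
    then have "x n * x n \<le> 1 * x n" by (intro mult_right_mono) auto
    then show ?case by (simp add: power2_eq_square)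
  qed
qed simp

context admissible_system begin

lemma Ldom_I: "(\<And>r. g r \<in> D) \<Longrightarrow> continuous_on UNIV g \<Longrightarrow> continuous_on UNIV (\<lambda>r. As (g r)) \<Longrightarrow> g \<in> Ldom"
proof -
  assume g: "\<And>r. g r \<in> D" "continuous_on UNIV g" "continuous_on UNIV (\<lambda>r. As (g r))"
  have c: "continuous_on UNIV (\<lambda>r. emb (g r))" unfolding embDAstar_def by (intro continuous_intros g)
  have fin: "(\<integral>\<^sup>+r\<in>{-\<tau>..\<tau>}. ennreal (norm (emb (g r))) \<partial>lborel) < \<infinity>" for \<tau>
  proof -
    obtain K where K: "\<And>r. r \<in> {-\<tau>..\<tau>} \<Longrightarrow> norm (emb (g r)) \<le> K" by (rule compact_bounded[OF c]) (rule that)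
    have "(\<integral>\<^sup>+r\<in>{-\<tau>..\<tau>}. ennreal (norm (emb (g r))) \<partial>lborel) \<le> (\<integral>\<^sup>+r. ennreal K * indicator {-\<tau>..\<tau>} r \<partial>lborel)"
      using K by (intro nn_integral_mono) (auto simp: indicator_def intro!: ennreal_leI)
    also have "\<dots> < \<infinity>" by (simp add: nn_integral_cmult_indicator ennreal_mult_less_top emeasure_lborel_Icc_eq)
    finally show ?thesis .
  qed
  show ?thesis unfolding L1loc_domAstar_def Lloc_def mem_Collect_eq power_one_right
    by (intro conjI allI impI strongly_measurable_continuous c fin emb_M g(1))
qed

lemma R_continuous: "continuous_on UNIV g \<Longrightarrow> continuous_on UNIV (\<lambda>r. R m (g r))"
  by (rule bounded_linear.continuous_on[OF R_bounded_linear])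

lemma As_R_continuous:
  assumes "continuous_on UNIV g" "\<And>r. g r \<in> X" shows "continuous_on UNIV (\<lambda>r. As (R m (g r)))"
  unfolding R_D(2)[OF assms(2)] by (intro continuous_on_minus bounded_linear.continuous_on[OF Q_bounded_linear] assms(1))

lemma R_Ldom: assumes "continuous_on UNIV g" "\<And>r. g r \<in> X" shows "(\<lambda>r. R m (g r)) \<in> Ldom"
  by (rule Ldom_I) (intro R_D(1) R_continuous As_R_continuous assms)+

lemma b_R_continuous: assumes "continuous_on UNIV y" "\<And>t. y t \<in> X" shows "continuous_on UNIV (\<lambda>t. b (R m (y t)))"
  by (rule b_continuous) (intro R_D(1) R_continuous As_R_continuous assms)+

lemma R_Lp:
  assumes g: "continuous_on UNIV g" "\<And>r. g r \<in> X" and k: "k > 0"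
  shows "Lloc_tendsto k (\<lambda>m r. R m (g r)) g"
  unfolding Lloc_tendsto_def
proof (intro allI impI)
  fix \<tau> :: real assume "\<tau> > 0"
  obtain K where K: "0 \<le> K" "\<And>m f. norm (R m f) \<le> K * norm f" by (rule R_bound) (rule that)
  obtain B where B: "\<And>r. r \<in> {-\<tau>..\<tau>} \<Longrightarrow> norm (g r) \<le> B" by (rule compact_bounded[OF g(1)]) (rule that)
  have bd: "norm (R m (g r) - g r) \<le> (K + 1) * B" if "r \<in> {-\<tau>..\<tau>}" for m r
  proof -
    have "norm (R m (g r) - g r) \<le> norm (R m (g r)) + norm (g r)" by (rule norm_triangle_ineq4)
    also have "\<dots> \<le> (K + 1) * norm (g r)" using K(2)[of m "g r"] by (simp add: algebra_simps)
    also have "\<dots> \<le> (K + 1) * B" using K(1) by (intro mult_left_mono B that) auto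
    finally show ?thesis .
  qed
  have meas: "(\<lambda>r. ennreal (norm (R m (g r) - g r) ^ k) * indicator {-\<tau>..\<tau>} r) \<in> borel_measurable lborel" for m
  proof -
    have [measurable]: "(\<lambda>r. norm (R m (g r) - g r)) \<in> borel_measurable borel"
      by (intro borel_measurable_continuous_onI continuous_on_norm continuous_on_diff R_continuous g(1))
    show ?thesis by measurable
  qed
  have "(\<lambda>m. \<integral>\<^sup>+r\<in>{-\<tau>..\<tau>}. ennreal (norm (R m (g r) - g r) ^ k) \<partial>lborel) \<longlonglongrightarrow> integral\<^sup>N lborel (\<lambda>r::real. 0)"
  proof (rule nn_integral_dominated_convergence[where w="\<lambda>r. ennreal (((K + 1) * B) ^ k) * indicator {-\<tau>..\<tau>} r"])
    show "(\<integral>\<^sup>+r. ennreal (((K + 1) * B) ^ k) * indicator {-\<tau>..\<tau>} r \<partial>lborel) < \<infinity>"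
      by (simp add: nn_integral_cmult_indicator ennreal_mult_less_top emeasure_lborel_Icc_eq)
    show "AE r in lborel. ennreal (norm (R m (g r) - g r) ^ k) * indicator {-\<tau>..\<tau>} r \<le> ennreal (((K + 1) * B) ^ k) * indicator {-\<tau>..\<tau>} r" for m
      using bd by (intro AE_I2) (auto simp: indicator_def intro!: ennreal_leI power_mono)
    show "AE r in lborel. (\<lambda>m. ennreal (norm (R m (g r) - g r) ^ k) * indicator {-\<tau>..\<tau>} r) \<longlonglongrightarrow> 0"
    proof (intro AE_I2)
      fix r
      have "(\<lambda>m. norm (R m (g r) - g r)) \<longlonglongrightarrow> 0" using R_tendsto[OF g(2)[of r]] by (simp add: LIM_zero tendsto_norm_zero)
      then have "(\<lambda>m. norm (R m (g r) - g r) ^ k) \<longlonglongrightarrow> 0 ^ k" by (rule tendsto_power)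
      then have "(\<lambda>m. ennreal (norm (R m (g r) - g r) ^ k)) \<longlonglongrightarrow> ennreal (0 ^ k)" by (rule tendsto_ennrealI)
      then show "(\<lambda>m. ennreal (norm (R m (g r) - g r) ^ k) * indicator {-\<tau>..\<tau>} r) \<longlonglongrightarrow> 0"
        using k by (cases "r \<in> {-\<tau>..\<tau>}") (auto simp: zero_power)
    qed
  qed (use meas in auto)
  then show "(\<lambda>m. \<integral>\<^sup>+r\<in>{-\<tau>..\<tau>}. ennreal (norm (R m (g r) - g r) ^ k) \<partial>lborel) \<longlonglongrightarrow> 0" by simp
qed

lemmas R_L1 = R_Lp[of _ 1, OF _ _ zero_less_one]

text \<open>Distance of the data \<open>(y, g)\<close> from \<open>(y\<^sub>0, g\<^sub>0)\<close> in the norm for which the extension is continuous.\<close>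

definition defect :: "real \<Rightarrow> ('h \<Rightarrow>\<^sub>L 'k) \<Rightarrow> (real \<Rightarrow> ('h \<Rightarrow>\<^sub>L 'k)) \<Rightarrow> ('h \<Rightarrow>\<^sub>L 'k) \<Rightarrow> (real \<Rightarrow> ('h \<Rightarrow>\<^sub>L 'k)) \<Rightarrow> ennreal" where
  "defect \<tau> y\<^sub>0 g\<^sub>0 y g = ennreal (norm (y - y\<^sub>0)) + (\<integral>\<^sup>+r\<in>{-\<tau>..\<tau>}. ennreal (norm (g r - g\<^sub>0 r)) \<partial>lborel)"

lemma defect_tendsto:
  assumes "ys \<longlonglongrightarrow> y\<^sub>0" "Lloc_tendsto 1 gs g\<^sub>0" "\<tau> > 0"
  shows "(\<lambda>n. defect \<tau> y\<^sub>0 g\<^sub>0 (ys n) (gs n)) \<longlonglongrightarrow> 0"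
proof -
  have "(\<lambda>n. norm (ys n - y\<^sub>0)) \<longlonglongrightarrow> 0" using assms(1) by (simp add: LIM_zero tendsto_norm_zero)
  then have "(\<lambda>n. ennreal (norm (ys n - y\<^sub>0))) \<longlonglongrightarrow> ennreal 0" by (rule tendsto_ennrealI)
  moreover have "(\<lambda>n. \<integral>\<^sup>+r\<in>{-\<tau>..\<tau>}. ennreal (norm (gs n r - g\<^sub>0 r)) \<partial>lborel) \<longlonglongrightarrow> 0"
    using assms(2,3) by (simp add: Lloc_tendsto_def)
  ultimately have "(\<lambda>n. defect \<tau> y\<^sub>0 g\<^sub>0 (ys n) (gs n)) \<longlonglongrightarrow> ennreal 0 + 0" unfolding defect_def by (rule tendsto_add)
  then show ?thesis by simp
qed

lemma two_data_estimate:
  assumes \<tau>: "\<tau> > 0" and g\<^sub>0: "strongly_measurable g\<^sub>0"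
  obtains c where "0 \<le> c" "\<And>y g y' g'. y \<in> D \<Longrightarrow> g \<in> Ldom \<Longrightarrow> y' \<in> D \<Longrightarrow> g' \<in> Ldom \<Longrightarrow>
     majorized \<tau> (\<lambda>t. b (mild \<Sigma> y g t) - b (mild \<Sigma> y' g' t))
       (ennreal c * (defect \<tau> y\<^sub>0 g\<^sub>0 y g + defect \<tau> y\<^sub>0 g\<^sub>0 y' g')\<^sup>2)"
proof -
  obtain c where c: "0 \<le> c" "\<And>y g. y \<in> D \<Longrightarrow> g \<in> Ldom \<Longrightarrow> majorized \<tau> (\<lambda>t. b (mild \<Sigma> y g t))
     (ennreal c * (ennreal (norm y) ^ 2 + (\<integral>\<^sup>+r\<in>{-\<tau>..\<tau>}. ennreal (norm (g r)) \<partial>lborel)\<^sup>2))"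
    by (rule mild_estimate[OF \<tau>]) (rule that)
  show thesis
  proof (rule that[OF c(1)])
    fix y g y' g' assume y: "y \<in> D" and g: "g \<in> Ldom" and y': "y' \<in> D" and g': "g' \<in> Ldom"
    let ?a = "ennreal (norm (y - y'))" and ?I = "\<integral>\<^sup>+r\<in>{-\<tau>..\<tau>}. ennreal (norm (g r - g' r)) \<partial>lborel"
    let ?d = "defect \<tau> y\<^sub>0 g\<^sub>0 y g + defect \<tau> y\<^sub>0 g\<^sub>0 y' g'"
    obtain q where q: "q \<in> borel_measurable borel"
      "\<And>t. t \<in> {-\<tau>..\<tau>} \<Longrightarrow> ennreal (norm (b (mild \<Sigma> (y - y') (\<lambda>r. g r - g' r) t))) \<le> q t"
      "(\<integral>\<^sup>+t\<in>{-\<tau>..\<tau>}. (q t)\<^sup>2 \<partial>lborel) \<le> ennreal c * (?a\<^sup>2 + ?I\<^sup>2)"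
      using c(2)[OF As_diff(1)[OF y y'] Ldom_diff[OF g g'], unfolded majorized_def] by (elim exE conjE) (rule that, assumption, erule bspec)
    have bm: "b (mild \<Sigma> (y - y') (\<lambda>r. g r - g' r) t) = b (mild \<Sigma> y g t) - b (mild \<Sigma> y' g' t)" for t
      unfolding mild_diff[OF g g'] by (rule b_diff[OF mild_D(1)[OF y g] mild_D(1)[OF y' g']])
    note [measurable] = strongly_measurable_norm[OF strongly_measurable_diff[OF Ldom(3)[OF g] g\<^sub>0]]
       strongly_measurable_norm[OF strongly_measurable_diff[OF Ldom(3)[OF g'] g\<^sub>0]]
    have tri: "norm (u - v) \<le> norm (u - w) + norm (v - w)" for u v w :: "'h \<Rightarrow>\<^sub>L 'k"
      using norm_triangle_ineq4[of "u - w" "v - w"] by simp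
    have a: "?a \<le> ennreal (norm (y - y\<^sub>0)) + ennreal (norm (y' - y\<^sub>0))"
      unfolding ennreal_plus[OF norm_ge_zero norm_ge_zero, symmetric] by (rule ennreal_leI[OF tri])
    have "?I \<le> (\<integral>\<^sup>+r. ennreal (norm (g r - g\<^sub>0 r)) * indicator {-\<tau>..\<tau>} r + ennreal (norm (g' r - g\<^sub>0 r)) * indicator {-\<tau>..\<tau>} r \<partial>lborel)"
      by (intro nn_integral_mono) (auto simp: indicator_def ennreal_plus[symmetric] simp del: ennreal_plus intro!: ennreal_leI tri)
    also have "\<dots> = (\<integral>\<^sup>+r\<in>{-\<tau>..\<tau>}. ennreal (norm (g r - g\<^sub>0 r)) \<partial>lborel) + (\<integral>\<^sup>+r\<in>{-\<tau>..\<tau>}. ennreal (norm (g' r - g\<^sub>0 r)) \<partial>lborel)"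
      by (rule nn_integral_add) measurable
    finally have "?a + ?I \<le> (ennreal (norm (y - y\<^sub>0)) + ennreal (norm (y' - y\<^sub>0))) + \<dots>" by (rule add_mono[OF a])
    also have "\<dots> = ?d" unfolding defect_def by (simp add: add_ac)
    finally have "?a + ?I \<le> ?d" .
    then have "(?a + ?I)\<^sup>2 \<le> ?d\<^sup>2" by (intro power_mono) auto
    moreover have "?a\<^sup>2 + ?I\<^sup>2 \<le> (?a + ?I)\<^sup>2"
    proof -
      have "(?a + ?I)\<^sup>2 = (?a\<^sup>2 + ?I\<^sup>2) + 2 * ?a * ?I" by (simp add: power2_eq_square distrib_left distrib_right mult_2 add_ac mult_ac)
      then show ?thesis by simp
    qed
    ultimately have "?a\<^sup>2 + ?I\<^sup>2 \<le> ?d\<^sup>2" by (rule order_trans[rotated])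
    then have "ennreal c * (?a\<^sup>2 + ?I\<^sup>2) \<le> ennreal c * ?d\<^sup>2" by (intro mult_left_mono) auto
    from order_trans[OF q(3) this] q(1) q(2)[unfolded bm]
    show "majorized \<tau> (\<lambda>t. b (mild \<Sigma> y g t) - b (mild \<Sigma> y' g' t)) (ennreal c * ?d\<^sup>2)"
      unfolding majorized_def by (intro exI[of _ q] conjI ballI)
  qed
qed

text \<open>The trajectory \<open>y\<close> belongs to the data \<open>(y\<^sub>0, g)\<close> in the sense that smoothing of the data smooths the
  trajectory. This holds for free orbits (\<open>smoothable_free\<close>) and for the closed loop (\<open>smoothable_V\<close>),
  and it provides regular data that tend to \<open>(y\<^sub>0, g)\<close> together with explicit, continuous observations.\<close>

definition smoothable :: "('h \<Rightarrow>\<^sub>L 'k) \<Rightarrow> (real \<Rightarrow> ('h \<Rightarrow>\<^sub>L 'k)) \<Rightarrow> (real \<Rightarrow> ('h \<Rightarrow>\<^sub>L 'k)) \<Rightarrow> bool" where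
  "smoothable y\<^sub>0 g y \<longleftrightarrow> y\<^sub>0 \<in> X \<and> continuous_on UNIV g \<and> (\<forall>r. g r \<in> X) \<and> continuous_on UNIV y \<and> (\<forall>t. y t \<in> X) \<and>
     (\<forall>m t. R m (y t) = mild \<Sigma> (R m y\<^sub>0) (\<lambda>r. R m (g r)) t)"

lemma energy_le_square:
  assumes "\<And>t. t \<in> {-\<tau>..\<tau>} \<Longrightarrow> ennreal (norm (f t)) \<le> q t"
  shows "energy \<tau> f \<le> (\<integral>\<^sup>+t\<in>{-\<tau>..\<tau>}. (q t)\<^sup>2 \<partial>lborel)"
proof (rule nn_integral_mono)
  fix t
  show "ennreal ((norm (f t))\<^sup>2) * indicator {-\<tau>..\<tau>} t \<le> (q t)\<^sup>2 * indicator {-\<tau>..\<tau>} t"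
  proof (cases "t \<in> {-\<tau>..\<tau>}")
    case True
    have "(ennreal (norm (f t)))\<^sup>2 \<le> (q t)\<^sup>2" by (intro power_mono assms True) auto
    then show ?thesis using True by (simp add: ennreal_power)
  qed simp
qed

text \<open>The observations of the smoothed trajectories form a Cauchy sequence by the a priori estimate. Their
  limit is the limit along every other regular sequence as well, since the estimate applies to the
  difference of two regular data.\<close>

lemma Bstar_ext_exists:
  assumes sm: "smoothable y\<^sub>0 g y" shows "\<exists>z. is_Bstar_ext \<Sigma> y\<^sub>0 g z"
proof -
  have y0: "y\<^sub>0 \<in> X" and g: "continuous_on UNIV g" "\<And>r. g r \<in> X" and y: "continuous_on UNIV y" "\<And>t. y t \<in> X"
    and Ry: "\<And>m t. R m (y t) = mild \<Sigma> (R m y\<^sub>0) (\<lambda>r. R m (g r)) t"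
    using sm unfolding smoothable_def by blast+
  define f where "f m t = b (R m (y t))" for m t
  have f: "f m \<in> Lloc 2 Y" for m
    unfolding f_def by (intro continuous_Lloc2 b_R_continuous y b_Y R_D(1))
  have fm: "f m t = b (mild \<Sigma> (R m y\<^sub>0) (\<lambda>r. R m (g r)) t)" for m t by (simp add: f_def Ry)
  have smg: "strongly_measurable g" by (rule strongly_measurable_continuous[OF g(1)])
  have RD: "R m y\<^sub>0 \<in> D" for m by (rule R_D(1)[OF y0])
  have RL: "(\<lambda>r. R m (g r)) \<in> Ldom" for m by (rule R_Ldom[OF g])
  define d where "d \<tau> m = defect \<tau> y\<^sub>0 g (R m y\<^sub>0) (\<lambda>r. R m (g r))" for \<tau> m
  have d0: "(\<lambda>m. d \<tau> m) \<longlonglongrightarrow> 0" if "\<tau> > 0" for \<tau>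
    unfolding d_def by (rule defect_tendsto[OF R_tendsto[OF y0] R_L1[OF g] that])
  obtain z where z: "z \<in> Lloc 2 Y" "Lloc_tendsto 2 f z"
  proof (rule Lloc2_complete[OF U.closed_antidual U.antidual_zero f])
    fix \<tau> e :: real assume \<tau>: "\<tau> > 0" and e: "e > 0"
    obtain c where c: "0 \<le> c" "\<And>y g' y' g''. y \<in> D \<Longrightarrow> g' \<in> Ldom \<Longrightarrow> y' \<in> D \<Longrightarrow> g'' \<in> Ldom \<Longrightarrow>
       majorized \<tau> (\<lambda>t. b (mild \<Sigma> y g' t) - b (mild \<Sigma> y' g'' t))
         (ennreal c * (defect \<tau> y\<^sub>0 g y g' + defect \<tau> y\<^sub>0 g y' g'')\<^sup>2)"
      by (rule two_data_estimate[OF \<tau> smg]) (rule that)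
    \<comment> \<open>Chosen so that \<open>c * (2 * \<epsilon>)\<^sup>2 \<le> e\<close>.\<close>
    define \<epsilon> where "\<epsilon> = sqrt (e / (4 * (c + 1)))"
    have \<epsilon>: "\<epsilon> > 0" "c * (\<epsilon> + \<epsilon>)\<^sup>2 \<le> e"
    proof -
      show "\<epsilon> > 0" using e c(1) by (simp add: \<epsilon>_def)
      have "\<epsilon>\<^sup>2 = e / (4 * (c + 1))" using e c(1) by (simp add: \<epsilon>_def)
      moreover have "(\<epsilon> + \<epsilon>)\<^sup>2 = 4 * \<epsilon>\<^sup>2" by (simp add: power2_eq_square)
      ultimately have "c * (\<epsilon> + \<epsilon>)\<^sup>2 = c * (e / (c + 1))" using c(1) by (simp add: field_simps)
      also have "\<dots> \<le> e" using e c(1) by (simp add: field_simps)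
      finally show "c * (\<epsilon> + \<epsilon>)\<^sup>2 \<le> e" .
    qed
    have "\<forall>\<^sub>F m in sequentially. d \<tau> m < ennreal \<epsilon>" by (rule order_tendstoD(2)[OF d0[OF \<tau>]]) (use \<epsilon> in simp)
    then obtain N where N: "\<And>m. m \<ge> N \<Longrightarrow> d \<tau> m < ennreal \<epsilon>" unfolding eventually_sequentially by (elim exE) (rule that, blast)
    have "energy \<tau> (\<lambda>t. f m t - f n t) \<le> ennreal e" if "m \<ge> N" "n \<ge> N" for m n
    proof -
      obtain q where q: "\<And>t. t \<in> {-\<tau>..\<tau>} \<Longrightarrow> ennreal (norm (f m t - f n t)) \<le> q t"
        "(\<integral>\<^sup>+t\<in>{-\<tau>..\<tau>}. (q t)\<^sup>2 \<partial>lborel) \<le> ennreal c * (d \<tau> m + d \<tau> n)\<^sup>2"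
        using c(2)[OF RD RL RD RL, of m m n n] unfolding fm[symmetric] d_def[symmetric] majorized_def by (elim exE conjE) (rule that, erule bspec)
      have "energy \<tau> (\<lambda>t. f m t - f n t) \<le> ennreal c * (d \<tau> m + d \<tau> n)\<^sup>2"
        by (rule order_trans[OF energy_le_square[OF q(1)] q(2)])
      also have "\<dots> \<le> ennreal c * (ennreal \<epsilon> + ennreal \<epsilon>)\<^sup>2"
        by (intro mult_left_mono power_mono add_mono less_imp_le[OF N] that) auto
      also have "\<dots> = ennreal (c * (\<epsilon> + \<epsilon>)\<^sup>2)"
        using c(1) \<epsilon>(1) by (simp add: ennreal_mult ennreal_power ennreal_plus[symmetric] del: ennreal_plus)
      also have "\<dots> \<le> ennreal e" by (rule ennreal_leI[OF \<epsilon>(2)])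
      finally show ?thesis .
    qed
    then show "\<exists>N. \<forall>m\<ge>N. \<forall>n\<ge>N. energy \<tau> (\<lambda>t. f m t - f n t) \<le> ennreal e" by blast
  qed (rule that)
  have "is_Bstar_ext \<Sigma> y\<^sub>0 g z"
    unfolding is_Bstar_ext_def Lloc_tendsto2_iff
  proof (intro conjI allI impI z(1))
    fix ys gs and \<tau> :: real
    assume as: "(\<forall>n. ys n \<in> D) \<and> (\<forall>n. gs n \<in> Ldom) \<and> ys \<longlonglongrightarrow> y\<^sub>0 \<and> Lloc_tendsto 1 gs g" and \<tau>: "\<tau> > 0"
    have ys: "ys n \<in> D" and gs: "gs n \<in> Ldom" for n using as by auto
    have ds: "(\<lambda>n. defect \<tau> y\<^sub>0 g (ys n) (gs n)) \<longlonglongrightarrow> 0" by (rule defect_tendsto) (use as \<tau> in auto)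
    obtain c where c: "0 \<le> c" "\<And>y g' y' g''. y \<in> D \<Longrightarrow> g' \<in> Ldom \<Longrightarrow> y' \<in> D \<Longrightarrow> g'' \<in> Ldom \<Longrightarrow>
       majorized \<tau> (\<lambda>t. b (mild \<Sigma> y g' t) - b (mild \<Sigma> y' g'' t))
         (ennreal c * (defect \<tau> y\<^sub>0 g y g' + defect \<tau> y\<^sub>0 g y' g'')\<^sup>2)"
      by (rule two_data_estimate[OF \<tau> smg]) (rule that)
    let ?r = "\<lambda>n. 4 * (ennreal c * (defect \<tau> y\<^sub>0 g (ys n) (gs n) + d \<tau> n)\<^sup>2 + energy \<tau> (\<lambda>t. f n t - z t))"
    have le: "energy \<tau> (\<lambda>t. b (mild \<Sigma> (ys n) (gs n) t) - z t) \<le> ?r n" for n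
    proof -
      obtain q where q: "q \<in> borel_measurable borel" "\<And>t. t \<in> {-\<tau>..\<tau>} \<Longrightarrow> ennreal (norm (b (mild \<Sigma> (ys n) (gs n) t) - f n t)) \<le> q t"
        "(\<integral>\<^sup>+t\<in>{-\<tau>..\<tau>}. (q t)\<^sup>2 \<partial>lborel) \<le> ennreal c * (defect \<tau> y\<^sub>0 g (ys n) (gs n) + d \<tau> n)\<^sup>2"
        using c(2)[OF ys gs RD RL, of n n n n] unfolding fm[symmetric] d_def[symmetric] majorized_def by (elim exE conjE) (rule that, assumption, erule bspec)
      have smd: "strongly_measurable (\<lambda>t. f n t - z t)"
        using f[of n] z(1) by (intro strongly_measurable_diff) (auto simp: Lloc2_iff)
      note [measurable] = q(1) strongly_measurable_norm[OF smd]
      have "energy \<tau> (\<lambda>t. b (mild \<Sigma> (ys n) (gs n) t) - z t) \<le> (\<integral>\<^sup>+t\<in>{-\<tau>..\<tau>}. (q t + ennreal (norm (f n t - z t)))\<^sup>2 \<partial>lborel)"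
      proof (rule energy_le_square)
        fix t assume t: "t \<in> {-\<tau>..\<tau>}"
        have "norm (b (mild \<Sigma> (ys n) (gs n) t) - z t) \<le> norm (b (mild \<Sigma> (ys n) (gs n) t) - f n t) + norm (f n t - z t)"
          using norm_triangle_ineq[of "b (mild \<Sigma> (ys n) (gs n) t) - f n t" "f n t - z t"] by simp
        from ennreal_leI[OF this]
        have "ennreal (norm (b (mild \<Sigma> (ys n) (gs n) t) - z t)) \<le> ennreal (norm (b (mild \<Sigma> (ys n) (gs n) t) - f n t)) + ennreal (norm (f n t - z t))"
          unfolding ennreal_plus[OF norm_ge_zero norm_ge_zero] .
        also have "\<dots> \<le> q t + ennreal (norm (f n t - z t))" by (intro add_right_mono q(2) t)
        finally show "ennreal (norm (b (mild \<Sigma> (ys n) (gs n) t) - z t)) \<le> q t + ennreal (norm (f n t - z t))" .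
      qed
      also have "\<dots> \<le> (\<integral>\<^sup>+t. 4 * ((q t)\<^sup>2 * indicator {-\<tau>..\<tau>} t + ennreal ((norm (f n t - z t))\<^sup>2) * indicator {-\<tau>..\<tau>} t) \<partial>lborel)"
        using ennreal_sum_square_le by (intro nn_integral_mono) (auto simp: indicator_def ennreal_power[symmetric])
      also have "\<dots> = 4 * ((\<integral>\<^sup>+t\<in>{-\<tau>..\<tau>}. (q t)\<^sup>2 \<partial>lborel) + energy \<tau> (\<lambda>t. f n t - z t))"
        by (subst nn_integral_cmult, measurable, subst nn_integral_add, measurable)
      also have "\<dots> \<le> ?r n" by (intro mult_left_mono add_right_mono q(3)) auto
      finally show ?thesis .
    qed
    have "(\<lambda>n. defect \<tau> y\<^sub>0 g (ys n) (gs n) + d \<tau> n) \<longlonglongrightarrow> 0 + 0" by (rule tendsto_add[OF ds d0[OF \<tau>]])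
    then have "(\<lambda>n. (defect \<tau> y\<^sub>0 g (ys n) (gs n) + d \<tau> n)\<^sup>2) \<longlonglongrightarrow> 0" by (intro ennreal_square_null) simp
    then have "?r \<longlonglongrightarrow> 4 * (ennreal c * 0 + 0)"
      using z(2) \<tau> by (intro ennreal_tendsto_cmult tendsto_add) (auto simp: Lloc_tendsto2_iff)
    then have "?r \<longlonglongrightarrow> 0" by simp
    from tendsto_sandwich[OF _ _ tendsto_const this] le
    show "(\<lambda>n. energy \<tau> (\<lambda>t. b (mild \<Sigma> (ys n) (gs n) t) - z t)) \<longlonglongrightarrow> 0" by simp
  qed
  then show ?thesis by (rule exI[where x=z])
qed

lemma Bstar_ext_limit:
  assumes sm: "smoothable y\<^sub>0 g y"
  shows "is_Bstar_ext \<Sigma> y\<^sub>0 g (Bstar_ext \<Sigma> y\<^sub>0 g)" "Bstar_ext \<Sigma> y\<^sub>0 g \<in> Lloc 2 Y"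
    "Lloc_tendsto 2 (\<lambda>m t. b (R m (y t))) (Bstar_ext \<Sigma> y\<^sub>0 g)" "\<And>m. (\<lambda>t. b (R m (y t))) \<in> Lloc 2 Y"
proof -
  have y0: "y\<^sub>0 \<in> X" and g: "continuous_on UNIV g" "\<And>r. g r \<in> X" and y: "continuous_on UNIV y" "\<And>t. y t \<in> X"
    and Ry: "\<And>m t. R m (y t) = mild \<Sigma> (R m y\<^sub>0) (\<lambda>r. R m (g r)) t"
    using sm unfolding smoothable_def by blast+
  show 1: "is_Bstar_ext \<Sigma> y\<^sub>0 g (Bstar_ext \<Sigma> y\<^sub>0 g)"
    unfolding Bstar_ext_def by (rule someI_ex[OF Bstar_ext_exists[OF sm]])
  then show "Bstar_ext \<Sigma> y\<^sub>0 g \<in> Lloc 2 Y" by (simp add: is_Bstar_ext_def)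
  show "(\<lambda>t. b (R m (y t))) \<in> Lloc 2 Y" for m
    by (intro continuous_Lloc2 b_R_continuous y b_Y R_D(1))
  show "Lloc_tendsto 2 (\<lambda>m t. b (R m (y t))) (Bstar_ext \<Sigma> y\<^sub>0 g)"
    unfolding Ry using 1[unfolded is_Bstar_ext_def, THEN conjunct2, rule_format, of "\<lambda>m. R m y\<^sub>0" "\<lambda>m r. R m (g r)"]
      R_D(1)[OF y0] R_Ldom[OF g] R_tendsto[OF y0] R_L1[OF g] by blast
qed

lemma mild_zero: "mild \<Sigma> x (\<lambda>_. 0) t = S t x"
  unfolding mild_def S_def[symmetric]
  by (simp add: oriented_integral_def S_linear(4))

lemma smoothable_free: "x \<in> X \<Longrightarrow> smoothable x (\<lambda>_. 0) (\<lambda>t. S t x)"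
  unfolding smoothable_def
  using H.antidual_zero S_continuous S_X
  by (auto simp: mild_zero R_S R_linear(4))

abbreviation "free \<equiv> Bstar_free \<Sigma>"

lemma free_Lloc: "x \<in> X \<Longrightarrow> free x \<in> Lloc 2 Y"
  unfolding Bstar_free_def by (rule Bstar_ext_limit(2)[OF smoothable_free])

lemma free_limit: "x \<in> X \<Longrightarrow> Lloc_tendsto 2 (\<lambda>m t. b (S t (R m x))) (free x)"
  unfolding Bstar_free_def using Bstar_ext_limit(3)[OF smoothable_free] by (simp add: R_S)

lemma bS_Lloc: "x \<in> D \<Longrightarrow> (\<lambda>t. b (S t x)) \<in> Lloc 2 Y"
  by (intro continuous_Lloc2 b_S_continuous b_Y S_D(1))

text \<open>Constant sequences of data are admissible in the definition of the extension.\<close>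

lemma free_on_D: assumes x: "x \<in> D" shows "Lloc_tendsto 2 (\<lambda>_ t. b (S t x)) (free x)"
proof -
  have "Lloc_tendsto 1 (\<lambda>_ _. 0) (\<lambda>_. 0 :: 'h \<Rightarrow>\<^sub>L 'k)" by (simp add: Lloc_tendsto_def)
  moreover have "(\<lambda>_. 0) \<in> Ldom" by (rule Ldom_I) (auto simp: D_0)
  moreover have "is_Bstar_ext \<Sigma> x (\<lambda>_. 0) (free x)"
    unfolding Bstar_free_def by (rule Bstar_ext_limit(1)[OF smoothable_free[OF As(1)[OF x]]])
  ultimately show ?thesis
    unfolding is_Bstar_ext_def using x by (auto simp: mild_zero dest!: spec[of _ "\<lambda>_. x"] spec[of _ "\<lambda>_ _. 0"])
qed

section \<open>Weighted observation forms\<close>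

sublocale pairingY: bounded_pairing Y U.dip
proof
  show "Real_Vector_Spaces.subspace Y" by (rule U.subspace_antidual)
qed (simp_all add: U.dip_add_left U.dip_add_right U.dip_bound)

text \<open>The Gramian and \<open>L\<close> are forms of this kind, with the weight and with minus its derivative. Everything is
  computed for \<open>formD\<close> on $D(A^*)$, where the integrand is continuous, and carried over by \<open>form_limit\<close>.
  Thus the representatives chosen by \<open>Bstar_free\<close> never have to be compared for different arguments.\<close>

definition form :: "(real \<Rightarrow> real) \<Rightarrow> real \<Rightarrow> ('h \<Rightarrow>\<^sub>L 'k) \<Rightarrow> ('h \<Rightarrow>\<^sub>L 'k) \<Rightarrow> 'k" where
  "form w a x y = (LBINT s:{0..a}. w s *\<^sub>R U.dip (free x s) (free y s))"

definition formD :: "(real \<Rightarrow> real) \<Rightarrow> real \<Rightarrow> ('h \<Rightarrow>\<^sub>L 'k) \<Rightarrow> ('h \<Rightarrow>\<^sub>L 'k) \<Rightarrow> 'k" where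
  "formD w a x y = (LBINT s:{0..a}. w s *\<^sub>R U.dip (b (S s x)) (b (S s y)))"

context
  fixes w :: "real \<Rightarrow> real" and a :: real
  assumes w: "continuous_on UNIV w" and a: "a > 0"
begin

lemma w_facts: obtains K where "w \<in> borel_measurable borel" "\<And>t. t \<in> {0..a} \<Longrightarrow> \<bar>w t\<bar> \<le> K" "0 \<le> K"
proof -
  obtain K where K: "\<And>t. t \<in> {0..a} \<Longrightarrow> norm (w t) \<le> K" by (rule compact_bounded[OF w]) (rule that)
  have "0 \<le> K" using K[of 0] a norm_ge_zero[of "w 0"] by simp
  moreover have "w \<in> borel_measurable borel" by (rule borel_measurable_continuous_onI[OF w])
  ultimately show thesis using that[of K] K by simp
qed

lemma form_integral_limit:
  assumes "f \<in> Lloc 2 Y" "\<And>n. fs n \<in> Lloc 2 Y" "Lloc_tendsto 2 fs f"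
    and "g \<in> Lloc 2 Y" "\<And>n. gs n \<in> Lloc 2 Y" "Lloc_tendsto 2 gs g"
  shows "set_integrable lborel {0..a} (\<lambda>t. w t *\<^sub>R U.dip (f t) (g t))"
    "(\<lambda>n. LBINT t:{0..a}. w t *\<^sub>R U.dip (fs n t) (gs n t)) \<longlonglongrightarrow> (LBINT t:{0..a}. w t *\<^sub>R U.dip (f t) (g t))"
proof -
  obtain K where K: "w \<in> borel_measurable borel" "\<And>t. t \<in> {0..a} \<Longrightarrow> \<bar>w t\<bar> \<le> K" "0 \<le> K" by (rule w_facts) (rule that)
  have A: "{0..a} \<in> sets borel" "{0..a} \<subseteq> {-a..a}" using a by auto
  note lim = pairingY.weighted_integral_tendsto[OF assms A a K(1,2)]
  show "set_integrable lborel {0..a} (\<lambda>t. w t *\<^sub>R U.dip (f t) (g t))" by (rule lim(1))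
  show "(\<lambda>n. LBINT t:{0..a}. w t *\<^sub>R U.dip (fs n t) (gs n t)) \<longlonglongrightarrow> (LBINT t:{0..a}. w t *\<^sub>R U.dip (f t) (g t))" by (rule lim(2))
qed

lemma form_on_D: assumes "x \<in> D" "y \<in> D" shows "form w a x y = formD w a x y"
proof -
  have "(\<lambda>n::nat. formD w a x y) \<longlonglongrightarrow> form w a x y"
    unfolding form_def formD_def
    by (rule form_integral_limit(2)) (intro free_Lloc As(1) assms bS_Lloc free_on_D)+
  then show ?thesis by (simp add: LIMSEQ_const_iff)
qed

lemma form_limit: assumes "x \<in> X" "y \<in> X" shows "(\<lambda>m. formD w a (R m x) (R m y)) \<longlonglongrightarrow> form w a x y"
  unfolding form_def formD_def
  by (rule form_integral_limit(2)) (intro free_Lloc assms bS_Lloc free_limit R_D(1))+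

lemma formD_integrable: assumes "x \<in> D" "y \<in> D" shows "set_integrable lborel {0..a} (\<lambda>s. w s *\<^sub>R U.dip (b (S s x)) (b (S s y)))"
  by (rule form_integral_limit(1)[where fs="\<lambda>_ s. b (S s x)" and gs="\<lambda>_ s. b (S s y)"])
    (auto simp: bS_Lloc assms Lloc_tendsto_def)

lemma formD_add_left: assumes "x \<in> D" "y \<in> D" "z \<in> D" shows "formD w a (x + y) z = formD w a x z + formD w a y z"
proof -
  have "U.dip (b (S s (x + y))) (b (S s z)) = U.dip (b (S s x)) (b (S s z)) + U.dip (b (S s y)) (b (S s z))" for s
    by (simp add: S_linear b_add S_D(1) assms U.dip_add_left b_Y)
  then show ?thesis unfolding formD_def
    by (simp add: scaleR_add_right set_integral_add(2)[OF formD_integrable formD_integrable] assms)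
qed

lemma formD_scale_left: assumes "x \<in> D" "z \<in> D" shows "formD w a (scale_dual c x) z = c * formD w a x z"
proof -
  have "U.dip (b (S s (scale_dual c x))) (b (S s z)) = c * U.dip (b (S s x)) (b (S s z))" for s
    by (simp add: S_scale b_scale S_D(1) assms U.dip_scale_left b_Y)
  then show ?thesis unfolding formD_def by (simp flip: mult_scaleR_right)
qed

lemma formD_commute: assumes "x \<in> D" "y \<in> D" shows "formD w a y x = sconj (formD w a x y)"
proof -
  have e: "indicat_real {0..a} s *\<^sub>R (w s *\<^sub>R U.dip (b (S s y)) (b (S s x))) = sconj (indicat_real {0..a} s *\<^sub>R (w s *\<^sub>R U.dip (b (S s x)) (b (S s y))))" for s
    using U.dip_commute[OF b_Y[OF S_D(1)[OF assms(1)]] b_Y[OF S_D(1)[OF assms(2)]], of s s] by simp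
  show ?thesis unfolding formD_def set_lebesgue_integral_def e
    by (rule integral_bounded_linear[OF bounded_linear_sconj])
      (use formD_integrable[OF assms] in \<open>simp add: set_integrable_def\<close>)
qed

lemma formD_self: assumes "x \<in> D" shows "formD w a x x \<bullet> 1 = (LBINT s:{0..a}. w s * (norm (b (S s x)))\<^sup>2)"
proof -
  have e: "indicat_real {0..a} s *\<^sub>R (w s * (norm (b (S s x)))\<^sup>2) = (indicat_real {0..a} s *\<^sub>R (w s *\<^sub>R U.dip (b (S s x)) (b (S s x)))) \<bullet> 1" for s
    by (simp add: U.dip_self[OF b_Y[OF S_D(1)[OF assms]]] of_real_def inner_one_one del: of_real_power)
  show ?thesis unfolding formD_def set_lebesgue_integral_def e
    by (rule integral_inner_left[symmetric]) (use formD_integrable[OF assms assms] in \<open>simp add: set_integrable_def\<close>)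
qed

text \<open>The inequality \<open>a * b \<le> a\<^sup>2 + b\<^sup>2\<close> gives the bound for unit vectors, from which homogeneity gives the bilinear
  one.\<close>

lemma formD_bound: obtains K where "0 \<le> K" "\<And>x y. x \<in> D \<Longrightarrow> y \<in> D \<Longrightarrow> norm (formD w a x y) \<le> K * norm x * norm y"
proof -
  obtain k where k: "w \<in> borel_measurable borel" "\<And>t. t \<in> {0..a} \<Longrightarrow> \<bar>w t\<bar> \<le> k" "0 \<le> k" by (rule w_facts) (rule that)
  obtain c where c: "0 \<le> c" "\<And>x. x \<in> D \<Longrightarrow> energy a (\<lambda>t. b (S t x)) \<le> ennreal (c * (norm x)\<^sup>2)"
    by (rule orbit_energy_bound[OF a]) (rule that)
  have unit: "norm (formD w a x y) \<le> 2 * k * c" if x: "x \<in> D" "norm x = 1" and y: "y \<in> D" "norm y = 1" for x y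
  proof -
    note [measurable] = b_S_measurable[OF x(1)] b_S_measurable[OF y(1)]
    have "ennreal (norm (formD w a x y)) \<le> (\<integral>\<^sup>+s. ennreal (norm (indicat_real {0..a} s *\<^sub>R (w s *\<^sub>R U.dip (b (S s x)) (b (S s y))))) \<partial>lborel)"
      unfolding formD_def set_lebesgue_integral_def by (rule integral_norm_bound_ennreal)
        (use formD_integrable[OF x(1) y(1)] in \<open>simp add: set_integrable_def\<close>)
    also have "\<dots> \<le> (\<integral>\<^sup>+s. ennreal k * (ennreal ((norm (b (S s x)))\<^sup>2) * indicator {-a..a} s + ennreal ((norm (b (S s y)))\<^sup>2) * indicator {-a..a} s) \<partial>lborel)"
    proof (rule nn_integral_mono)
      fix s
      show "ennreal (norm (indicat_real {0..a} s *\<^sub>R (w s *\<^sub>R U.dip (b (S s x)) (b (S s y))))) \<le>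
         ennreal k * (ennreal ((norm (b (S s x)))\<^sup>2) * indicator {-a..a} s + ennreal ((norm (b (S s y)))\<^sup>2) * indicator {-a..a} s)"
      proof (cases "s \<in> {0..a}")
        case True
        have "norm (U.dip (b (S s x)) (b (S s y))) \<le> norm (b (S s x)) * norm (b (S s y))"
          by (intro U.dip_bound b_Y S_D(1) x y)
        also have "\<dots> \<le> (norm (b (S s x)))\<^sup>2 + (norm (b (S s y)))\<^sup>2"
          using sum_squares_bound[of "norm (b (S s x))" "norm (b (S s y))"]
            mult_nonneg_nonneg[OF norm_ge_zero[of "b (S s x)"] norm_ge_zero[of "b (S s y)"]] by linarith
        finally have "\<bar>w s\<bar> * norm (U.dip (b (S s x)) (b (S s y))) \<le> k * ((norm (b (S s x)))\<^sup>2 + (norm (b (S s y)))\<^sup>2)"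
          using k(2)[OF True] k(3) by (intro mult_mono) auto
        from ennreal_leI[OF this] show ?thesis using True k(3) by (simp add: ennreal_mult ennreal_plus)
      qed simp
    qed
    also have "\<dots> = ennreal k * (energy a (\<lambda>s. b (S s x)) + energy a (\<lambda>s. b (S s y)))"
      by (subst nn_integral_cmult, measurable, subst nn_integral_add, measurable)
    also have "\<dots> \<le> ennreal k * (ennreal (c * (norm x)\<^sup>2) + ennreal (c * (norm y)\<^sup>2))"
      by (intro mult_left_mono add_mono c x y) auto
    also have "\<dots> = ennreal (2 * k * c)" using x y k c by (simp add: ennreal_plus[symmetric] ennreal_mult[symmetric] del: ennreal_plus)
    finally show ?thesis using k c by simp
  qed
  have sc: "formD w a (r *\<^sub>R x) y = r *\<^sub>R formD w a x y" if "x \<in> D" "y \<in> D" for r x y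
    using formD_scale_left[OF that, of "of_real r"] by (simp add: scale_dual_of_real scaleR_conv_of_real)
  have scr: "formD w a x (r *\<^sub>R y) = r *\<^sub>R formD w a x y" if "x \<in> D" "y \<in> D" for r x y
    using formD_commute[OF As_scaleR(1)[OF that(2)] that(1), of r] formD_commute[OF that(2,1)] sc[OF that(2,1), of r] by simp
  have "norm (formD w a x y) \<le> 2 * k * c * norm x * norm y" if x: "x \<in> D" and y: "y \<in> D" for x y
  proof (cases "x = 0 \<or> y = 0")
    case True
    then show ?thesis using sc[OF x y, of 0] scr[OF x y, of 0] by auto
  next
    case False
    let ?x = "x /\<^sub>R norm x" and ?y = "y /\<^sub>R norm y"
    have "norm (formD w a ?x ?y) \<le> 2 * k * c" by (rule unit) (use False in \<open>auto simp: As_scaleR(1) x y\<close>)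
    moreover have "formD w a ?x ?y = (inverse (norm x) * inverse (norm y)) *\<^sub>R formD w a x y"
      by (simp add: sc scr x y As_scaleR(1))
    ultimately show ?thesis using False by (simp add: field_simps)
  qed
  then show thesis using that[of "2 * k * c"] k c by simp
qed

lemma form_add_left: assumes "x \<in> X" "y \<in> X" "z \<in> X" shows "form w a (x + y) z = form w a x z + form w a y z"
proof (rule LIMSEQ_unique[OF form_limit])
  show "(\<lambda>m. formD w a (R m (x + y)) (R m z)) \<longlonglongrightarrow> form w a x z + form w a y z"
    unfolding R_linear(1) formD_add_left[OF R_D(1)[OF assms(1)] R_D(1)[OF assms(2)] R_D(1)[OF assms(3)]]
    by (intro tendsto_add form_limit assms)
qed (use assms H.antidual_add in auto)

lemma form_scale_left: assumes "x \<in> X" "z \<in> X" shows "form w a (scale_dual c x) z = c * form w a x z"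
proof (rule LIMSEQ_unique[OF form_limit])
  show "(\<lambda>m. formD w a (R m (scale_dual c x)) (R m z)) \<longlonglongrightarrow> c * form w a x z"
    unfolding R_scale formD_scale_left[OF R_D(1)[OF assms(1)] R_D(1)[OF assms(2)]]
    by (intro tendsto_mult_left form_limit assms)
qed (use assms H.scale_dual_in_antidual in auto)

lemma form_commute: assumes "x \<in> X" "y \<in> X" shows "form w a y x = sconj (form w a x y)"
proof (rule LIMSEQ_unique[OF form_limit[OF assms(2,1)]])
  show "(\<lambda>m. formD w a (R m y) (R m x)) \<longlonglongrightarrow> sconj (form w a x y)"
    unfolding formD_commute[OF R_D(1)[OF assms(1)] R_D(1)[OF assms(2)]]
    by (rule bounded_linear.tendsto[OF bounded_linear_sconj form_limit[OF assms]])
qed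

lemma form_add_right: assumes "x \<in> X" "y \<in> X" "z \<in> X" shows "form w a z (x + y) = form w a z x + form w a z y"
  using form_commute[OF H.antidual_add[OF assms(1,2)] assms(3)]
    form_add_left[OF assms] form_commute[OF assms(1,3)] form_commute[OF assms(2,3)] by (simp add: sconj_add)

lemma form_scale_right: assumes "x \<in> X" "z \<in> X" shows "form w a z (scale_dual c x) = sconj c * form w a z x"
  using form_commute[OF H.scale_dual_in_antidual[OF assms(1), of c] assms(2)]
    form_scale_left[OF assms] form_commute[OF assms] by (simp add: sconj_mult)

lemma form_scaleR: assumes "x \<in> X" "z \<in> X" shows "form w a (r *\<^sub>R x) z = r *\<^sub>R form w a x z" "form w a z (r *\<^sub>R x) = r *\<^sub>R form w a z x"
  using form_scale_left[OF assms, of "of_real r"] form_scale_right[OF assms, of "of_real r"]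
  by (simp_all add: scale_dual_of_real scaleR_conv_of_real)

lemma form_bound: obtains K where "0 \<le> K" "\<And>x y. x \<in> X \<Longrightarrow> y \<in> X \<Longrightarrow> norm (form w a x y) \<le> K * norm x * norm y"
proof -
  obtain K where K: "0 \<le> K" "\<And>x y. x \<in> D \<Longrightarrow> y \<in> D \<Longrightarrow> norm (formD w a x y) \<le> K * norm x * norm y"
    by (rule formD_bound) (rule that)
  have "norm (form w a x y) \<le> K * norm x * norm y" if "x \<in> X" "y \<in> X" for x y
  proof (rule LIMSEQ_le)
    show "(\<lambda>m. norm (formD w a (R m x) (R m y))) \<longlonglongrightarrow> norm (form w a x y)" by (intro tendsto_norm form_limit that)
    show "(\<lambda>m. K * norm (R m x) * norm (R m y)) \<longlonglongrightarrow> K * norm x * norm y" by (intro tendsto_intros R_tendsto that)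
    show "\<exists>N. \<forall>n\<ge>N. norm (formD w a (R n x) (R n y)) \<le> K * norm (R n x) * norm (R n y)"
      using K(2) R_D(1) that by blast
  qed
  with K(1) show thesis by (rule that)
qed

end

end

section \<open>Weighted Gramian and the operator L\<close>

locale observed_system = admissible_system \<Sigma>
  for \<Sigma> :: "('k::real_or_complex, 'h::banach, 'u::banach) csys" +
  fixes \<omega> T :: real
  assumes H4: "H4 \<Sigma> T" and omega: "\<omega> > 0"
begin

abbreviation "Tw \<equiv> T_weight \<omega> T"
abbreviation "e \<equiv> e_weight \<omega> T"
definition e' :: "real \<Rightarrow> real" where "e' s = (if s \<le> T then - 2 * \<omega> * exp (- 2 * \<omega> * s) else - 2 * \<omega> * exp (- 2 * \<omega> * T))"

lemma T_pos: "T > 0" "Tw > 0" "T < Tw" using H4 omega by (auto simp: H4_def T_weight_def add_pos_pos)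

lemma e'_continuous: "continuous_on UNIV e'"
proof -
  have "continuous_on ({..T} \<union> {T..}) (\<lambda>s. if s \<le> T then - 2 * \<omega> * exp (- 2 * \<omega> * s) else - 2 * \<omega> * exp (- 2 * \<omega> * T))"
    by (rule continuous_on_If) (auto intro!: continuous_intros)
  moreover have "{..T} \<union> {T..} = UNIV" by auto
  ultimately show ?thesis by (simp add: e'_def[abs_def])
qed

text \<open>The two branches of the weight agree at \<open>T\<close> together with their derivatives; this is the reason for the choice of
  \<open>T_weight\<close>.\<close>

lemma e_deriv: "(e has_real_derivative e' s) (at s)"
proof -
  have 1: "((\<lambda>s. exp (- 2 * \<omega> * s)) has_vector_derivative - 2 * \<omega> * exp (- 2 * \<omega> * s)) (at s within A)" for s A
    unfolding has_real_derivative_iff_has_vector_derivative[symmetric] by (auto intro!: derivative_eq_intros)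
  have 2: "((\<lambda>s. 2 * \<omega> * exp (- 2 * \<omega> * T) * (Tw - s)) has_vector_derivative - 2 * \<omega> * exp (- 2 * \<omega> * T)) (at s within A)" for s A
    unfolding has_real_derivative_iff_has_vector_derivative[symmetric] by (auto intro!: derivative_eq_intros)
  have "((\<lambda>s. if s \<in> {..T} then exp (- 2 * \<omega> * s) else 2 * \<omega> * exp (- 2 * \<omega> * T) * (Tw - s)) has_vector_derivative
      (if s \<in> {..T} then - 2 * \<omega> * exp (- 2 * \<omega> * s) else - 2 * \<omega> * exp (- 2 * \<omega> * T))) (at s within {..T} \<union> {T..})"
    by (rule has_vector_derivative_If_within_closures[where S="{..T}" and T="{T..}"])
      (use 1 2 omega in \<open>auto simp: T_weight_def\<close>)
  moreover have "{..T} \<union> {T..} = UNIV" by auto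
  ultimately show ?thesis
    unfolding has_real_derivative_iff_has_vector_derivative by (simp add: e_weight_def[abs_def] e'_def)
qed

lemma e_continuous: "continuous_on UNIV e"
  using e_deriv by (meson DERIV_isCont continuous_at_imp_continuous_on)

lemma deriv_e: "deriv e = e'"
  using e_deriv by (auto intro: DERIV_imp_deriv)

lemma e_ends: "e 0 = 1" "e Tw = 0"
  using T_pos by (auto simp: e_weight_def)

abbreviation "G \<equiv> form e Tw"
abbreviation "\<Lambda> \<equiv> Gramian \<Sigma> \<omega> T"
abbreviation "\<Lambda>inv \<equiv> Gramian_inv \<Sigma> \<omega> T"

lemmas G_add_left = form_add_left[OF e_continuous T_pos(2)] and G_add_right = form_add_right[OF e_continuous T_pos(2)]
  and G_scale_left = form_scale_left[OF e_continuous T_pos(2)] and G_scale_right = form_scale_right[OF e_continuous T_pos(2)]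
  and G_scaleR = form_scaleR[OF e_continuous T_pos(2)] and G_commute = form_commute[OF e_continuous T_pos(2)]
  and G_bound = form_bound[OF e_continuous T_pos(2)] and G_limit = form_limit[OF e_continuous T_pos(2)]
  and G_on_D = form_on_D[OF e_continuous T_pos(2)]

text \<open>On \<open>[0, T]\<close> the weight is at least \<open>exp (- 2 * \<omega> * T)\<close>, and it is nonnegative on the rest of the interval.\<close>

lemma G_coercive: obtains c where "0 < c" "\<And>x. x \<in> X \<Longrightarrow> c * (norm x)\<^sup>2 \<le> G x x \<bullet> 1"
proof -
  obtain c2 where c2: "c2 > 0" "\<And>x. x \<in> D \<Longrightarrow> c2 * (norm x)\<^sup>2 \<le> (LBINT t:{0..T}. (norm (b (expAstar \<Sigma> (- t) x)))\<^sup>2)"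
    using H4 unfolding H4_def by auto
  define k where "k = exp (- 2 * \<omega> * T)"
  have k: "k > 0" by (simp add: k_def)
  have onD: "k * c2 * (norm x)\<^sup>2 \<le> formD e Tw x x \<bullet> 1" if x: "x \<in> D" for x
  proof -
    have cont: "continuous_on UNIV (\<lambda>s. (norm (b (S s x)))\<^sup>2)" by (intro continuous_intros b_S_continuous x)
    have i1: "set_integrable lborel {0..T} (\<lambda>s. k * (norm (b (S s x)))\<^sup>2)"
      by (rule borel_integrable_atLeastAtMost') (intro continuous_intros continuous_on_subset[OF b_S_continuous[OF x]] subset_UNIV)
    have i2: "set_integrable lborel {0..Tw} (\<lambda>s. e s * (norm (b (S s x)))\<^sup>2)"
      by (rule borel_integrable_atLeastAtMost') (intro continuous_intros continuous_on_subset[OF b_S_continuous[OF x]] continuous_on_subset[OF e_continuous] subset_UNIV)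
    have "k * c2 * (norm x)\<^sup>2 \<le> k * (LBINT t:{0..T}. (norm (b (S t x)))\<^sup>2)"
      using c2(2)[OF x] k by (simp add: S_def mult.assoc)
    also have "\<dots> = (LBINT t:{0..T}. k * (norm (b (S t x)))\<^sup>2)" by simp
    also have "\<dots> \<le> (LBINT s:{0..Tw}. e s * (norm (b (S s x)))\<^sup>2)"
      unfolding set_lebesgue_integral_def
    proof (rule integral_mono)
      fix s
      show "indicat_real {0..T} s *\<^sub>R (k * (norm (b (S s x)))\<^sup>2) \<le> indicat_real {0..Tw} s *\<^sub>R (e s * (norm (b (S s x)))\<^sup>2)"
      proof (cases "s \<in> {0..T}")
        case True
        then have "k \<le> e s" using omega by (simp add: k_def e_weight_def)
        then show ?thesis using True T_pos by (auto intro: mult_right_mono)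
      next
        case False
        have "0 \<le> e s" if "s \<le> Tw" using that omega by (simp add: e_weight_def)
        then show ?thesis using False by (auto simp: indicator_def)
      qed
    qed (use i1 i2 in \<open>auto simp: set_integrable_def\<close>)
    also have "\<dots> = formD e Tw x x \<bullet> 1" by (rule formD_self[OF e_continuous T_pos(2) x, symmetric])
    finally show ?thesis .
  qed
  have "k * c2 * (norm x)\<^sup>2 \<le> G x x \<bullet> 1" if x: "x \<in> X" for x
  proof (rule LIMSEQ_le)
    show "(\<lambda>m. k * c2 * (norm (R m x))\<^sup>2) \<longlonglongrightarrow> k * c2 * (norm x)\<^sup>2" by (intro tendsto_intros R_tendsto x)
    show "(\<lambda>m. formD e Tw (R m x) (R m x) \<bullet> 1) \<longlonglongrightarrow> G x x \<bullet> 1" by (intro tendsto_inner G_limit x tendsto_const)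
    show "\<exists>N. \<forall>n\<ge>N. k * c2 * (norm (R n x))\<^sup>2 \<le> formD e Tw (R n x) (R n x) \<bullet> 1" using onD R_D(1)[OF x] by blast
  qed
  then show thesis using that[of "k * c2"] k c2(1) by simp
qed

lemma pair_Jtilde: "pair h (Jtilde \<Sigma> k) = ipH \<Sigma> h k"
  by (simp add: pair_def pair'_def H.ip_commute[of h k])

lemma pair_unique: "(\<And>y. y \<in> X \<Longrightarrow> pair h y = pair h' y) \<Longrightarrow> h = h'"
  by (rule H.ip_left_unique) (metis pair_Jtilde H.riesz_in_antidual)

lemma G_alt: "G x y = (LBINT s:{0..Tw}. of_real (e s) * pair (J \<Sigma> (free x s)) (free y s))"
  by (simp add: form_def U.dip_def scaleR_conv_of_real)

lemma Gramian_pair: assumes x: "x \<in> X" "y \<in> X" shows "pair (\<Lambda> x) y = G x y"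
proof -
  obtain K where K: "0 \<le> K" "\<And>x y. x \<in> X \<Longrightarrow> y \<in> X \<Longrightarrow> norm (G x y) \<le> K * norm x * norm y" by (rule G_bound) (rule that)
  obtain h where h: "\<And>k. G x (Jtilde \<Sigma> k) = ipH \<Sigma> h k"
  proof (rule H.riesz_representation[of "\<lambda>k. G x (Jtilde \<Sigma> k)" "K * norm x"])
    show "norm (G x (Jtilde \<Sigma> k)) \<le> K * norm x * norm k" for k using K(2)[OF x(1) H.riesz_in_antidual[of k]] by simp
  qed (auto simp: H.riesz_linear G_add_right G_scale_right x)
  have hp: "pair h y = G x y" if "y \<in> X" for y
    using H.riesz_surj[OF that] h by (auto simp: pair_Jtilde)
  have "\<Lambda> x = h"
    unfolding Gramian_def G_alt[symmetric]
    by (rule the_equality) (use hp pair_unique in \<open>metis+\<close>)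
  then show ?thesis using hp x by simp
qed

lemma Gramian_linear: assumes "x \<in> X" "y \<in> X"
  shows "\<Lambda> (x + y) = \<Lambda> x + \<Lambda> y" "\<Lambda> (scale_dual c x) = scaleH \<Sigma> c (\<Lambda> x)" "\<Lambda> (r *\<^sub>R x) = r *\<^sub>R \<Lambda> x"
proof -
  have p: "pair (h + h') z = pair h z + pair h' z" "pair (r *\<^sub>R h) z = r *\<^sub>R pair h z" for h h' and r :: real and z :: "'h \<Rightarrow>\<^sub>L 'k"
    by (simp_all add: pair_def pair'_def blinfun.add_right sconj_add blinfun.scaleR_right)
  have pc: "pair (scaleH \<Sigma> c h) z = c * pair h z" if "z \<in> X" for h z
    using that by (simp add: pair_def pair'_def antidual_def sconj_mult)
  show "\<Lambda> (x + y) = \<Lambda> x + \<Lambda> y"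
    by (rule pair_unique) (simp add: p Gramian_pair assms G_add_left H.antidual_add)
  show "\<Lambda> (scale_dual c x) = scaleH \<Sigma> c (\<Lambda> x)"
    by (rule pair_unique) (simp add: pc Gramian_pair assms G_scale_left H.scale_dual_in_antidual)
  show "\<Lambda> (r *\<^sub>R x) = r *\<^sub>R \<Lambda> x"
    by (rule pair_unique) (simp add: p Gramian_pair assms G_scaleR H.antidual_scaleR)
qed

lemma Gramian_bound: obtains K where "0 \<le> K" "\<And>x. x \<in> X \<Longrightarrow> norm (\<Lambda> x) \<le> K * norm x"
proof -
  obtain K where K: "0 \<le> K" "\<And>x y. x \<in> X \<Longrightarrow> y \<in> X \<Longrightarrow> norm (G x y) \<le> K * norm x * norm y" by (rule G_bound) (rule that)
  have "norm (\<Lambda> x) \<le> K * norm x" if x: "x \<in> X" for x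
  proof -
    have "ipH \<Sigma> (\<Lambda> x) (\<Lambda> x) = G x (Jtilde \<Sigma> (\<Lambda> x))" using Gramian_pair[OF x H.riesz_in_antidual] by (simp add: pair_Jtilde)
    then have "(norm (\<Lambda> x))\<^sup>2 = norm (G x (Jtilde \<Sigma> (\<Lambda> x)))" unfolding H.ip_self by (metis norm_of_real abs_power2)
    also have "\<dots> \<le> K * norm x * norm (\<Lambda> x)" using K(2)[OF x H.riesz_in_antidual] by (metis H.norm_riesz)
    finally have "norm (\<Lambda> x) * norm (\<Lambda> x) \<le> (K * norm x) * norm (\<Lambda> x)" by (simp add: power2_eq_square)
    then show ?thesis using K(1) by (cases "norm (\<Lambda> x) = 0") (auto dest: mult_right_le_imp_le)
  qed
  with K(1) show thesis by (rule that)
qed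

lemma Gramian_coercive: obtains c where "0 < c" "\<And>x. x \<in> X \<Longrightarrow> c * norm x \<le> norm (\<Lambda> x)"
proof -
  obtain c where c: "0 < c" "\<And>x. x \<in> X \<Longrightarrow> c * (norm x)\<^sup>2 \<le> G x x \<bullet> 1" by (rule G_coercive) (rule that)
  have "c * norm x \<le> norm (\<Lambda> x)" if x: "x \<in> X" for x
  proof -
    have "c * (norm x)\<^sup>2 \<le> norm (G x x)" using c(2)[OF x] Cauchy_Schwarz_ineq2[of "G x x" 1] by simp
    also have "\<dots> = norm (blinfun_apply x (\<Lambda> x))" using Gramian_pair[OF x x] by (metis pair_def pair'_def norm_sconj)
    also have "\<dots> \<le> norm x * norm (\<Lambda> x)" by (rule norm_blinfun)
    finally have "(c * norm x) * norm x \<le> norm (\<Lambda> x) * norm x" by (simp add: power2_eq_square mult_ac)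
    then show ?thesis by (cases "norm x = 0") (auto dest: mult_right_le_imp_le)
  qed
  with c(1) show thesis by (rule that)
qed

lemma Gramian_inj: "inj_on \<Lambda> X"
proof (rule inj_onI)
  fix x y assume x: "x \<in> X" "y \<in> X" and eq: "\<Lambda> x = \<Lambda> y"
  obtain c where c: "0 < c" "\<And>x. x \<in> X \<Longrightarrow> c * norm x \<le> norm (\<Lambda> x)" by (rule Gramian_coercive) (rule that)
  have d: "x - y \<in> X" by (rule H.antidual_diff[OF x])
  have "\<Lambda> (x - y) = 0" using Gramian_linear(1)[OF d x(2)] eq by simp
  then have "c * norm (x - y) \<le> 0" using c(2)[OF d] by simp
  then show "x = y" using c(1) by (simp add: mult_le_0_iff)
qed

text \<open>The form \<open>G\<close> is coercive, hence represents the functional \<open>v \<mapsto> pair h v\<close>.\<close>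

lemma Gramian_surj: "\<exists>x\<in>X. \<Lambda> x = h"
proof -
  obtain c where c: "0 < c" "\<And>x. x \<in> X \<Longrightarrow> c * (norm x)\<^sup>2 \<le> G x x \<bullet> 1" by (rule G_coercive) (rule that)
  obtain K where K: "0 \<le> K" "\<And>x y. x \<in> X \<Longrightarrow> y \<in> X \<Longrightarrow> norm (G x y) \<le> K * norm x * norm y" by (rule G_bound) (rule that)
  have in1: "\<bar>z \<bullet> 1\<bar> \<le> norm z" for z :: 'k using Cauchy_Schwarz_ineq2[of z 1] by simp
  obtain p where p: "p \<in> X" "\<And>v. v \<in> X \<Longrightarrow> G p v \<bullet> 1 = pair h v \<bullet> 1"
  proof (rule symmetric_form_represents_functional[OF H.subspace_antidual H.closed_antidual, of "\<lambda>u v. G u v \<bullet> 1" K c "\<lambda>v. pair h v \<bullet> 1" "norm h"])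
    fix u v w' and r :: real assume u: "u \<in> X" and v: "v \<in> X"
    show "G u v \<bullet> 1 = G v u \<bullet> 1" using G_commute[OF u v] inner_sconj_one[of "G u v"] by simp
    show "G (r *\<^sub>R u) v \<bullet> 1 = r * (G u v \<bullet> 1)" by (simp add: G_scaleR u v)
    show "\<bar>G u v \<bullet> 1\<bar> \<le> K * norm u * norm v" by (rule order_trans[OF in1 K(2)[OF u v]])
    show "c * (norm v)\<^sup>2 \<le> G v v \<bullet> 1" by (rule c(2)[OF v])
    show "pair h (u + v) \<bullet> 1 = pair h u \<bullet> 1 + pair h v \<bullet> 1" by (simp add: pair_def pair'_def inner_sconj_one plus_blinfun.rep_eq inner_add)
    show "pair h (r *\<^sub>R u) \<bullet> 1 = r * (pair h u \<bullet> 1)" by (simp add: pair_def pair'_def scaleR_blinfun.rep_eq)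
    show "\<bar>pair h u \<bullet> 1\<bar> \<le> norm h * norm u"
      using order_trans[OF in1 norm_blinfun[of u h]] by (simp add: pair_def pair'_def inner_sconj_one mult.commute)
    assume "w' \<in> X"
    then show "G (u + v) w' \<bullet> 1 = G u w' \<bullet> 1 + G v w' \<bullet> 1" by (simp add: G_add_left u v inner_add)
  qed (rule c(1), rule that)
  have "ipH \<Sigma> (\<Lambda> p) = ipH \<Sigma> h"
  proof (rule H.antidual_eq_by_re)
    show "ipH \<Sigma> (\<Lambda> p) k \<bullet> 1 = ipH \<Sigma> h k \<bullet> 1" for k
      using p(2)[OF H.riesz_in_antidual[of k]] unfolding Gramian_pair[OF p(1) H.riesz_in_antidual, symmetric] pair_Jtilde .
  qed (rule H.ip_scale_right)+
  then have "\<Lambda> p = h" by (intro H.ip_left_unique) simp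
  with p(1) show ?thesis by blast
qed

lemma Gramian_inv: "\<Lambda>inv h \<in> X" "\<Lambda> (\<Lambda>inv h) = h"
proof -
  have "h \<in> \<Lambda> ` X" using Gramian_surj[of h] by blast
  then show "\<Lambda>inv h \<in> X" "\<Lambda> (\<Lambda>inv h) = h" unfolding Gramian_inv_def by (rule inv_into_into, rule f_inv_into_f)
qed

lemma Gramian_inv_Gramian: "x \<in> X \<Longrightarrow> \<Lambda>inv (\<Lambda> x) = x"
  unfolding Gramian_inv_def by (rule inv_into_f_f[OF Gramian_inj])

lemma Gramian_inv_linear: "\<Lambda>inv (h + h') = \<Lambda>inv h + \<Lambda>inv h'" "\<Lambda>inv (scaleH \<Sigma> c h) = scale_dual c (\<Lambda>inv h)"
proof -
  note I = Gramian_inv[of h] and I' = Gramian_inv[of h']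
  show "\<Lambda>inv (h + h') = \<Lambda>inv h + \<Lambda>inv h'"
    using Gramian_inv_Gramian[OF H.antidual_add[OF I(1) I'(1)]]
    by (simp add: Gramian_linear(1)[OF I(1) I'(1)] I(2) I'(2))
  show "\<Lambda>inv (scaleH \<Sigma> c h) = scale_dual c (\<Lambda>inv h)"
    using Gramian_inv_Gramian[OF H.scale_dual_in_antidual[OF I(1), of c]]
    by (simp add: Gramian_linear(2)[OF I(1) I(1)] I(2))
qed

lemma Gramian_inv_bound: obtains K where "0 \<le> K" "\<And>h. norm (\<Lambda>inv h) \<le> K * norm h"
proof -
  obtain c where c: "0 < c" "\<And>x. x \<in> X \<Longrightarrow> c * norm x \<le> norm (\<Lambda> x)" by (rule Gramian_coercive) (rule that)
  have "norm (\<Lambda>inv h) \<le> (1 / c) * norm h" for h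
    using c(2)[OF Gramian_inv(1)[of h]] c(1) by (simp add: Gramian_inv(2) field_simps)
  then show thesis using that[of "1 / c"] c(1) by simp
qed

abbreviation "GL \<equiv> form (\<lambda>s. - e' s) Tw"

lemma minus_e'_continuous: "continuous_on UNIV (\<lambda>s. - e' s)" by (intro continuous_intros e'_continuous)

lemma opL: "ipH \<Sigma> (opL \<Sigma> \<omega> T x) y = GL (\<Lambda>inv x) (\<Lambda>inv y)"
proof -
  note GL = form_add_right[OF minus_e'_continuous T_pos(2)] form_scale_right[OF minus_e'_continuous T_pos(2)]
  obtain K where K: "0 \<le> K" "\<And>x y. x \<in> X \<Longrightarrow> y \<in> X \<Longrightarrow> norm (GL x y) \<le> K * norm x * norm y"
    by (rule form_bound[OF minus_e'_continuous T_pos(2)]) (rule that)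
  obtain L where L: "0 \<le> L" "\<And>h. norm (\<Lambda>inv h) \<le> L * norm h" by (rule Gramian_inv_bound) (rule that)
  obtain h where h: "\<And>y. GL (\<Lambda>inv x) (\<Lambda>inv y) = ipH \<Sigma> h y"
  proof (rule H.riesz_representation[of "\<lambda>y. GL (\<Lambda>inv x) (\<Lambda>inv y)" "K * norm (\<Lambda>inv x) * L"])
    fix y
    have "norm (GL (\<Lambda>inv x) (\<Lambda>inv y)) \<le> K * norm (\<Lambda>inv x) * norm (\<Lambda>inv y)" by (rule K(2)[OF Gramian_inv(1) Gramian_inv(1)])
    also have "\<dots> \<le> K * norm (\<Lambda>inv x) * (L * norm y)" using K(1) by (intro mult_left_mono L) auto
    finally show "norm (GL (\<Lambda>inv x) (\<Lambda>inv y)) \<le> K * norm (\<Lambda>inv x) * L * norm y" by (simp add: mult_ac)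
  qed (simp_all add: Gramian_inv_linear GL Gramian_inv(1))
  have alt: "- (LBINT s:{0..Tw}. of_real (deriv e s) * pair (J \<Sigma> (free x s)) (free y s)) = GL x y" for x y
    by (simp add: form_def U.dip_def deriv_e scaleR_conv_of_real set_lebesgue_integral_def)
  have "opL \<Sigma> \<omega> T x = h"
    unfolding opL_def alt by (rule the_equality) (use h H.ip_left_unique in \<open>metis+\<close>)
  then show ?thesis using h by simp
qed

end

section \<open>Lyapunov equation\<close>

lemma continuous_interval_integrable:
  fixes f :: "real \<Rightarrow> 'a::euclidean_space"
  assumes "continuous_on UNIV f" shows "interval_lebesgue_integrable lborel (ereal a) (ereal b) f"
proof -
  have "set_integrable lborel {c..d} f" for c d by (rule borel_integrable_atLeastAtMost'[OF continuous_on_subset[OF assms]]) auto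
  then have "set_integrable lborel {c<..<d} f" for c d by (rule set_integrable_subset[where A="{c..d}"]) auto
  then show ?thesis by (simp add: interval_lebesgue_integrable_def)
qed

context bounded_pairing begin

lemma B_continuous_on:
  fixes f g :: "real \<Rightarrow> 'a"
  assumes "continuous_on UNIV f" "continuous_on UNIV g" "\<And>t. f t \<in> X" "\<And>t. g t \<in> X"
  shows "continuous_on UNIV (\<lambda>t. B (f t) (g t))"
  unfolding continuous_on_sequentially
proof (intro allI impI ballI)
  fix x :: "nat \<Rightarrow> real" and a assume "(\<forall>n. x n \<in> UNIV) \<and> x \<longlonglongrightarrow> a"
  then have x: "x \<longlonglongrightarrow> a" by simp
  have "(\<lambda>n. B (f (x n)) (g (x n))) \<longlonglongrightarrow> B (f a) (g a)"
    by (rule B_tendsto) (use assms x in \<open>auto intro: continuous_on_tendsto_compose[OF assms(1)] continuous_on_tendsto_compose[OF assms(2)]\<close>)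
  then show "((\<lambda>t. B (f t) (g t)) \<circ> x) \<longlonglongrightarrow> B (f a) (g a)" by (simp add: comp_def)
qed

lemma B_has_vector_derivative:
  assumes scale: "\<And>r u v. u \<in> X \<Longrightarrow> v \<in> X \<Longrightarrow> B (r *\<^sub>R u) v = r *\<^sub>R B u v" "\<And>r u v. u \<in> X \<Longrightarrow> v \<in> X \<Longrightarrow> B u (r *\<^sub>R v) = r *\<^sub>R B u v"
    and y: "\<And>t. y t \<in> X" "\<And>t. z t \<in> X" "y' \<in> X" "z' \<in> X"
    and d: "(y has_vector_derivative y') (at t)" "(z has_vector_derivative z') (at t)"
  shows "((\<lambda>t. B (y t) (z t)) has_vector_derivative B y' (z t) + B (y t) z') (at t)"
  unfolding has_vector_derivative_iff_quotient
proof -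
  let ?dy = "\<lambda>h. (y (t + h) - y t) /\<^sub>R h" and ?dz = "\<lambda>h. (z (t + h) - z t) /\<^sub>R h"
  have sub: "?dy h \<in> X" "?dz h \<in> X" "y (t + h) - y t \<in> X" "z (t + h) - z t \<in> X" for h
    by (intro subspace_scale subspace_diff X y)+
  have eq: "(B (y (t + h)) (z (t + h)) - B (y t) (z t)) /\<^sub>R h = B (?dy h) (z (t + h)) + B (y t) (?dz h)" for h
  proof -
    have "B (y (t + h)) (z (t + h)) = B (y (t + h) - y t) (z (t + h)) + B (y t) (z (t + h))"
      using add_left[OF sub(3)[of h] y(1)[of t] y(2)[of "t + h"]] by simp
    moreover have "B (y t) (z (t + h)) = B (y t) (z (t + h) - z t) + B (y t) (z t)"
      using add_right[OF sub(4)[of h] y(2)[of t] y(1)[of t]] by simp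
    ultimately show ?thesis
      using scale(1)[OF sub(3)[of h] y(2)[of "t + h"], of "inverse h"] scale(2)[OF y(1)[of t] sub(4)[of h], of "inverse h"]
      by (simp add: scaleR_add_right)
  qed
  have zc: "((\<lambda>h. z (t + h)) \<longlongrightarrow> z t) (at 0)"
    using has_vector_derivative_continuous[OF d(2)] unfolding isCont_iff .
  show "((\<lambda>h. (B (y (t + h)) (z (t + h)) - B (y t) (z t)) /\<^sub>R h) \<longlongrightarrow> B y' (z t) + B (y t) z') (at 0)"
    unfolding eq
  proof (intro tendsto_add B_tendsto sub y zc)
    show "(?dy \<longlongrightarrow> y') (at 0)" "(?dz \<longlongrightarrow> z') (at 0)" using d unfolding has_vector_derivative_iff_quotient .
  qed (rule tendsto_const)
qed

lemma interval_integral_tendsto: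
  fixes t :: real
  assumes f: "f \<in> Lloc 2 X" "\<And>n. fs n \<in> Lloc 2 X" "Lloc_tendsto 2 fs f"
    and g: "g \<in> Lloc 2 X" "\<And>n. gs n \<in> Lloc 2 X" "Lloc_tendsto 2 gs g"
  shows "(\<lambda>n. LBINT s=0..t. B (fs n s) (gs n s)) \<longlonglongrightarrow> (LBINT s=0..t. B (f s) (g s))"
proof -
  have lim: "(\<lambda>n. LBINT s:A. B (fs n s) (gs n s)) \<longlonglongrightarrow> (LBINT s:A. B (f s) (g s))"
    if "A \<in> sets borel" "A \<subseteq> {-(\<bar>t\<bar> + 1)..\<bar>t\<bar> + 1}" for A
    using weighted_integral_tendsto(2)[OF f g that, of "\<lambda>_. 1" 1] by simp
  have sub: "{0<..<t} \<subseteq> {-(\<bar>t\<bar> + 1)..\<bar>t\<bar> + 1}" "{t<..<0} \<subseteq> {-(\<bar>t\<bar> + 1)..\<bar>t\<bar> + 1}"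
    by (rule subsetI, simp only: greaterThanLessThan_iff atLeastAtMost_iff, linarith)+
  show ?thesis
  proof (cases "0 \<le> t")
    case True
    then show ?thesis using lim[OF _ sub(1)] by (auto simp: interval_lebesgue_integral_def zero_ereal_def)
  next
    case False
    then show ?thesis using tendsto_minus[OF lim[OF _ sub(2)]] by (auto simp: interval_lebesgue_integral_def zero_ereal_def)
  qed
qed

end

context admissible_system begin

text \<open>Differentiate \<open>(y r) (E r h)\<close> for \<open>h\<close> in the domain of $A$: the terms with $A$ and $A^*$ cancel and \<open>(g r) (E r h)\<close>
  remains. Only scalar functions are differentiated.\<close>

lemma strong_solution_mild:
  assumes y: "\<And>t. y t \<in> D" "\<And>t. (y has_vector_derivative - As (y t) + g t) (at t)" and g: "g \<in> Ldom"
  shows "y t = mild \<Sigma> (y 0) g t"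
proof (rule eq_on_dense[OF _ domA_dense])
  fix k assume k: "k \<in> domA \<Sigma>"
  define h where "h = E (- t) k"
  have h: "h \<in> domA \<Sigma>" unfolding h_def by (rule E.S_in_D(1)[OF k])
  have d: "((\<lambda>r. blinfun_apply (y r) (E r h)) has_vector_derivative blinfun_apply (g r) (E r h)) (at r)" for r
  proof -
    have "((\<lambda>r. blinfun_apply (y r) (E r h)) has_vector_derivative
        blinfun_apply (y r) (E r (opA \<Sigma> h)) + blinfun_apply (- As (y r) + g r) (E r h)) (at r)"
      by (rule bilinear_has_vector_derivative[OF bounded_bilinear_blinfun_apply y(2) E.S_has_vector_derivative[OF h]])
    moreover have "blinfun_apply (y r) (E r (opA \<Sigma> h)) = blinfun_apply (As (y r)) (E r h)"
      using As(3)[OF y(1) E.S_in_D(1)[OF h]] E.S_in_D(2)[OF h] by simp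
    ultimately show ?thesis by (simp add: plus_blinfun.rep_eq uminus_blinfun.rep_eq minus_blinfun.rep_eq)
  qed
  have 1: "oriented_integral 0 t (\<lambda>r. blinfun_apply (g r) (E r h)) = blinfun_apply (y t) k - blinfun_apply (y 0) h"
    using oriented_integral_of_derivative[OF d, of 0 t] by (simp add: h_def E.S_0 flip: E.S_plus)
  have Eh: "E r h = E (- (t - r)) k" for r by (simp add: h_def flip: E.S_plus)
  have "oriented_integral 0 t (\<lambda>r. blinfun_apply (S (t - r) (g r)) k) = blinfun_apply (oriented_integral 0 t (\<lambda>r. S (t - r) (g r))) k"
    by (rule oriented_integral_bounded_linear[OF blinfun.bounded_linear_left]) (rule Duhamel_has_integral(1)[OF g])+
  then have "blinfun_apply (oriented_integral 0 t (\<lambda>r. S (t - r) (g r))) k = blinfun_apply (y t) k - blinfun_apply (y 0) h"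
    using 1 by (simp add: Eh)
  then show "blinfun_apply (y t) k = blinfun_apply (mild \<Sigma> (y 0) g t) k"
    unfolding mild_def S_def[symmetric] by (simp add: plus_blinfun.rep_eq h_def)
qed

end

context observed_system begin

lemma X_sub: "subspace X" "closed X" using H.subspace_antidual H.closed_antidual by auto

lemma scaled_form_pairing:
  assumes w: "continuous_on UNIV w"
  obtains K where "K > 0" "bounded_pairing X (\<lambda>u v. form w Tw u v /\<^sub>R K)"
proof -
  obtain K where K: "0 \<le> K" "\<And>x y. x \<in> X \<Longrightarrow> y \<in> X \<Longrightarrow> norm (form w Tw x y) \<le> K * norm x * norm y"
    by (rule form_bound[OF w T_pos(2)]) (rule that)
  have "bounded_pairing X (\<lambda>u v. form w Tw u v /\<^sub>R (K + 1))"
  proof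
    show "norm (form w Tw u v /\<^sub>R (K + 1)) \<le> norm u * norm v" if "u \<in> X" "v \<in> X" for u v
    proof -
      have "norm (form w Tw u v) \<le> K * norm u * norm v" by (rule K(2)[OF that])
      also have "\<dots> \<le> (K + 1) * (norm u * norm v)" by (simp add: distrib_right mult.assoc)
      finally show ?thesis using K(1) by (simp add: field_simps)
    qed
  qed (simp_all add: X_sub form_add_left[OF w T_pos(2)] form_add_right[OF w T_pos(2)] scaleR_add_right)
  then show thesis using that[of "K + 1"] K(1) by simp
qed

lemma form_has_vector_derivative:
  assumes w: "continuous_on UNIV w" and y: "\<And>t. y t \<in> X" "\<And>t. z t \<in> X" "y' \<in> X" "z' \<in> X"
    and d: "(y has_vector_derivative y') (at t)" "(z has_vector_derivative z') (at t)"
  shows "((\<lambda>t. form w Tw (y t) (z t)) has_vector_derivative form w Tw y' (z t) + form w Tw (y t) z') (at t)"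
proof -
  obtain K where K: "K > 0" "bounded_pairing X (\<lambda>u v. form w Tw u v /\<^sub>R K)" by (rule scaled_form_pairing[OF w]) (rule that)
  have "((\<lambda>t. form w Tw (y t) (z t) /\<^sub>R K) has_vector_derivative form w Tw y' (z t) /\<^sub>R K + form w Tw (y t) z' /\<^sub>R K) (at t)"
    by (rule bounded_pairing.B_has_vector_derivative[OF K(2) _ _ y d]) (simp_all add: form_scaleR[OF w T_pos(2)])
  from bounded_linear.has_vector_derivative[OF bounded_linear_scaleR_right this, of K] show ?thesis
    using K(1) by (simp add: scaleR_add_right)
qed

lemma form_continuous_on:
  fixes f g :: "real \<Rightarrow> _"
  assumes w: "continuous_on UNIV w" and f: "continuous_on UNIV f" "continuous_on UNIV g" "\<And>t. f t \<in> X" "\<And>t. g t \<in> X"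
  shows "continuous_on UNIV (\<lambda>t. form w Tw (f t) (g t))"
proof -
  obtain K where K: "K > 0" "bounded_pairing X (\<lambda>u v. form w Tw u v /\<^sub>R K)" by (rule scaled_form_pairing[OF w]) (rule that)
  have "continuous_on UNIV (\<lambda>t. K *\<^sub>R (form w Tw (f t) (g t) /\<^sub>R K))"
    by (intro continuous_on_scaleR continuous_on_const bounded_pairing.B_continuous_on[OF K(2) f])
  then show ?thesis using K(1) by simp
qed

lemma form_smoothing_limit:
  fixes f g :: "real \<Rightarrow> _" and t :: real
  assumes w: "continuous_on UNIV w" and f: "continuous_on UNIV f" "continuous_on UNIV g" "\<And>t. f t \<in> X" "\<And>t. g t \<in> X"
  shows "(\<lambda>m. LBINT s=0..t. form w Tw (R m (f s)) (R m (g s))) \<longlonglongrightarrow> (LBINT s=0..t. form w Tw (f s) (g s))"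
    "(\<lambda>m. form w Tw (R m (f t)) (R m (g t))) \<longlonglongrightarrow> form w Tw (f t) (g t)"
proof -
  obtain K where K: "K > 0" "bounded_pairing X (\<lambda>u v. form w Tw u v /\<^sub>R K)" by (rule scaled_form_pairing[OF w]) (rule that)
  have L: "f \<in> Lloc 2 X" "\<And>m. (\<lambda>t. R m (f t)) \<in> Lloc 2 X" "Lloc_tendsto 2 (\<lambda>m t. R m (f t)) f"
    "g \<in> Lloc 2 X" "\<And>m. (\<lambda>t. R m (g t)) \<in> Lloc 2 X" "Lloc_tendsto 2 (\<lambda>m t. R m (g t)) g"
    by (intro continuous_Lloc2 R_continuous R_X f R_Lp[where k=2]; simp)+
  have "(\<lambda>m. K *\<^sub>R (LBINT s=0..t. form w Tw (R m (f s)) (R m (g s)) /\<^sub>R K)) \<longlonglongrightarrow> K *\<^sub>R (LBINT s=0..t. form w Tw (f s) (g s) /\<^sub>R K)"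
    by (intro tendsto_scaleR tendsto_const bounded_pairing.interval_integral_tendsto[OF K(2) L])
  moreover have "K *\<^sub>R (LBINT s=0..t. h s /\<^sub>R K) = (LBINT s=0..t. h s)" for h :: "real \<Rightarrow> 'k"
    using K(1) by (simp add: interval_lebesgue_integral_def)
  ultimately show "(\<lambda>m. LBINT s=0..t. form w Tw (R m (f s)) (R m (g s))) \<longlonglongrightarrow> (LBINT s=0..t. form w Tw (f s) (g s))"
    by (simp only:)
  have "(\<lambda>m. K *\<^sub>R (form w Tw (R m (f t)) (R m (g t)) /\<^sub>R K)) \<longlonglongrightarrow> K *\<^sub>R (form w Tw (f t) (g t) /\<^sub>R K)"
    by (intro tendsto_scaleR tendsto_const bounded_pairing.B_tendsto[OF K(2)] R_X R_tendsto f)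
  then show "(\<lambda>m. form w Tw (R m (f t)) (R m (g t))) \<longlonglongrightarrow> form w Tw (f t) (g t)" using K(1) by simp
qed

text \<open>Let \<open>\<Phi>\<close> be the primitive of \<open>\<phi> s = (b (S s z), b (S s v))\<close>. Integration by parts gives
  \<open>G (S t z) (S t v) = - \<Phi> t - \<integral> e' s \<Phi> (s + t) ds\<close>, because the weight is 1 at 0 and 0 at the right end. This
  can be differentiated in \<open>t\<close> although \<open>\<phi>\<close> is merely continuous, and the derivative at 0 is compared with the one
  obtained from the derivative of the orbits.\<close>

lemma Lyapunov_identity:
  assumes z: "z \<in> D" and v: "v \<in> D"
  shows "G (As z) v + G z (As v) = U.dip (b z) (b v) - GL z v"
proof -
  define \<phi> where "\<phi> s = U.dip (b (S s z)) (b (S s v))" for s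
  have \<phi>: "continuous_on UNIV \<phi>"
    unfolding \<phi>_def by (intro pairingY.B_continuous_on b_S_continuous z v b_Y S_D(1))
  define \<Phi> where "\<Phi> u = oriented_integral 0 u \<phi>" for u
  have \<Phi>: "(\<Phi> has_vector_derivative \<phi> u) (at u)" for u
    unfolding \<Phi>_def[abs_def] by (rule oriented_integral_has_vector_derivative[OF \<phi>])
  have \<Phi>c: "continuous_on UNIV \<Phi>"
    by (intro continuous_at_imp_continuous_on ballI has_vector_derivative_continuous[OF \<Phi>])
  have \<Phi>s: "((\<lambda>t. \<Phi> (s + t)) has_vector_derivative \<phi> (s + t)) (at t within A)"
     "((\<lambda>s. \<Phi> (s + t)) has_vector_derivative \<phi> (s + t)) (at s within A)" for s t A
    using \<Phi>[of "s + t"] by - (rule has_vector_derivative_at_within, simp add: has_vector_derivative_iff_quotient add_ac)+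
  have shift: "continuous_on UNIV (\<lambda>s. f (s + t :: real))" if "continuous_on UNIV f" for f :: "real \<Rightarrow> 'k" and t
    by (rule continuous_on_compose2[OF that]) (auto intro!: continuous_intros)
  have G_eq: "G (S t z) (S t v) = - \<Phi> t - integral {0..Tw} (\<lambda>s. e' s *\<^sub>R \<Phi> (s + t))" for t
  proof -
    have "G (S t z) (S t v) = (LBINT s:{0..Tw}. e s *\<^sub>R \<phi> (s + t))"
      unfolding G_on_D[OF S_D(1)[OF z] S_D(1)[OF v]] formD_def \<phi>_def by (simp add: S_plus)
    also have "\<dots> = integral {0..Tw} (\<lambda>s. e s *\<^sub>R \<phi> (s + t))"
      by (rule set_borel_integral_eq_integral(2), rule borel_integrable_atLeastAtMost')
        (intro continuous_intros continuous_on_subset[OF e_continuous] continuous_on_subset[OF shift[OF \<phi>]] subset_UNIV)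
    also have "\<dots> = - \<Phi> t - integral {0..Tw} (\<lambda>s. e' s *\<^sub>R \<Phi> (s + t))"
    proof -
      have "((\<lambda>s. e s *\<^sub>R \<phi> (s + t) + e' s *\<^sub>R \<Phi> (s + t)) has_integral e Tw *\<^sub>R \<Phi> (Tw + t) - e 0 *\<^sub>R \<Phi> (0 + t)) {0..Tw}"
      proof (rule has_integral_of_derivative)
        show "((\<lambda>s. e s *\<^sub>R \<Phi> (s + t)) has_vector_derivative e s *\<^sub>R \<phi> (s + t) + e' s *\<^sub>R \<Phi> (s + t)) (at s)" for s
          by (rule has_vector_derivative_scaleR[OF e_deriv \<Phi>s(2)])
      qed (use T_pos in simp)
      moreover have "(\<lambda>s. e s *\<^sub>R \<phi> (s + t)) integrable_on {0..Tw}" "(\<lambda>s. e' s *\<^sub>R \<Phi> (s + t)) integrable_on {0..Tw}"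
        by (intro integrable_continuous_real continuous_intros continuous_on_subset[OF e_continuous] continuous_on_subset[OF e'_continuous]
            continuous_on_subset[OF shift[OF \<phi>]] continuous_on_subset[OF shift[OF \<Phi>c]] subset_UNIV)+
      ultimately show ?thesis by (auto dest!: integral_unique simp: integral_add e_ends algebra_simps)
    qed
    finally show ?thesis .
  qed
  have "((\<lambda>t. integral (cbox 0 Tw) (\<lambda>s. e' s *\<^sub>R \<Phi> (s + t))) has_vector_derivative integral (cbox 0 Tw) (\<lambda>s. e' s *\<^sub>R \<phi> (s + 0))) (at 0 within UNIV)"
  proof (rule leibniz_rule_vector_derivative[where fx="\<lambda>t s. e' s *\<^sub>R \<phi> (s + t)"])
    show "((\<lambda>t. e' s *\<^sub>R \<Phi> (s + t)) has_vector_derivative e' s *\<^sub>R \<phi> (s + t)) (at t within UNIV)" for s t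
      by (rule bounded_linear.has_vector_derivative[OF bounded_linear_scaleR_right \<Phi>s(1)])
    show "(\<lambda>s. e' s *\<^sub>R \<Phi> (s + t)) integrable_on cbox 0 Tw" for t
      unfolding box_real by (intro integrable_continuous_real continuous_intros continuous_on_subset[OF e'_continuous]
         continuous_on_subset[OF shift[OF \<Phi>c]] subset_UNIV)
    show "continuous_on (UNIV \<times> cbox 0 Tw) (\<lambda>(t, s). e' s *\<^sub>R \<phi> (s + t))"
      unfolding case_prod_beta'
      by (intro continuous_on_scaleR continuous_on_compose2[OF e'_continuous] continuous_on_compose2[OF \<phi>]) (auto intro!: continuous_intros)
  qed auto
  then have "((\<lambda>t. integral {0..Tw} (\<lambda>s. e' s *\<^sub>R \<Phi> (s + t))) has_vector_derivative integral {0..Tw} (\<lambda>s. e' s *\<^sub>R \<phi> s)) (at 0)"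
    by simp
  from has_vector_derivative_diff[OF has_vector_derivative_minus[OF \<Phi>[of 0]] this]
  have d1: "((\<lambda>t. G (S t z) (S t v)) has_vector_derivative - \<phi> 0 - integral {0..Tw} (\<lambda>s. e' s *\<^sub>R \<phi> s)) (at 0)"
    by (simp add: G_eq)
  have d2: "((\<lambda>t. G (S t z) (S t v)) has_vector_derivative G (- S 0 (As z)) (S 0 v) + G (S 0 z) (- S 0 (As v))) (at 0)"
    by (rule form_has_vector_derivative[OF e_continuous _ _ _ _ S_has_vector_derivative[OF z] S_has_vector_derivative[OF v]])
      (intro S_X H.antidual_neg As(1,2) z v)+
  have neg: "G (- x) y = - G x y" "G y (- x) = - G y x" if "x \<in> X" "y \<in> X" for x y
    using G_scaleR[OF that, of "-1"] by simp_all
  have "- G (As z) v - G z (As v) = - \<phi> 0 - integral {0..Tw} (\<lambda>s. e' s *\<^sub>R \<phi> s)"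
    using vector_derivative_unique_at[OF d2 d1] As[OF z] As[OF v] by (simp add: neg)
  moreover have "GL z v = - integral {0..Tw} (\<lambda>s. e' s *\<^sub>R \<phi> s)"
  proof -
    have "GL z v = - (LBINT s:{0..Tw}. e' s *\<^sub>R \<phi> s)"
      unfolding form_on_D[OF minus_e'_continuous T_pos(2) z v] formD_def \<phi>_def by (simp add: set_lebesgue_integral_def)
    also have "(LBINT s:{0..Tw}. e' s *\<^sub>R \<phi> s) = integral {0..Tw} (\<lambda>s. e' s *\<^sub>R \<phi> s)"
      by (rule set_borel_integral_eq_integral(2), rule borel_integrable_atLeastAtMost')
        (intro continuous_intros continuous_on_subset[OF e'_continuous] continuous_on_subset[OF \<phi>] subset_UNIV)
    finally show ?thesis .
  qed
  ultimately show ?thesis by (simp add: \<phi>_def algebra_simps)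
qed

end

section \<open>Energy balance of the closed loop\<close>

locale closed_loop = observed_system \<Sigma> \<omega> T
  for \<Sigma> :: "('k::real_or_complex, 'h::banach, 'u::banach) csys" and \<omega> T :: real +
  fixes C :: "'h \<Rightarrow> 'h" and V :: "real \<Rightarrow> ('h \<Rightarrow>\<^sub>L 'k) \<Rightarrow> ('h \<Rightarrow>\<^sub>L 'k)"
  assumes C: "positive_sqrt (scaleH \<Sigma>) (ipH \<Sigma>) (opL \<Sigma> \<omega> T) C"
    and V_generates: "generates_group scale_dual X D (\<lambda>z. - As z - feedback \<Sigma> \<omega> T C z) V"
begin

abbreviation "F \<equiv> feedback \<Sigma> \<omega> T C"

sublocale V: strongly_continuous_real_group X V D "\<lambda>z. - As z - F z"
  by (rule generates_group_real[OF V_generates X_sub]) (rule scale_dual_of_real)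

lemma C_facts: "bounded_linear C" "C (scaleH \<Sigma> c x) = scaleH \<Sigma> c (C x)" "ipH \<Sigma> (C x) y = ipH \<Sigma> x (C y)" "C (C x) = opL \<Sigma> \<omega> T x"
proof -
  have bo: "bounded_operator (scaleH \<Sigma>) UNIV C" using C unfolding positive_sqrt_def by (elim conjE)
  show sc: "C (scaleH \<Sigma> c x) = scaleH \<Sigma> c (C x)" for c x using bo by (simp add: bounded_operator_def)
  obtain K where K: "\<And>x. norm (C x) \<le> K * norm x" using bo unfolding bounded_operator_def by auto
  show "bounded_linear C"
  proof (rule bounded_linear_intro[where K=K])
    show "C (x + y) = C x + C y" for x y using bo by (simp add: bounded_operator_def)
    show "C (r *\<^sub>R x) = r *\<^sub>R C x" for r x using sc[of "of_real r" x] by (simp add: H.scale_of_real)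
    show "norm (C x) \<le> norm x * K" for x using K[of x] by (simp add: mult.commute)
  qed
  show "ipH \<Sigma> (C x) y = ipH \<Sigma> x (C y)" "C (C x) = opL \<Sigma> \<omega> T x" using C by (simp_all add: positive_sqrt_def)
qed

lemma F_apply: "blinfun_apply (F z) h = ipH \<Sigma> (C (\<Lambda> z)) (C h)"
  by (simp add: feedback_def C_facts(1))

lemma F_X: "F z \<in> X"
  by (simp add: antidual_def F_apply C_facts(2) H.ip_scale_right)

lemma F_linear: assumes "x \<in> X" "y \<in> X" shows "F (x + y) = F x + F y" "F (r *\<^sub>R x) = r *\<^sub>R F x"
  using linear_add[OF bounded_linear.linear[OF C_facts(1)]] linear_scale[OF bounded_linear.linear[OF C_facts(1)]]
  by (auto intro!: blinfun_eqI simp: F_apply plus_blinfun.rep_eq scaleR_blinfun.rep_eq Gramian_linear[OF assms] H.ip_add_left H.ip_scaleR_left)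

lemma F_bound: obtains K where "0 \<le> K" "\<And>x. x \<in> X \<Longrightarrow> norm (F x) \<le> K * norm x"
proof -
  obtain k where k: "0 \<le> k" "\<And>x. norm (C x) \<le> norm x * k" using bounded_linear.nonneg_bounded[OF C_facts(1)] by auto
  obtain l where l: "0 \<le> l" "\<And>x. x \<in> X \<Longrightarrow> norm (\<Lambda> x) \<le> l * norm x" by (rule Gramian_bound) (rule that)
  have "norm (F x) \<le> k * (l * k) * norm x" if x: "x \<in> X" for x
  proof -
    have "norm (F x) \<le> k * norm (Jtilde \<Sigma> (C (\<Lambda> x)))"
      unfolding feedback_def by (rule norm_adj_le[OF C_facts(1) _ k(1)]) (subst mult.commute, rule k(2))
    also have "\<dots> \<le> k * (norm (\<Lambda> x) * k)" unfolding H.norm_riesz by (intro mult_left_mono k)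
    also have "\<dots> \<le> k * ((l * norm x) * k)" by (intro mult_left_mono mult_right_mono l x k)
    finally show ?thesis by (simp add: mult_ac)
  qed
  then show thesis using that[of "k * (l * k)"] k(1) l(1) by simp
qed

lemma F_tendsto:
  assumes "\<And>h. f h \<in> X" "x \<in> X" "(f \<longlongrightarrow> x) Fl" shows "((\<lambda>h. F (f h)) \<longlongrightarrow> F x) Fl"
proof -
  obtain K where K: "0 \<le> K" "\<And>x. x \<in> X \<Longrightarrow> norm (F x) \<le> K * norm x" by (rule F_bound) (rule that)
  show ?thesis
  proof (rule LIM_zero_cancel, rule Lim_null_comparison)
    have "norm (F (f h) - F x) \<le> K * norm (f h - x)" for h
    proof -
      have d: "f h - x \<in> X" by (rule H.antidual_diff[OF assms(1,2)])
      have "F (f h) = F (f h - x) + F x" using F_linear(1)[OF d assms(2)] by simp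
      then show ?thesis using K(2)[OF d] by simp
    qed
    then show "\<forall>\<^sub>F h in Fl. norm (F (f h) - F x) \<le> K * norm (f h - x)" by simp
    have "((\<lambda>h. norm (f h - x)) \<longlongrightarrow> 0) Fl" using assms(3) by (simp add: LIM_zero tendsto_norm_zero)
    then show "((\<lambda>h. K * norm (f h - x)) \<longlongrightarrow> 0) Fl" by (rule tendsto_mult_right_zero)
  qed
qed

definition forcing :: "('h \<Rightarrow>\<^sub>L 'k) \<Rightarrow> real \<Rightarrow> ('h \<Rightarrow>\<^sub>L 'k)" where "forcing p t = - F (V t p)"

lemma forcing: assumes p: "p \<in> X" shows "forcing p t \<in> X" "continuous_on UNIV (forcing p)"
proof -
  show "forcing p t \<in> X" unfolding forcing_def by (rule H.antidual_neg[OF F_X])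
  have "continuous_on UNIV (\<lambda>t. F (V t p))"
    unfolding continuous_on_def
  proof
    fix t
    show "((\<lambda>t. F (V t p)) \<longlongrightarrow> F (V t p)) (at t within UNIV)"
      by (rule F_tendsto[OF V.S_in[OF p] V.S_in[OF p]]) (use V.S_cont[OF p] in \<open>simp add: continuous_on_def\<close>)
  qed
  then show "continuous_on UNIV (forcing p)" unfolding forcing_def[abs_def] by (rule continuous_on_minus)
qed

text \<open>The generator of \<open>V\<close>, applied to the integrated orbit \<open>Y\<close>, gives \<open>V t p - p = - A\<^sup>* Y - F Y\<close> for every \<open>p\<close>.
  After smoothing, the unbounded term becomes the bounded one \<open>Q m Y\<close>, and the identity can be
  differentiated for all \<open>p\<close>.\<close>

lemma smoothed_increment:
  assumes p: "p \<in> X"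
  shows "R m (V t p) = R m p + (Q m (V.primitive p t) - R m (F (V.primitive p t)))"
proof -
  let ?Y = "V.primitive p t"
  have Y: "?Y \<in> D" "- As ?Y - F ?Y = V t p - p" using V.primitive_in_D[OF p] by auto
  have "R m (V t p) - R m p = R m (- As ?Y - F ?Y)" unfolding Y(2) R_linear(2) ..
  also have "\<dots> = - R m (As ?Y) - R m (F ?Y)" by (simp only: R_linear(2,5))
  finally show ?thesis by (simp add: R_As[OF Y(1)] algebra_simps)
qed

lemma smoothed_derivative:
  assumes p: "p \<in> X"
  shows "((\<lambda>t. R m (V t p)) has_vector_derivative - As (R m (V t p)) + R m (forcing p t)) (at t)"
  unfolding has_vector_derivative_iff_quotient
proof -
  let ?Y = "V.primitive p"
  let ?d = "\<lambda>h. (?Y (t + h) - ?Y t) /\<^sub>R h"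
  have Y: "?Y s \<in> X" for s by (rule V.primitive_in_X[OF p])
  have dX: "?d h \<in> X" "?Y (t + h) - ?Y t \<in> X" for h
    by (intro H.antidual_scaleR H.antidual_diff Y)+
  have linQ: "Q m (x - y) = Q m x - Q m y" "Q m (r *\<^sub>R x) = r *\<^sub>R Q m x" for x y r
    by (rule linear_diff[OF bounded_linear.linear[OF Q_bounded_linear]], rule linear_scale[OF bounded_linear.linear[OF Q_bounded_linear]])
  have FY: "F (?d h) = (F (?Y (t + h)) - F (?Y t)) /\<^sub>R h" for h
    using F_linear(2)[OF dX(2) dX(2)] F_linear(1)[OF dX(2) Y, of h t] by simp
  have eq: "(R m (V (t + h) p) - R m (V t p)) /\<^sub>R h = Q m (?d h) - R m (F (?d h))" for h
    unfolding smoothed_increment[OF p] FY linQ R_linear by (simp add: algebra_simps)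
  have lim: "(?d \<longlongrightarrow> V t p) (at 0)"
    using V.primitive_derivative[OF p] unfolding has_vector_derivative_iff_quotient .
  have "((\<lambda>h. Q m (?d h) - R m (F (?d h))) \<longlongrightarrow> Q m (V t p) - R m (F (V t p))) (at 0)"
    by (intro tendsto_diff bounded_linear.tendsto[OF Q_bounded_linear] bounded_linear.tendsto[OF R_bounded_linear]
      F_tendsto dX(1) V.S_in p lim)
  moreover have "- As (R m (V t p)) + R m (forcing p t) = Q m (V t p) - R m (F (V t p))"
    by (simp add: R_D(2)[OF V.S_in[OF p]] forcing_def R_linear(5))
  ultimately show "((\<lambda>h. (R m (V (t + h) p) - R m (V t p)) /\<^sub>R h) \<longlongrightarrow> - As (R m (V t p)) + R m (forcing p t)) (at 0)"
    unfolding eq by simp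
qed

lemma smoothable_V: assumes p: "p \<in> X" shows "smoothable p (forcing p) (\<lambda>t. V t p)"
proof -
  have "R m (V t p) = mild \<Sigma> (R m p) (\<lambda>r. R m (forcing p r)) t" for m t
    using strong_solution_mild[where y="\<lambda>t. R m (V t p)" and g="\<lambda>r. R m (forcing p r)", OF R_D(1)[OF V.S_in[OF p]] smoothed_derivative[OF p]
       R_Ldom[OF forcing(2)[OF p] forcing(1)[OF p]], of t] by (simp add: V.S_0[OF p])
  then show ?thesis unfolding smoothable_def using p forcing[OF p] V.S_cont[OF p] V.S_in[OF p] by simp
qed

lemma G_F: assumes "z \<in> X" "v \<in> X" shows "G (F z) v = ipH \<Sigma> (C (\<Lambda> z)) (C (\<Lambda> v))" "G z (F v) = ipH \<Sigma> (C (\<Lambda> z)) (C (\<Lambda> v))"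
proof -
  have r: "G z (F v) = ipH \<Sigma> (C (\<Lambda> z)) (C (\<Lambda> v))" if "z \<in> X" "v \<in> X" for z v
    using Gramian_pair[OF that(1) F_X, of v] by (simp add: pair_def pair'_def F_apply H.ip_commute[of "C (\<Lambda> z)" "C (\<Lambda> v)"])
  show "G z (F v) = ipH \<Sigma> (C (\<Lambda> z)) (C (\<Lambda> v))" by (rule r[OF assms])
  from r[OF assms(2,1)] show "G (F z) v = ipH \<Sigma> (C (\<Lambda> z)) (C (\<Lambda> v))"
    using G_commute[OF assms(2) F_X, of z] by (simp add: H.ip_commute[of "C (\<Lambda> v)" "C (\<Lambda> z)"])
qed

lemma GL_C: assumes "z \<in> X" "v \<in> X" shows "GL z v = ipH \<Sigma> (C (\<Lambda> z)) (C (\<Lambda> v))"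
  using opL[of "\<Lambda> z" "\<Lambda> v"] by (simp add: Gramian_inv_Gramian assms C_facts(3) flip: C_facts(4))

lemma G_neg: assumes "x \<in> X" "y \<in> X" shows "G (- x) y = - G x y" "G y (- x) = - G y x"
  using G_scaleR[OF assms, of "-1"] by simp_all

text \<open>The fundamental theorem of calculus, with the derivative supplied by the Lyapunov equation.\<close>

lemma smoothed_energy_balance:
  assumes p: "p \<in> X" and q: "q \<in> X"
  shows "G (R m (V t p)) (R m (V t q)) - G (R m p) (R m q) =
      - (LBINT s=0..t. U.dip (b (R m (V s p))) (b (R m (V s q)))) + (LBINT s=0..t. GL (R m (V s p)) (R m (V s q)))
      + (LBINT s=0..t. G (R m (forcing p s)) (R m (V s q))) + (LBINT s=0..t. G (R m (V s p)) (R m (forcing q s)))"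
proof -
  note Vp = V.S_in[OF p] and Vq = V.S_in[OF q]
  note cont = V.S_cont[OF p] V.S_cont[OF q] forcing(2)[OF p] forcing(2)[OF q]
  let ?f1 = "\<lambda>s. U.dip (b (R m (V s p))) (b (R m (V s q)))" and ?f2 = "\<lambda>s. GL (R m (V s p)) (R m (V s q))"
  let ?f3 = "\<lambda>s. G (R m (forcing p s)) (R m (V s q))" and ?f4 = "\<lambda>s. G (R m (V s p)) (R m (forcing q s))"
  have c1: "continuous_on UNIV ?f1"
    by (intro pairingY.B_continuous_on b_R_continuous cont Vp Vq b_Y R_D(1))
  have c2: "continuous_on UNIV ?f2"
    by (intro form_continuous_on[OF minus_e'_continuous] R_continuous cont R_X Vp Vq)
  have c3: "continuous_on UNIV ?f3" and c4: "continuous_on UNIV ?f4"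
    by (intro form_continuous_on[OF e_continuous] R_continuous cont R_X Vp Vq forcing p q)+
  have d: "((\<lambda>t. G (R m (V t p)) (R m (V t q))) has_vector_derivative - ?f1 s + ?f2 s + ?f3 s + ?f4 s) (at s)" for s
  proof -
    let ?y = "R m (V s p)" and ?z = "R m (V s q)"
    have D: "?y \<in> D" "?z \<in> D" by (intro R_D(1) Vp Vq)+
    have X: "?y \<in> X" "?z \<in> X" "As ?y \<in> X" "As ?z \<in> X" "R m (forcing p s) \<in> X" "R m (forcing q s) \<in> X"
      using As[OF D(1)] As[OF D(2)] by (auto intro: R_X forcing p q)
    have nX: "- As ?y \<in> X" "- As ?z \<in> X" using X H.antidual_neg by auto
    have sX: "- As ?y + R m (forcing p s) \<in> X" "- As ?z + R m (forcing q s) \<in> X"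
      by (rule H.antidual_add[OF nX(1) X(5)], rule H.antidual_add[OF nX(2) X(6)])
    have "((\<lambda>t. G (R m (V t p)) (R m (V t q))) has_vector_derivative G (- As ?y + R m (forcing p s)) ?z + G ?y (- As ?z + R m (forcing q s))) (at s)"
      by (rule form_has_vector_derivative[OF e_continuous _ _ sX smoothed_derivative[OF p] smoothed_derivative[OF q]]) (intro R_X Vp Vq)+
    moreover have "G (- As ?y + R m (forcing p s)) ?z + G ?y (- As ?z + R m (forcing q s)) = - ?f1 s + ?f2 s + ?f3 s + ?f4 s"
      using Lyapunov_identity[OF D]
      unfolding G_add_left[OF nX(1) X(5) X(2)] G_add_right[OF nX(2) X(6) X(1)] G_neg(1)[OF X(3,2)] G_neg(2)[OF X(4,1)]
      by (simp add: algebra_simps)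
    ultimately show ?thesis by simp
  qed
  note i1 = continuous_interval_integrable[OF c1, of 0 t] and i2 = continuous_interval_integrable[OF c2, of 0 t]
    and i3 = continuous_interval_integrable[OF c3, of 0 t] and i4 = continuous_interval_integrable[OF c4, of 0 t]
  have m1: "interval_lebesgue_integrable lborel (ereal 0) (ereal t) (\<lambda>s. - ?f1 s)"
    by (rule continuous_interval_integrable) (intro continuous_on_minus c1)
  have "(LBINT s=ereal 0..ereal t. - ?f1 s + ?f2 s + ?f3 s + ?f4 s) = G (R m (V t p)) (R m (V t q)) - G (R m (V 0 p)) (R m (V 0 q))"
    by (rule interval_integral_FTC_finite)
      (rule continuous_on_subset[OF _ subset_UNIV], intro continuous_on_add continuous_on_minus c1 c2 c3 c4, rule has_vector_derivative_at_within[OF d])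
  moreover have "(LBINT s=ereal 0..ereal t. - ?f1 s + ?f2 s + ?f3 s + ?f4 s) =
     - (LBINT s=ereal 0..ereal t. ?f1 s) + (LBINT s=ereal 0..ereal t. ?f2 s) + (LBINT s=ereal 0..ereal t. ?f3 s) + (LBINT s=ereal 0..ereal t. ?f4 s)"
    by (simp only: interval_lebesgue_integral_add[OF interval_lebesgue_integral_add(1)[OF interval_lebesgue_integral_add(1)[OF m1 i2] i3] i4]
      interval_lebesgue_integral_add[OF interval_lebesgue_integral_add(1)[OF m1 i2] i3]
      interval_lebesgue_integral_add[OF m1 i2] interval_lebesgue_integral_uminus)
  ultimately show ?thesis by (simp add: zero_ereal_def V.S_0[OF p] V.S_0[OF q])
qed

text \<open>In the limit the term of \<open>L\<close> and the two feedback terms are \<open>1\<close>, \<open>-1\<close> and \<open>-1\<close> times the same integral, since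
  \<open>L = C C\<close>.\<close>

lemma energy_balance:
  assumes p: "p \<in> X" and q: "q \<in> X"
  shows "G p q = G (V t p) (V t q) + (LBINT s=0..t. ipH \<Sigma> (C (\<Lambda> (V s p))) (C (\<Lambda> (V s q))))
    + (LBINT s=0..t. U.dip (Bstar_ext \<Sigma> p (forcing p) s) (Bstar_ext \<Sigma> q (forcing q) s))"
proof -
  note Vp = V.S_in[OF p] and Vq = V.S_in[OF q]
  note cont = V.S_cont[OF p] V.S_cont[OF q] forcing(2)[OF p] forcing(2)[OF q]
  let ?k = "\<lambda>s. ipH \<Sigma> (C (\<Lambda> (V s p))) (C (\<Lambda> (V s q)))"
  let ?I = "\<lambda>f. LBINT s=0..t. f s"
  note ep = Bstar_ext_limit[OF smoothable_V[OF p]] and eq = Bstar_ext_limit[OF smoothable_V[OF q]]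
  have l1: "(\<lambda>m. ?I (\<lambda>s. U.dip (b (R m (V s p))) (b (R m (V s q))))) \<longlonglongrightarrow> ?I (\<lambda>s. U.dip (Bstar_ext \<Sigma> p (forcing p) s) (Bstar_ext \<Sigma> q (forcing q) s))"
    by (rule pairingY.interval_integral_tendsto[OF ep(2,4,3) eq(2,4,3)])
  have l2: "(\<lambda>m. ?I (\<lambda>s. GL (R m (V s p)) (R m (V s q)))) \<longlonglongrightarrow> ?I ?k"
    using form_smoothing_limit(1)[OF minus_e'_continuous cont(1,2) Vp Vq] by (simp add: GL_C Vp Vq)
  have l3: "(\<lambda>m. ?I (\<lambda>s. G (R m (forcing p s)) (R m (V s q)))) \<longlonglongrightarrow> - ?I ?k"
    using form_smoothing_limit(1)[OF e_continuous cont(3,2) forcing(1)[OF p] Vq]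
    by (simp add: forcing_def G_neg F_X Vp Vq G_F interval_lebesgue_integral_uminus)
  have l4: "(\<lambda>m. ?I (\<lambda>s. G (R m (V s p)) (R m (forcing q s)))) \<longlonglongrightarrow> - ?I ?k"
    using form_smoothing_limit(1)[OF e_continuous cont(1,4) Vp forcing(1)[OF q]]
    by (simp add: forcing_def G_neg F_X Vp Vq G_F interval_lebesgue_integral_uminus)
  have l0: "(\<lambda>m. G (R m (V s p)) (R m (V s q))) \<longlonglongrightarrow> G (V s p) (V s q)" for s
    by (rule form_smoothing_limit(2)[OF e_continuous cont(1,2) Vp Vq])
  have "(\<lambda>m. G (R m (V t p)) (R m (V t q)) - G (R m p) (R m q)) \<longlonglongrightarrow> G (V t p) (V t q) - G p q"
    using tendsto_diff[OF l0[of t] l0[of 0]] by (simp add: V.S_0 p q)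
  moreover have "(\<lambda>m. G (R m (V t p)) (R m (V t q)) - G (R m p) (R m q)) \<longlonglongrightarrow>
     - ?I (\<lambda>s. U.dip (Bstar_ext \<Sigma> p (forcing p) s) (Bstar_ext \<Sigma> q (forcing q) s)) + ?I ?k + - ?I ?k + - ?I ?k"
    unfolding smoothed_energy_balance[OF p q] by (intro tendsto_add tendsto_minus l1 l2 l3 l4)
  ultimately have "G (V t p) (V t q) - G p q = - ?I (\<lambda>s. U.dip (Bstar_ext \<Sigma> p (forcing p) s) (Bstar_ext \<Sigma> q (forcing q) s)) + ?I ?k + - ?I ?k + - ?I ?k"
    by (rule LIMSEQ_unique)
  then show ?thesis by (simp add: algebra_simps)
qed

lemma pair'_Gramian: assumes "x \<in> X" "y \<in> X" shows "pair' x (\<Lambda> y) = G x y"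
proof -
  have "pair' x (\<Lambda> y) = sconj (pair (\<Lambda> y) x)" by (simp add: pair_def)
  then show ?thesis by (simp only: Gramian_pair[OF assms(2,1)] G_commute[OF assms(2,1)])
qed

lemma balance_in_state_space:
  "pair' (\<Lambda>inv x) y =
      pair' (\<Lambda>inv (groupU \<Sigma> \<omega> T V t x)) (groupU \<Sigma> \<omega> T V t y)
    + (LBINT s=0..t. pair' (Jtilde \<Sigma> (C (groupU \<Sigma> \<omega> T V s x))) (C (groupU \<Sigma> \<omega> T V s y)))
    + (LBINT s=0..t. pair (J \<Sigma> (Bstar_U \<Sigma> \<omega> T C V x s)) (Bstar_U \<Sigma> \<omega> T C V y s))"
proof -
  let ?p = "\<Lambda>inv x" and ?q = "\<Lambda>inv y"
  have p: "?p \<in> X" and q: "?q \<in> X" by (rule Gramian_inv(1))+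
  have 1: "pair' (\<Lambda>inv x) y = G ?p ?q" using pair'_Gramian[OF p q] by (simp add: Gramian_inv(2))
  have 2: "pair' (\<Lambda>inv (groupU \<Sigma> \<omega> T V t x)) (groupU \<Sigma> \<omega> T V t y) = G (V t ?p) (V t ?q)"
    unfolding groupU_def Gramian_inv_Gramian[OF V.S_in[OF p]] by (rule pair'_Gramian[OF V.S_in[OF p] V.S_in[OF q]])
  have 3: "pair' (Jtilde \<Sigma> (C (groupU \<Sigma> \<omega> T V s x))) (C (groupU \<Sigma> \<omega> T V s y)) = ipH \<Sigma> (C (\<Lambda> (V s ?p))) (C (\<Lambda> (V s ?q)))" for s
    by (simp add: groupU_def pair'_def)
  have 4: "Bstar_U \<Sigma> \<omega> T C V x = Bstar_ext \<Sigma> (\<Lambda>inv x) (forcing (\<Lambda>inv x))" for x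
    by (simp add: Bstar_U_def Bstar_V_def forcing_def[abs_def])
  show ?thesis unfolding 1 2 3 4 U.dip_def[symmetric] by (rule energy_balance[OF p q])
qed

end

theorem proposition4p2:
  fixes \<Sigma> :: "('k::real_or_complex, 'h::banach, 'u::banach) control_system"
    and T \<omega> t :: real
    and C :: "'h \<Rightarrow> 'h"
    and V :: "real \<Rightarrow> ('h \<Rightarrow>\<^sub>L 'k) \<Rightarrow> ('h \<Rightarrow>\<^sub>L 'k)"
    and x y :: 'h
  assumes "hilbert_space (scaleH \<Sigma>) (ipH \<Sigma>)"
    and "hilbert_space (scaleU \<Sigma>) (ipU \<Sigma>)"
    and "H1 \<Sigma>" and "H2 \<Sigma>" and "H3 \<Sigma>" and "H4 \<Sigma> T"
    and "\<omega> > 0"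
    and "positive_sqrt (scaleH \<Sigma>) (ipH \<Sigma>) (opL \<Sigma> \<omega> T) C"
    and "generates_group scale_dual (dualH \<Sigma>) (domAstar \<Sigma>)
           (\<lambda>z. - opAstar \<Sigma> z - feedback \<Sigma> \<omega> T C z) V"
  shows "pair' (Gramian_inv \<Sigma> \<omega> T x) y =
      pair' (Gramian_inv \<Sigma> \<omega> T (groupU \<Sigma> \<omega> T V t x)) (groupU \<Sigma> \<omega> T V t y)
    + (LBINT s=0..t. pair' (Jtilde \<Sigma> (C (groupU \<Sigma> \<omega> T V s x))) (C (groupU \<Sigma> \<omega> T V s y)))
    + (LBINT s=0..t. pair (J \<Sigma> (Bstar_U \<Sigma> \<omega> T C V x s)) (Bstar_U \<Sigma> \<omega> T C V y s))"
proof -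
  interpret closed_loop \<Sigma> \<omega> T C V
    by (intro closed_loop.intro closed_loop_axioms.intro observed_system.intro observed_system_axioms.intro
        admissible_system.intro admissible_system_axioms.intro group_system.intro assms)
  show ?thesis by (rule balance_in_state_space)
qed

end
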